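(* Let $M$ be a matroid on the ground set $E$, let $B_M(\mathbf{x})$ be its basis generating polynomial, and let $\beta$ be real. (a) If $M=M(K_p)$ [the graphic matroid of the complete graph $K_p$], where $p\ge 2$, and $\beta\notin\{0,\frac12,1,\frac32,\ldots\}\cup[(p-2)/2,\infty)$, then $B_M^{-\beta}$ is not completely monotone on any nonempty open convex subcone of $(0,\infty)^E$. (b, rank 2) If $M=U_{2,4}$ [the uniform matroid of rank 2 on four elements] and $\beta\notin\{0\}\cup[1,\infty)$, then $B_M^{-\beta}$ is not completely monotone on any nonempty open convex subcone of $(0,\infty)^E$. (b, rank 3) If $M=AG(2,3)$ [the ternary affine plane] and $\beta\notin\{0,1\}\cup[2,\infty)$, then $B_M^{-\beta}$ is not completely monotone on any nonempty open convex subcone of $(0,\infty)^E$.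
   Context: $B_M(\mathbf{x})=\sum_{S\in\mathcal{B}(M)}\prod_{e\in S}x_e$, where $\mathcal{B}(M)$ is the set of bases of $M$ and $\mathbf{x}=\{x_e\}_{e\in E}$. $AG(2,3)$ is the rank-3 matroid whose elements are the nine points of the affine plane over the field with three elements and whose bases are the non-collinear triples of points. Let $C$ be an open convex cone in a finite-dimensional real vector space. A $C^\infty$ function $f\colon C\to\mathbb{R}$ is completely monotone on $C$ if for all $k\ge 0$, all $\mathbf{u}_1,\ldots,\mathbf{u}_k\in C$ and all $\mathbf{x}\in C$, one has $(-1)^kD_{\mathbf{u}_1}\cdots D_{\mathbf{u}_k}f(\mathbf{x})\ge 0$, where $D_{\mathbf{u}}$ is the directional derivative. *)

theory Defs
  imports "HOL-Analysis.Analysis" "HOL-Library.Numeral_Type"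
begin

section \<open>Matroids\<close>

record 'e matroid_data =
  ground :: "'e set"
  bases :: "'e set set"

locale matroid =
  fixes M :: "'e matroid_data"
  assumes finite_ground: "finite (ground M)"
    and bases_subset: "S \<in> bases M \<Longrightarrow> S \<subseteq> ground M"
    and bases_nonempty: "bases M \<noteq> {}"
    and basis_exchange:
      "\<lbrakk>S \<in> bases M; T \<in> bases M; a \<in> S - T\<rbrakk>
        \<Longrightarrow> \<exists>b\<in>T - S. insert b (S - {a}) \<in> bases M"

definition matroid_iso :: "'e matroid_data \<Rightarrow> 'f matroid_data \<Rightarrow> bool" where
  "matroid_iso M N \<longleftrightarrow>
    (\<exists>h. bij_betw h (ground M) (ground N) \<and> bases N = (\<lambda>S. h ` S) ` bases M)"

definition uniform_matroid :: "nat \<Rightarrow> nat \<Rightarrow> nat matroid_data" where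
  "uniform_matroid r n =
    \<lparr>ground = {..<n}, bases = {S. S \<subseteq> {..<n} \<and> card S = r}\<rparr>"

text \<open>
  A simple graph is given by its set of edges, an edge being a two-element set of vertices.
  The list \<open>vs\<close> runs through the distinct vertices of a cycle; indices are taken modulo its length.
\<close>

definition has_cycle :: "'v set set \<Rightarrow> bool" where
  "has_cycle F \<longleftrightarrow>
    (\<exists>vs. 3 \<le> length vs \<and> distinct vs \<and>
      (\<forall>i<length vs. {vs ! i, vs ! (Suc i mod length vs)} \<in> F))"

text \<open>
  The bases of the graphic matroid are the maximal forests; for a connected graph such as
  \<open>K\<^sub>p\<close> these are its spanning trees.
\<close>

definition graphic_matroid :: "'v set set \<Rightarrow> 'v set matroid_data" where
  "graphic_matroid E =
    \<lparr>ground = E,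
     bases = {F. F \<subseteq> E \<and> \<not> has_cycle F \<and>
                 (\<forall>F'. F \<subset> F' \<and> F' \<subseteq> E \<longrightarrow> has_cycle F')}\<rparr>"

definition complete_graph_edges :: "nat \<Rightarrow> nat set set" where
  "complete_graph_edges p = {e. e \<subseteq> {..<p} \<and> card e = 2}"

text \<open>
  The type \<open>3\<close> with its ring operations is the integers modulo 3, i.e. the field with three
  elements, so \<open>3 \<times> 3\<close> is the set of points of the affine plane over it.
\<close>

definition affine_line_3 :: "(3 \<times> 3) set \<Rightarrow> bool" where
  "affine_line_3 L \<longleftrightarrow>
    (\<exists>a b c. (a, b) \<noteq> (0, 0) \<and> L = {(x, y). a * x + b * y = c})"

definition AG23 :: "(3 \<times> 3) matroid_data" where
  "AG23 =
    \<lparr>ground = UNIV,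
     bases = {S. card S = 3 \<and> \<not> (\<exists>L. affine_line_3 L \<and> S \<subseteq> L)}\<rparr>"

definition basis_gen_poly :: "'e matroid_data \<Rightarrow> real ^ 'e \<Rightarrow> real" where
  "basis_gen_poly M x = (\<Sum>S\<in>bases M. \<Prod>e\<in>S. x $ e)"


section \<open>Complete monotonicity on cones\<close>

text \<open>
  The library predicates \<^const>\<open>cone\<close> and \<^const>\<open>convex_cone\<close> allow the scalar 0 and hence
  force the origin into every nonempty cone; an open cone is only closed under positive scalars.
\<close>

definition open_convex_cone :: "'a::euclidean_space set \<Rightarrow> bool" where
  "open_convex_cone C \<longleftrightarrow>
    open C \<and> convex C \<and> (\<forall>x\<in>C. \<forall>c>0. c *\<^sub>R x \<in> C)"

fun C_diff_on :: "nat \<Rightarrow> 'a::euclidean_space set \<Rightarrow> ('a \<Rightarrow> real) \<Rightarrow> bool" where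
  "C_diff_on 0 C f \<longleftrightarrow> continuous_on C f"
| "C_diff_on (Suc n) C f \<longleftrightarrow>
    (\<forall>x\<in>C. f differentiable (at x)) \<and>
    (\<forall>v. C_diff_on n C (\<lambda>x. frechet_derivative f (at x) v))"

definition smooth_on :: "'a::euclidean_space set \<Rightarrow> ('a \<Rightarrow> real) \<Rightarrow> bool" where
  "smooth_on C f \<longleftrightarrow> (\<forall>n. C_diff_on n C f)"

definition dir_deriv :: "'a::euclidean_space \<Rightarrow> ('a \<Rightarrow> real) \<Rightarrow> 'a \<Rightarrow> real" where
  "dir_deriv u f x = deriv (\<lambda>t. f (x + t *\<^sub>R u)) 0"

definition completely_monotone_on :: "'a::euclidean_space set \<Rightarrow> ('a \<Rightarrow> real) \<Rightarrow> bool" where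
  "completely_monotone_on C f \<longleftrightarrow>
    smooth_on C f \<and>
    (\<forall>us x. set us \<subseteq> C \<and> x \<in> C \<longrightarrow> 0 \<le> (- 1) ^ length us * foldr dir_deriv us f x)"

definition positive_orthant :: "(real ^ 'e) set" where
  "positive_orthant = {x. \<forall>e. 0 < x $ e}"

end

theory Submission
  imports Defs "Jordan_Normal_Form.Determinant"
begin

no_notation vec_index (infixl "$" 100)

text \<open>
  In each case \<open>c B\<^sub>M(x) = det X(x)\<close> for a constant \<open>c\<close> and \<open>X(x) = \<Sum>\<^sub>e x\<^sub>e v\<^sub>e v\<^sub>e\<^sup>*\<close>: for \<open>K\<^sub>p\<close> this is the
  reduced Laplacian (matrix-tree theorem), for \<open>U\<^sub>2\<^sub>,\<^sub>4\<close> and \<open>AG(2,3)\<close> the \<open>v\<^sub>e\<close> have entries in the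
  Eisenstein integers, and the \<open>v\<^sub>e v\<^sub>e\<^sup>*\<close> span all symmetric, respectively Hermitian, matrices.

  A completely monotone function \<open>f\<close> on a cone is positive definite there,
  \<open>\<Sum>\<^sub>a\<^sub>b c\<^sub>a c\<^sub>b f(x + u\<^sub>a + u\<^sub>b) \<ge> 0\<close>; letting difference quotients tend to derivatives,
  \<open>q(\<partial>)\<^sup>2 f \<ge> 0\<close> for every homogeneous polynomial \<open>q\<close> (\<open>q\<close> times its conjugate if the coefficients are
  complex). For \<open>q\<close> the leading \<open>r \<times> r\<close> minor, the Cayley identity
  \<open>q(\<partial>) det(X)\<^sup>s = (\<Prod>\<^sub>i\<^sub><\<^sub>r s + \<kappa> i) det(X)\<^sup>s q(X\<^sup>-\<^sup>1)\<close> with \<open>\<kappa> = 1/2\<close> (symmetric) or \<open>\<kappa> = 1\<close> (Hermitian), applied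
  twice, gives \<open>q(\<partial>)\<^sup>2 f = (\<Prod>\<^sub>i\<^sub><\<^sub>r (\<beta> - \<kappa> i)(\<beta> + 1 - \<kappa> i)) f q(X\<^sup>-\<^sup>1)\<^sup>2\<close> for \<open>f = det(X)\<^sup>-\<^sup>\<beta>\<close>. If \<open>\<beta> > 0\<close> is one
  of the excluded exponents, some \<open>r\<close> makes the product negative. If \<open>\<beta> < 0\<close>, then \<open>f\<close> increases along rays.
\<close>

section \<open>Determinants as sums over permutations\<close>

no_notation vec_index (infixl "$" 100)

text \<open>The coordinate directions need not lie in \<open>C\<close>, so complete monotonicity is
  silent about the derivatives along them. Positive definiteness removes this obstacle: it involves
  only values of f at points of the cone, and an open cone leaves room for small steps in every
  direction around such points. The choice of r comes from telescoping, since 1 is a multiple of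
  \<kappa>. For \<kappa> = 1 the product over i < r is \<beta> + 1 times the squares of the \<beta>
  - i with i < r - 1, times the single unpaired factor \<beta> - (r - 1); hence r = n serves every
  nonintegral \<beta> between 0 and n - 1. For \<kappa> = 1/2 two factors stay unpaired, \<beta> -
  (r - 2)/2 and \<beta> - (r - 1)/2, so \<beta> must lie strictly between (r - 2)/2 and (r - 1)/2.
  This dictates r, and r \<le> n = p - 1 produces the bound (p - 2)/2. At the exempted integers or
  half-integers the product is never negative. Matrices are functions of two naturals, so that the
  leading minor of order r is \<open>pdet r\<close> of the same function.\<close>

definition pdet :: "nat \<Rightarrow> (nat \<Rightarrow> nat \<Rightarrow> 'a::comm_ring_1) \<Rightarrow> 'a" where
  "pdet n A = (\<Sum>\<sigma> | \<sigma> permutes {..<n}. of_int (sign \<sigma>) * (\<Prod>i<n. A i (\<sigma> i)))"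

text \<open>Composition with a transposition is a sign-reversing bijection of the symmetric group.
  Both the vanishing for equal rows and the terms from differentiating an entry in the Cayley
  identity rest on this.\<close>

lemma sum_permutes_transpose:
  fixes F :: "(nat \<Rightarrow> nat) \<Rightarrow> 'a::comm_ring_1"
  assumes "i < n" "k < n" "i \<noteq> k"
  shows "(\<Sum>\<sigma> | \<sigma> permutes {..<n}. of_int (sign \<sigma>) * F \<sigma>)
       = - (\<Sum>\<sigma> | \<sigma> permutes {..<n}. of_int (sign \<sigma>) * F (\<sigma> \<circ> Transposition.transpose i k))"
proof -
  let ?q = "Transposition.transpose i k"
  have q: "?q permutes {..<n}"
    using assms by (intro permutes_swap_id) auto
  have s: "sign (\<sigma> \<circ> ?q) = - sign \<sigma>" if "\<sigma> permutes {..<n}" for \<sigma> :: "nat \<Rightarrow> nat"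
  proof -
    have "permutation \<sigma>" "permutation ?q"
      using that q permutation_permutes by blast+
    then show ?thesis
      using assms(3) by (simp add: sign_compose sign_swap_id)
  qed
  have "(\<Sum>\<sigma> | \<sigma> permutes {..<n}. of_int (sign \<sigma>) * F \<sigma>)
     = (\<Sum>\<sigma> | \<sigma> permutes {..<n}. of_int (sign (\<sigma> \<circ> ?q)) * F (\<sigma> \<circ> ?q))"
    by (rule sum_permutations_compose_right[OF q])
  also have "\<dots> = (\<Sum>\<sigma> | \<sigma> permutes {..<n}. - (of_int (sign \<sigma>) * F (\<sigma> \<circ> ?q)))"
    by (intro sum.cong) (auto simp: s)
  finally show ?thesis by (simp add: sum_negf)
qed

lemma pdet_cong: "(\<And>i j. i < n \<Longrightarrow> j < n \<Longrightarrow> A i j = B i j) \<Longrightarrow> pdet n A = pdet n B"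
  unfolding pdet_def by (intro sum.cong arg_cong2[of _ _ _ _ "(*)"] prod.cong) (auto dest: permutes_in_image)

lemma pdet_transpose: "pdet n (\<lambda>i j. A j i) = pdet n A"
proof -
  have "pdet n A = (\<Sum>\<sigma> | \<sigma> permutes {..<n}. of_int (sign (Hilbert_Choice.inv \<sigma>)) * (\<Prod>i<n. A i (Hilbert_Choice.inv \<sigma> i)))"
    unfolding pdet_def by (rule sum_permutations_inverse)
  also have "\<dots> = (\<Sum>\<sigma> | \<sigma> permutes {..<n}. of_int (sign \<sigma>) * (\<Prod>i<n. A (\<sigma> i) i))"
  proof (intro sum.cong refl arg_cong2[of _ _ _ _ "(*)"])
    fix \<sigma> assume "\<sigma> \<in> {\<sigma>. \<sigma> permutes {..<n}}"
    then have p: "\<sigma> permutes {..<n}" by simp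
    then show "of_int (sign (Hilbert_Choice.inv \<sigma>)) = (of_int (sign \<sigma>) :: 'a)"
      using permutation_permutes sign_inverse by (metis finite_lessThan)
    show "(\<Prod>i<n. A i (Hilbert_Choice.inv \<sigma> i)) = (\<Prod>i<n. A (\<sigma> i) i)"
      by (subst prod.permute[OF p]) (simp add: permutes_inverses[OF p])
  qed
  finally show ?thesis by (simp add: pdet_def)
qed

lemma prod_replace_row:
  fixes A :: "nat \<Rightarrow> nat \<Rightarrow> 'a::comm_ring_1"
  assumes "i < n"
  shows "(\<Prod>k<n. (if k = i then a else A k) (\<sigma> k)) = a (\<sigma> i) * (\<Prod>k\<in>{..<n}-{i}. A k (\<sigma> k))"
proof -
  have "(\<Prod>k<n. (if k = i then a else A k) (\<sigma> k))
    = (if i = i then a else A i) (\<sigma> i) * (\<Prod>k\<in>{..<n}-{i}. (if k = i then a else A k) (\<sigma> k))"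
    using assms by (intro prod.remove) auto
  then show ?thesis by simp
qed

lemma pdet_row:
  assumes "i < n"
  shows "pdet n (\<lambda>k. if k = i then a else A k)
    = (\<Sum>\<sigma> | \<sigma> permutes {..<n}. of_int (sign \<sigma>) * (a (\<sigma> i) * (\<Prod>k\<in>{..<n}-{i}. A k (\<sigma> k))))"
  unfolding pdet_def by (subst prod_replace_row[OF assms]) simp

lemma pdet_row_sum:
  assumes "i < n"
  shows "pdet n (\<lambda>k. if k = i then (\<lambda>j. \<Sum>l\<in>L. c l * a l j) else A k)
    = (\<Sum>l\<in>L. c l * pdet n (\<lambda>k. if k = i then a l else A k))"
proof -
  have "pdet n (\<lambda>k. if k = i then (\<lambda>j. \<Sum>l\<in>L. c l * a l j) else A k)
    = (\<Sum>\<sigma> | \<sigma> permutes {..<n}. \<Sum>l\<in>L. c l * (of_int (sign \<sigma>) * (a l (\<sigma> i) * (\<Prod>k\<in>{..<n}-{i}. A k (\<sigma> k)))))"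
    unfolding pdet_row[OF assms] by (intro sum.cong) (auto simp: sum_distrib_left sum_distrib_right mult_ac)
  also have "\<dots> = (\<Sum>l\<in>L. c l * pdet n (\<lambda>k. if k = i then a l else A k))"
    unfolding pdet_row[OF assms] by (subst sum.swap) (simp add: sum_distrib_left)
  finally show ?thesis .
qed

text \<open>Swapping the two equal rows leaves every product unchanged and flips its sign, so the
  determinant is its own negative; characteristic 0 without zero divisors cancels the factor
  2.\<close>

lemma pdet_identical_rows:
  fixes A :: "nat \<Rightarrow> nat \<Rightarrow> 'a::{comm_ring_1,ring_char_0,semiring_no_zero_divisors}"
  assumes "i < n" "k < n" "i \<noteq> k" "A i = A k"
  shows "pdet n A = 0"
proof -
  let ?q = "Transposition.transpose i k"
  have q: "?q permutes {..<n}"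
    using assms by (intro permutes_swap_id) auto
  have "(\<Prod>l<n. A l ((\<sigma> \<circ> ?q) l)) = (\<Prod>l<n. A l (\<sigma> l))" for \<sigma>
  proof -
    have Aq: "A (?q l) = A l" for l
      using assms(4) by (auto simp: Transposition.transpose_def)
    have "(\<Prod>l<n. A l (\<sigma> l)) = (\<Prod>l<n. A (?q l) (\<sigma> (?q l)))"
      using prod.permute[OF q, of "\<lambda>l. A l (\<sigma> l)"] by (simp add: o_def)
    then show ?thesis by (simp add: Aq)
  qed
  then have "pdet n A = - pdet n A"
    using sum_permutes_transpose[OF assms(1-3), of "\<lambda>\<sigma>. \<Prod>l<n. A l (\<sigma> l)"] by (simp add: pdet_def)
  then have "2 * pdet n A = 0"
    by (subst mult_2, subst (1) \<open>pdet n A = - pdet n A\<close>) (rule add.left_inverse)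
  then show ?thesis by simp
qed

lemma pdet_row_other:
  fixes A :: "nat \<Rightarrow> nat \<Rightarrow> 'a::{comm_ring_1,ring_char_0,semiring_no_zero_divisors}"
  assumes "i < n" "l < n"
  shows "pdet n (\<lambda>k. if k = i then A l else A k) = (if l = i then pdet n A else 0)"
proof (cases "l = i")
  case True
  then show ?thesis by (auto intro!: pdet_cong)
next
  case False
  then show ?thesis using assms pdet_identical_rows[of i n l "\<lambda>k. if k = i then A l else A k"] by auto
qed

text \<open>The adjugate, with its entry (j, i) written as the determinant in which row i is
  replaced by the j-th unit vector.\<close>

definition padj :: "nat \<Rightarrow> (nat \<Rightarrow> nat \<Rightarrow> 'a::comm_ring_1) \<Rightarrow> nat \<Rightarrow> nat \<Rightarrow> 'a" where
  "padj n A j i = pdet n (\<lambda>k. if k = i then (\<lambda>l. of_bool (l = j)) else A k)"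

lemma pdet_row_padj:
  assumes "i < n"
  shows "pdet n (\<lambda>k. if k = i then a else A k) = (\<Sum>j<n. a j * padj n A j i)"
proof -
  have "pdet n (\<lambda>k. if k = i then a else A k)
      = pdet n (\<lambda>k. if k = i then (\<lambda>m. \<Sum>j<n. a j * of_bool (m = j)) else A k)"
    using assms by (intro pdet_cong) (simp add: of_bool_def if_distrib[of "\<lambda>x. _ * x"] cong: if_cong)
  also have "\<dots> = (\<Sum>j<n. a j * padj n A j i)"
    unfolding padj_def by (rule pdet_row_sum[OF assms])
  finally show ?thesis .
qed

lemma mult_padj:
  fixes A :: "nat \<Rightarrow> nat \<Rightarrow> 'a::{comm_ring_1,ring_char_0,semiring_no_zero_divisors}"
  assumes "i < n" "l < n"
  shows "(\<Sum>j<n. A l j * padj n A j i) = (if l = i then pdet n A else 0)"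
  by (rule trans[OF pdet_row_padj[OF assms(1), symmetric] pdet_row_other[OF assms]])

text \<open>Transferred from the matrices of \<open>Jordan_Normal_Form\<close>. It serves twice: for
  minors of the inverse of a positive definite matrix, and for parent functions that contain a
  cycle.\<close>

lemma pdet_eq_0_iff:
  fixes A :: "nat \<Rightarrow> nat \<Rightarrow> 'a::idom"
  shows "pdet n A = 0 \<longleftrightarrow> (\<exists>u. (\<exists>k<n. u k \<noteq> 0) \<and> (\<forall>i<n. (\<Sum>j<n. A i j * u j) = 0))"
proof -
  let ?A = "Matrix.mat n n (\<lambda>(i, j). A i j)"
  have carr: "?A \<in> carrier_mat n n" by simp
  have "pdet n A = Determinant.det ?A"
    unfolding pdet_def det_def'[OF carr] lessThan_atLeast0
    by (intro sum.cong arg_cong2[of _ _ _ _ "(*)"] prod.cong) (auto dest: permutes_in_image)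
  then have "pdet n A = 0 \<longleftrightarrow> (\<exists>v. v \<in> carrier_vec n \<and> v \<noteq> 0\<^sub>v n \<and> ?A *\<^sub>v v = 0\<^sub>v n)"
    using det_0_iff_vec_prod_zero[OF carr] by simp
  also have "\<dots> \<longleftrightarrow> (\<exists>u. (\<exists>k<n. u k \<noteq> 0) \<and> (\<forall>i<n. (\<Sum>j<n. A i j * u j) = 0))"
  proof
    assume "\<exists>v. v \<in> carrier_vec n \<and> v \<noteq> 0\<^sub>v n \<and> ?A *\<^sub>v v = 0\<^sub>v n"
    then obtain v where v: "v \<in> carrier_vec n" "v \<noteq> 0\<^sub>v n" "?A *\<^sub>v v = 0\<^sub>v n" by blast
    have "(\<Sum>j<n. A i j * vec_index v j) = 0" if "i < n" for i
    proof -
      have "vec_index (?A *\<^sub>v v) i = (\<Sum>j<n. A i j * vec_index v j)"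
        using that v(1) by (auto simp: scalar_prod_def lessThan_atLeast0 intro!: sum.cong)
      then show ?thesis using v(3) that by simp
    qed
    moreover have "\<exists>k<n. vec_index v k \<noteq> 0"
      using v(1,2) by (metis carrier_vecD eq_vecI index_zero_vec)
    ultimately show "\<exists>u. (\<exists>k<n. u k \<noteq> 0) \<and> (\<forall>i<n. (\<Sum>j<n. A i j * u j) = 0)" by blast
  next
    assume "\<exists>u. (\<exists>k<n. u k \<noteq> 0) \<and> (\<forall>i<n. (\<Sum>j<n. A i j * u j) = 0)"
    then obtain u k where u: "k < n" "u k \<noteq> 0" "\<And>i. i < n \<Longrightarrow> (\<Sum>j<n. A i j * u j) = 0" by blast
    have "?A *\<^sub>v Matrix.vec n u = 0\<^sub>v n"
    proof (rule eq_vecI)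
      fix i assume "i < dim_vec (0\<^sub>v n :: 'a Matrix.vec)"
      then have "i < n" by simp
      then have "vec_index (?A *\<^sub>v Matrix.vec n u) i = (\<Sum>j<n. A i j * u j)"
        by (auto simp: scalar_prod_def lessThan_atLeast0 intro!: sum.cong)
      then show "vec_index (?A *\<^sub>v Matrix.vec n u) i = vec_index (0\<^sub>v n) i" using u(3) \<open>i < n\<close> by simp
    qed simp
    moreover have "Matrix.vec n u \<noteq> 0\<^sub>v n"
      using u(1,2) by (metis index_vec index_zero_vec(1))
    ultimately show "\<exists>v. v \<in> carrier_vec n \<and> v \<noteq> 0\<^sub>v n \<and> ?A *\<^sub>v v = 0\<^sub>v n"
      using vec_carrier by blast
  qed
  finally show ?thesis .
qed

lemma pdet_scale: "pdet n (\<lambda>i j. c * A i j) = c ^ n * pdet n A"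
  unfolding pdet_def by (simp add: prod.distrib sum_distrib_left mult_ac)

section \<open>Finite differences\<close>

fun fdiff :: "'a::real_vector list \<Rightarrow> ('a \<Rightarrow> real) \<Rightarrow> 'a \<Rightarrow> real" where
  "fdiff [] f x = f x"
| "fdiff (v # vs) f x = fdiff vs f (x + v) - fdiff vs f x"

lemma fdiff_diff: "fdiff vs (\<lambda>x. f x - g x) x = fdiff vs f x - fdiff vs g x"
  by (induction vs arbitrary: x) auto

lemma fdiff_shift: "fdiff vs (\<lambda>x. f (x + v)) x = fdiff vs f (x + v)"
  by (induction vs arbitrary: x) (auto simp: algebra_simps)

lemma fdiff_append: "fdiff (us @ vs) f x = fdiff us (fdiff vs f) x"
  by (induction us arbitrary: x) auto

section \<open>Smooth functions, directional derivatives and the mean value theorem for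
  differences\<close>

lemma frechet_derivative_cong_open:
  assumes "open C" "x \<in> C" "\<And>y. y \<in> C \<Longrightarrow> f y = g y"
  shows "frechet_derivative f (at x) = frechet_derivative g (at x)"
proof -
  have "(f has_derivative D) (at x) \<longleftrightarrow> (g has_derivative D) (at x)" for D
    using assms by (metis has_derivative_transform_within_open)
  then show ?thesis by (simp add: frechet_derivative_def)
qed

lemma differentiable_cong_open:
  assumes "open C" "x \<in> C" "\<And>y. y \<in> C \<Longrightarrow> f y = g y" "f differentiable (at x)"
  shows "g differentiable (at x)"
  using assms unfolding differentiable_def by (metis has_derivative_transform_within_open)

text \<open>Derivatives depend only on values near the point. This is needed because
  \<open>dir_deriv\<close> and the Frechet derivative are known to agree only on C, where f is
  differentiable.\<close>

lemma C_diff_on_cong: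
  assumes "open C" "\<And>y. y \<in> C \<Longrightarrow> f y = g y" "C_diff_on n C f"
  shows "C_diff_on n C g"
  using assms(2,3)
proof (induction n arbitrary: f g)
  case 0
  then show ?case by (simp cong: continuous_on_cong)
next
  case (Suc n)
  have "g differentiable (at x)" if "x \<in> C" for x
    using Suc.prems that by (auto intro: differentiable_cong_open[OF assms(1), of _ f])
  moreover have "C_diff_on n C (\<lambda>x. frechet_derivative g (at x) v)" for v
  proof (rule Suc.IH)
    show "frechet_derivative f (at y) v = frechet_derivative g (at y) v" if "y \<in> C" for y
      using frechet_derivative_cong_open[OF assms(1) that, of f g] Suc.prems(1) by metis
    show "C_diff_on n C (\<lambda>x. frechet_derivative f (at x) v)" using Suc.prems(2) by auto
  qed
  ultimately show ?case by auto
qed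

lemma smooth_on_differentiable: "smooth_on C f \<Longrightarrow> x \<in> C \<Longrightarrow> f differentiable (at x)"
  unfolding smooth_on_def using C_diff_on.simps(2) by blast

lemma dir_deriv_line:
  assumes "f differentiable (at (x + \<tau> *\<^sub>R v))"
  shows "((\<lambda>\<tau>. f (x + \<tau> *\<^sub>R v)) has_real_derivative frechet_derivative f (at (x + \<tau> *\<^sub>R v)) v) (at \<tau>)"
proof -
  let ?D = "frechet_derivative f (at (x + \<tau> *\<^sub>R v))"
  have D: "(f has_derivative ?D) (at (x + \<tau> *\<^sub>R v))"
    using assms frechet_derivative_works by blast
  have "((\<lambda>\<tau>. f (x + \<tau> *\<^sub>R v)) has_derivative (\<lambda>h. ?D (h *\<^sub>R v))) (at \<tau>)"
    by (rule has_derivative_compose[of "\<lambda>\<tau>. x + \<tau> *\<^sub>R v" "\<lambda>h. h *\<^sub>R v" \<tau> UNIV f, OF _ D])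
       (auto intro!: derivative_eq_intros)
  moreover have "?D (h *\<^sub>R v) = ?D v * h" for h
    using has_derivative_linear[OF D] by (simp add: linear_cmul)
  ultimately show ?thesis by (simp add: has_field_derivative_def)
qed

lemma dir_deriv_frechet:
  assumes "f differentiable (at x)"
  shows "dir_deriv v f x = frechet_derivative f (at x) v"
  unfolding dir_deriv_def using dir_deriv_line[of f x 0 v] assms by (simp add: DERIV_imp_deriv)

lemma dir_deriv_has_derivative:
  assumes "smooth_on C f" "x + \<tau> *\<^sub>R v \<in> C"
  shows "((\<lambda>\<tau>. f (x + \<tau> *\<^sub>R v)) has_real_derivative dir_deriv v f (x + \<tau> *\<^sub>R v)) (at \<tau>)"
  using dir_deriv_line[of f x \<tau> v] dir_deriv_frechet[of f "x + \<tau> *\<^sub>R v"] smooth_on_differentiable[OF assms] by simp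

lemma smooth_on_dir_deriv:
  assumes "open C" "smooth_on C f"
  shows "smooth_on C (dir_deriv v f)"
  unfolding smooth_on_def
proof
  fix n
  have "C_diff_on n C (\<lambda>x. frechet_derivative f (at x) v)"
    using assms(2) unfolding smooth_on_def by (metis C_diff_on.simps(2))
  then show "C_diff_on n C (dir_deriv v f)"
    by (rule C_diff_on_cong[OF assms(1), rotated])
       (simp add: dir_deriv_frechet smooth_on_differentiable[OF assms(2)])
qed

lemma smooth_on_iterated_dir_deriv:
  "open C \<Longrightarrow> smooth_on C f \<Longrightarrow> smooth_on C (foldr dir_deriv us f)"
  by (induction us) (auto intro: smooth_on_dir_deriv)

lemma smooth_on_continuous: "smooth_on C f \<Longrightarrow> continuous_on C f"
  unfolding smooth_on_def using C_diff_on.simps(1) by blast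

text \<open>The zonotope spanned by the steps \<open>h *\<^sub>R v\<close>. It contains every
  displacement at which the iterated mean value theorem may evaluate a derivative.\<close>

fun box_sums :: "real \<Rightarrow> 'a::real_vector list \<Rightarrow> 'a set" where
  "box_sums h [] = {0}"
| "box_sums h (v # vs) = {(h * \<theta>) *\<^sub>R v + y |\<theta> y. 0 \<le> \<theta> \<and> \<theta> \<le> 1 \<and> y \<in> box_sums h vs}"

lemma fdiff_has_derivative:
  assumes "smooth_on C f" "\<And>y. y \<in> box_sums h vs \<Longrightarrow> x + \<tau> *\<^sub>R v + y \<in> C" "0 \<le> h"
  shows "((\<lambda>\<tau>. fdiff (map (scaleR h) vs) f (x + \<tau> *\<^sub>R v)) has_real_derivative
      fdiff (map (scaleR h) vs) (dir_deriv v f) (x + \<tau> *\<^sub>R v)) (at \<tau>)"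
  using assms(2)
proof (induction vs arbitrary: x)
  case Nil
  then show ?case using dir_deriv_has_derivative[OF assms(1)] by auto
next
  case (Cons u us)
  have a: "x + \<tau> *\<^sub>R v + y \<in> C" if "y \<in> box_sums h us" for y
  proof -
    have "y \<in> box_sums h (u # us)" using that by (force intro: exI[of _ 0])
    then show ?thesis using Cons.prems by blast
  qed
  have b: "(x + h *\<^sub>R u) + \<tau> *\<^sub>R v + y \<in> C" if "y \<in> box_sums h us" for y
  proof -
    have "h *\<^sub>R u + y \<in> box_sums h (u # us)" using that by (force intro: exI[of _ 1])
    then have "x + \<tau> *\<^sub>R v + (h *\<^sub>R u + y) \<in> C" using Cons.prems by blast
    then show ?thesis by (simp add: algebra_simps)
  qed
  show ?case
    using DERIV_diff[OF Cons.IH[OF b] Cons.IH[OF a]] by (simp add: algebra_simps)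
qed

text \<open>The outermost difference is a one-variable increment of the remaining differences, so
  the ordinary mean value theorem trades it for h times a derivative along v; induction continues
  with \<open>dir_deriv v f\<close>. Derivatives thus accumulate in the opposite order, whence
  \<open>rev vs\<close>.\<close>

lemma fdiff_mean_value:
  assumes "open C" "smooth_on C f" "\<And>y. y \<in> box_sums h vs \<Longrightarrow> x + y \<in> C" "0 < h"
  shows "\<exists>y\<in>box_sums h vs. fdiff (map (scaleR h) vs) f x = h ^ length vs * foldr dir_deriv (rev vs) f (x + y)"
  using assms(2,3)
proof (induction vs arbitrary: f x)
  case Nil
  then show ?case by simp
next
  case (Cons v vs)
  let ?g = "\<lambda>\<tau>. fdiff (map (scaleR h) vs) f (x + \<tau> *\<^sub>R v)"
  have mem: "x + \<tau> *\<^sub>R v + y \<in> C" if "0 \<le> \<tau>" "\<tau> \<le> h" "y \<in> box_sums h vs" for \<tau> y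
  proof -
    have "\<tau> *\<^sub>R v + y \<in> box_sums h (v # vs)"
      using that assms(4) by (force intro: exI[of _ "\<tau> / h"])
    then have "x + (\<tau> *\<^sub>R v + y) \<in> C" using Cons.prems by blast
    then show ?thesis by (simp add: algebra_simps)
  qed
  have "\<exists>z>0. z < h \<and> ?g h - ?g 0 = (h - 0) * fdiff (map (scaleR h) vs) (dir_deriv v f) (x + z *\<^sub>R v)"
    using assms(4) by (intro MVT2) (auto intro!: fdiff_has_derivative[OF Cons.prems(1)] mem)
  then obtain z where z: "0 < z" "z < h"
    and eq: "?g h - ?g 0 = h * fdiff (map (scaleR h) vs) (dir_deriv v f) (x + z *\<^sub>R v)" by auto
  obtain y where y: "y \<in> box_sums h vs"
    and eq2: "fdiff (map (scaleR h) vs) (dir_deriv v f) (x + z *\<^sub>R v)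
      = h ^ length vs * foldr dir_deriv (rev vs) (dir_deriv v f) (x + z *\<^sub>R v + y)"
    using Cons.IH[OF smooth_on_dir_deriv[OF assms(1) Cons.prems(1)], of "x + z *\<^sub>R v" v] mem z by fastforce
  have "z *\<^sub>R v + y \<in> box_sums h (v # vs)"
    using y z by (force intro: exI[of _ "z / h"])
  moreover have "fdiff (map (scaleR h) (v # vs)) f x
    = h ^ length (v # vs) * foldr dir_deriv (rev (v # vs)) f (x + (z *\<^sub>R v + y))"
    using eq eq2 by (simp add: algebra_simps)
  ultimately show ?case by blast
qed

lemma box_sums_norm:
  assumes "y \<in> box_sums h vs" "0 \<le> h"
  shows "norm y \<le> h * sum_list (map norm vs)"
  using assms(1)
proof (induction vs arbitrary: y)
  case (Cons v vs)
  then obtain \<theta> z where y: "y = (h * \<theta>) *\<^sub>R v + z" "0 \<le> \<theta>" "\<theta> \<le> 1" "z \<in> box_sums h vs" by auto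
  have "norm y \<le> h * \<theta> * norm v + norm z"
    using y assms(2) by (metis norm_triangle_ineq norm_scaleR abs_of_nonneg mult_nonneg_nonneg)
  also have "\<dots> \<le> h * norm v + h * sum_list (map norm vs)"
  proof (rule add_mono)
    have "h * \<theta> \<le> h * 1" using y assms(2) by (intro mult_left_mono) auto
    then show "h * \<theta> * norm v \<le> h * norm v" by (intro mult_right_mono) auto
    show "norm z \<le> h * sum_list (map norm vs)" by (rule Cons.IH[OF y(4)])
  qed
  finally show ?case by (simp add: algebra_simps)
qed auto

text \<open>The quotient equals the iterated derivative at a point whose distance from x is at most
  h times the sum of the norms of the steps, so continuity of that derivative suffices.\<close>

lemma fdiff_quotient_tendsto:
  assumes "open C" "smooth_on C f" "x \<in> C"
  shows "((\<lambda>h. fdiff (map (scaleR h) vs) f x / h ^ length vs) \<longlongrightarrow> foldr dir_deriv (rev vs) f x) (at_right 0)"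
proof (rule tendstoI)
  fix e :: real assume "e > 0"
  let ?D = "foldr dir_deriv (rev vs) f"
  let ?s = "sum_list (map norm vs)"
  have s0: "0 \<le> ?s" by (induction vs) auto
  have "continuous_on C ?D"
    using smooth_on_continuous[OF smooth_on_iterated_dir_deriv[OF assms(1,2)]] .
  then have "isCont ?D x"
    using assms(1,3) continuous_on_eq_continuous_at by blast
  then obtain d1 where d1: "d1 > 0" "\<And>y. dist y x < d1 \<Longrightarrow> dist (?D y) (?D x) < e"
    using \<open>e > 0\<close> unfolding continuous_at_eps_delta by (metis dist_norm)
  obtain d2 where d2: "d2 > 0" "\<And>y. dist y x < d2 \<Longrightarrow> y \<in> C"
    using assms(1,3) by (meson open_dist)
  define d where "d = min d1 d2"
  have d0: "d > 0" using d1 d2 by (simp add: d_def)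
  \<comment> \<open>The summand 1 keeps the denominator positive when all directions vanish.\<close>
  have "\<forall>h. 0 < h \<and> h < d / (?s + 1) \<longrightarrow> dist (fdiff (map (scaleR h) vs) f x / h ^ length vs) (?D x) < e"
  proof (intro allI impI)
    fix h assume h: "0 < h \<and> h < d / (?s + 1)"
    have near: "dist (x + y) x < d" if "y \<in> box_sums h vs" for y
    proof -
      have "norm y \<le> h * ?s" using box_sums_norm[OF that] h by simp
      also have "\<dots> < h * (?s + 1)" using h by simp
      also have "\<dots> < d" using h s0 by (simp add: field_simps)
      finally show ?thesis by (simp add: dist_norm)
    qed
    then have "x + y \<in> C" if "y \<in> box_sums h vs" for y using that d2(2) by (force simp: d_def)
    then obtain y where "y \<in> box_sums h vs" "fdiff (map (scaleR h) vs) f x = h ^ length vs * ?D (x + y)"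
      using fdiff_mean_value[OF assms(1,2)] h by blast
    then show "dist (fdiff (map (scaleR h) vs) f x / h ^ length vs) (?D x) < e"
      using near d1(2) h by (force simp: d_def)
  qed
  then show "eventually (\<lambda>h. dist (fdiff (map (scaleR h) vs) f x / h ^ length vs) (?D x) < e) (at_right 0)"
    using d0 s0 by (auto simp: eventually_at_right_field intro!: exI[of _ "d / (?s + 1)"])
qed

section \<open>Positive definiteness of completely monotone functions\<close>

text \<open>Complete monotonicity in terms of differences. It passes from f to
  \<open>\<lambda>x. f (x + u)\<close> and to \<open>\<lambda>x. f x - f (x + u)\<close> for u in C,
  the two pieces into which the second moment induction splits f.\<close>

definition alternating_on :: "'a::euclidean_space set \<Rightarrow> ('a \<Rightarrow> real) \<Rightarrow> bool" where
  "alternating_on C f \<longleftrightarrow> (\<forall>us x. set us \<subseteq> C \<and> x \<in> C \<longrightarrow> 0 \<le> (-1) ^ length us * fdiff us f x)"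

lemma cone_add:
  assumes "open_convex_cone C" "x \<in> C" "y \<in> C"
  shows "x + y \<in> C"
proof -
  have "(1/2) *\<^sub>R x + (1/2) *\<^sub>R y \<in> C"
    using assms unfolding open_convex_cone_def by (intro convexD) auto
  then have "2 *\<^sub>R ((1/2) *\<^sub>R x + (1/2) *\<^sub>R y) \<in> C"
    using assms unfolding open_convex_cone_def by (metis zero_less_numeral)
  then show ?thesis by (simp add: scaleR_add_right)
qed

lemma cone_add_box_sums:
  assumes "open_convex_cone C" "x \<in> C" "set us \<subseteq> C" "y \<in> box_sums 1 us"
  shows "x + y \<in> C"
  using assms(2-)
proof (induction us arbitrary: x y)
  case (Cons u us)
  then obtain \<theta> z where y: "y = \<theta> *\<^sub>R u + z" "0 \<le> \<theta>" "z \<in> box_sums 1 us" by auto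
  have "x + \<theta> *\<^sub>R u \<in> C"
  \<comment> \<open>The zero multiple is treated apart because an open cone need not contain the
    origin.\<close>
  proof (cases "\<theta> = 0")
    case False
    then have "\<theta> *\<^sub>R u \<in> C" using y Cons.prems assms(1) by (auto simp: open_convex_cone_def)
    then show ?thesis using cone_add assms(1) Cons.prems by blast
  qed (use Cons.prems in auto)
  then show ?case using Cons.IH[of "x + \<theta> *\<^sub>R u" z] Cons.prems y by (auto simp: algebra_simps)
qed auto

text \<open>With step size 1 the mean value form turns a difference along cone directions into an
  iterated derivative along the same directions at a point x + y, and adding a box sum of cone
  directions does not leave the cone.\<close>

lemma completely_monotone_alternating:
  assumes "open_convex_cone C" "completely_monotone_on C f"
  shows "alternating_on C f"
  unfolding alternating_on_def
proof (intro allI impI)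
  fix us x assume *: "set us \<subseteq> C \<and> x \<in> C"
  have "smooth_on C f" "open C"
    using assms by (auto simp: completely_monotone_on_def open_convex_cone_def)
  then obtain y where y: "y \<in> box_sums 1 us" "fdiff us f x = foldr dir_deriv (rev us) f (x + y)"
    using fdiff_mean_value[of C f 1 us x] cone_add_box_sums[OF assms(1)] *
    by (auto simp: map_idI[of us "scaleR 1"])
  have "x + y \<in> C" using cone_add_box_sums[OF assms(1)] * y by blast
  then have "0 \<le> (-1) ^ length (rev us) * foldr dir_deriv (rev us) f (x + y)"
    using assms(2) * unfolding completely_monotone_on_def by (metis set_rev)
  then show "0 \<le> (-1) ^ length us * fdiff us f x" by (simp add: y)
qed

lemma alternating_on_shift:
  assumes "open_convex_cone C" "alternating_on C f" "u \<in> C"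
  shows "alternating_on C (\<lambda>x. f (x + u))"
  using assms cone_add unfolding alternating_on_def fdiff_shift by blast

lemma alternating_on_diff:
  assumes "alternating_on C f" "u \<in> C"
  shows "alternating_on C (\<lambda>x. f x - f (x + u))"
  unfolding alternating_on_def
proof (intro allI impI)
  fix us x assume *: "set us \<subseteq> C \<and> x \<in> C"
  then have "0 \<le> (-1) ^ length (u # us) * fdiff (u # us) f x"
    using assms unfolding alternating_on_def by (metis insert_subset list.simps(15))
  then show "0 \<le> (-1) ^ length us * fdiff us (\<lambda>x. f x - f (x + u)) x"
    by (simp add: fdiff_diff fdiff_shift algebra_simps)
qed

text \<open>With \<open>T\<^sub>i\<close> the translation by \<open>u i\<close>, the expression is the second moment of
  \<open>c0 + \<Sum>\<^sub>i c\<^sub>i X\<^sub>i\<close> for formally independent Bernoulli variables \<open>X\<^sub>i\<close> with parameters \<open>T\<^sub>i\<close>; the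
  induction conditions on one \<open>X\<^sub>i\<close> at a time.\<close>
lemma alternating_second_moment:
  fixes c :: "'i \<Rightarrow> real" and u :: "'i \<Rightarrow> 'a::euclidean_space"
  assumes C: "open_convex_cone C" and "finite I" "alternating_on C f" "\<And>i. i \<in> I \<Longrightarrow> u i \<in> C" "x \<in> C"
  shows "0 \<le> c0\<^sup>2 * f x + 2 * c0 * (\<Sum>i\<in>I. c i * f (x + u i))
     + (\<Sum>i\<in>I. \<Sum>j\<in>I. c i * c j * f (x + u i + u j))
     + (\<Sum>i\<in>I. (c i)\<^sup>2 * (f (x + u i) - f (x + u i + u i)))"
  using assms(2-4)
proof (induction I arbitrary: f c0 rule: finite_induct)
  case empty
  have "0 \<le> f x"
    using empty.prems(1) \<open>x \<in> C\<close> unfolding alternating_on_def by (metis empty_subsetI fdiff.simps(1) list.set(1) list.size(3) mult_1 power_0)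
  then show ?case by simp
next
  case (insert a I)
  let ?S1 = "\<lambda>g. (\<Sum>i\<in>I. c i * g (x + u i))"
  let ?S2 = "\<lambda>g. (\<Sum>i\<in>I. \<Sum>j\<in>I. c i * c j * g (x + u i + u j))"
  let ?R = "\<lambda>g. (\<Sum>i\<in>I. (c i)\<^sup>2 * (g (x + u i) - g (x + u i + u i)))"
  let ?T = "\<lambda>x. f (x + u a)"
  let ?U = "\<lambda>x. f x - f (x + u a)"
  have u: "u a \<in> C" "\<And>i. i \<in> I \<Longrightarrow> u i \<in> C" using insert.prems by auto
  \<comment> \<open>The event X_a = 1 carries the shifted function and raises the constant by
    \<open>c a\<close>; the complementary event carries f minus its shift and keeps
    \<open>c0\<close>.\<close>
  have 1: "0 \<le> (c0 + c a)\<^sup>2 * ?T x + 2 * (c0 + c a) * ?S1 ?T + ?S2 ?T + ?R ?T"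
    by (rule insert.IH[OF alternating_on_shift[OF C insert.prems(1) u(1)] u(2)])
  have 2: "0 \<le> c0\<^sup>2 * ?U x + 2 * c0 * ?S1 ?U + ?S2 ?U + ?R ?U"
    by (rule insert.IH[OF alternating_on_diff[OF insert.prems(1) u(1)] u(2)])
  have U1: "?S1 ?U = ?S1 f - ?S1 ?T" by (simp add: algebra_simps sum_subtractf)
  have U2: "?S2 ?U = ?S2 f - ?S2 ?T" by (simp add: algebra_simps sum_subtractf)
  have U3: "?R ?U = ?R f - ?R ?T"
    unfolding sum_subtractf[symmetric] by (intro sum.cong refl) (simp add: algebra_simps)
  have e1: "(\<Sum>i\<in>insert a I. c i * f (x + u i)) = c a * ?T x + ?S1 f"
    using insert.hyps by simp
  have e2: "(\<Sum>i\<in>insert a I. \<Sum>j\<in>insert a I. c i * c j * f (x + u i + u j))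
      = (c a)\<^sup>2 * f (x + u a + u a) + 2 * c a * ?S1 ?T + ?S2 f"
    using insert.hyps by (simp add: sum.distrib sum_distrib_left power2_eq_square add_ac mult_ac)
  have e3: "(\<Sum>i\<in>insert a I. (c i)\<^sup>2 * (f (x + u i) - f (x + u i + u i)))
     = (c a)\<^sup>2 * (?T x - f (x + u a + u a)) + ?R f"
    using insert.hyps by simp
  show ?case
    using 1 2 unfolding U1 U2 U3 e1 e2 e3 by (simp add: power2_eq_square algebra_simps)
qed

text \<open>Replacing each summand by \<open>N\<close> independent copies of weight \<open>1/N\<close> makes the diagonal correction
  negligible.\<close>
lemma alternating_positive_definite:
  fixes c :: "'i \<Rightarrow> real" and u :: "'i \<Rightarrow> 'a::euclidean_space"
  assumes C: "open_convex_cone C" and "finite A" "alternating_on C f" "\<And>i. i \<in> A \<Longrightarrow> u i \<in> C" "x \<in> C"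
  shows "0 \<le> (\<Sum>i\<in>A. \<Sum>j\<in>A. c i * c j * f (x + u i + u j))"
proof -
  let ?S2 = "\<Sum>i\<in>A. \<Sum>j\<in>A. c i * c j * f (x + u i + u j)"
  let ?R = "\<Sum>i\<in>A. (c i)\<^sup>2 * (f (x + u i) - f (x + u i + u i))"
  have "0 \<le> ?S2 + ?R / real (Suc N)" for N
  proof -
    let ?n = "Suc N"
    let ?I = "{..<?n} \<times> A"
    let ?c = "\<lambda>i. c (snd i) / real ?n" and ?u = "\<lambda>i. u (snd i)"
    have "0 \<le> 0\<^sup>2 * f x + 2 * 0 * (\<Sum>i\<in>?I. ?c i * f (x + ?u i))
     + (\<Sum>i\<in>?I. \<Sum>j\<in>?I. ?c i * ?c j * f (x + ?u i + ?u j))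
     + (\<Sum>i\<in>?I. (?c i)\<^sup>2 * (f (x + ?u i) - f (x + ?u i + ?u i)))"
      using assms by (intro alternating_second_moment[OF C]) auto
    moreover have "(\<Sum>i\<in>?I. \<Sum>j\<in>?I. ?c i * ?c j * f (x + ?u i + ?u j)) = ?S2"
    proof -
      have "(\<Sum>i\<in>?I. \<Sum>j\<in>?I. ?c i * ?c j * f (x + ?u i + ?u j))
        = (\<Sum>k<?n. \<Sum>i\<in>A. \<Sum>l<?n. \<Sum>j\<in>A. c i / ?n * (c j / ?n) * f (x + u i + u j))"
        by (simp add: sum.cartesian_product' sum.cartesian_product[symmetric])
      also have "\<dots> = (\<Sum>i\<in>A. \<Sum>j\<in>A. ?n * (?n * (c i / ?n * (c j / ?n) * f (x + u i + u j))))"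
        by (simp add: sum_distrib_left del: of_nat_Suc)
      also have "\<dots> = ?S2"
        by (intro sum.cong refl) (simp add: field_simps del: of_nat_Suc)
      finally show ?thesis .
    qed
    moreover have "(\<Sum>i\<in>?I. (?c i)\<^sup>2 * (f (x + ?u i) - f (x + ?u i + ?u i))) = ?R / ?n"
    proof -
      have "(\<Sum>i\<in>?I. (?c i)\<^sup>2 * (f (x + ?u i) - f (x + ?u i + ?u i)))
        = (\<Sum>k<?n. \<Sum>i\<in>A. (c i / ?n)\<^sup>2 * (f (x + u i) - f (x + u i + u i)))"
        by (simp add: sum.cartesian_product')
      also have "\<dots> = (\<Sum>i\<in>A. ?n * ((c i / ?n)\<^sup>2 * (f (x + u i) - f (x + u i + u i))))"
        by (simp add: sum_distrib_left del: of_nat_Suc)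
      also have "\<dots> = ?R / ?n"
        unfolding sum_divide_distrib by (intro sum.cong refl) (simp add: field_simps power2_eq_square del: of_nat_Suc)
      finally show ?thesis .
    qed
    ultimately show ?thesis by simp
  qed
  moreover have "(\<lambda>N. ?S2 + ?R / real (Suc N)) \<longlonglongrightarrow> ?S2 + 0"
    by (intro tendsto_intros LIMSEQ_Suc lim_const_over_n)
  ultimately have "0 \<le> ?S2 + 0"
    by (meson LIMSEQ_le_const)
  then show ?thesis by simp
qed

section \<open>Positivity of squares of homogeneous differential operators\<close>

lemma finite_lists_length: "finite {xs :: 'a::finite list. length xs = n}"
  using finite_lists_length_eq[of "UNIV :: 'a set" n] by simp

lemma sum_lists_Suc:
  "(\<Sum>xs\<in>{xs :: 'a::finite list. length xs = Suc n}. g xs) = (\<Sum>x\<in>UNIV. \<Sum>xs | length xs = n. g (x # xs))"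
proof -
  have "{xs :: 'a list. length xs = Suc n} = (\<lambda>(x, xs). x # xs) ` (UNIV \<times> {xs. length xs = n})"
    by (auto simp: length_Suc_conv image_iff)
  then have "(\<Sum>xs\<in>{xs :: 'a list. length xs = Suc n}. g xs)
    = (\<Sum>p\<in>UNIV \<times> {xs. length xs = n}. g (fst p # snd p))"
    by (simp add: sum.reindex inj_on_def case_prod_unfold)
  then show ?thesis by (simp add: sum.cartesian_product' case_prod_unfold)
qed

fun partial_sum :: "'a::real_vector list \<Rightarrow> bool list \<Rightarrow> 'a" where
  "partial_sum (v # vs) (b # bs) = (if b then v else 0) + partial_sum vs bs"
| "partial_sum _ _ = 0"

fun bsign :: "bool list \<Rightarrow> real" where
  "bsign [] = 1"
| "bsign (b # bs) = (if b then 1 else -1) * bsign bs"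

lemma partial_sum_scaleR: "partial_sum (map (scaleR h) vs) bs = h *\<^sub>R partial_sum vs bs"
  by (induction vs bs rule: partial_sum.induct) (auto simp: scaleR_add_right)

lemma fdiff_expand:
  "fdiff vs f x = (\<Sum>bs | length bs = length vs. bsign bs * f (x + partial_sum vs bs))"
proof (induction vs arbitrary: x)
  case (Cons v vs)
  show ?case
    by (simp add: sum_lists_Suc UNIV_bool Cons.IH sum_negf sum_subtractf[symmetric] add.assoc algebra_simps)
qed simp

text \<open>Positivity of the square of the operator that sums \<open>c i\<close> times the iterated
  derivative along \<open>vs i\<close>. The directions are arbitrary vectors; only the base point
  has to lie in C.\<close>

lemma completely_monotone_derivative_form:
  fixes c :: "'i \<Rightarrow> real" and vs :: "'i \<Rightarrow> 'a::euclidean_space list"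
  assumes C: "open_convex_cone C" and f: "completely_monotone_on C f"
    and A: "finite A" "\<And>i. i \<in> A \<Longrightarrow> length (vs i) = r" and x: "x \<in> C"
  shows "0 \<le> (\<Sum>i\<in>A. \<Sum>j\<in>A. c i * c j * foldr dir_deriv (rev (vs i @ vs j)) f x)"
proof -
  \<comment> \<open>One third of x remains the base point. The other two thirds are added to the two
    increments, which puts both into C for small h even though the directions themselves may lie
    outside.\<close>
  let ?y = "(1/3) *\<^sub>R x"
  have y: "?y \<in> C" using C x by (simp add: open_convex_cone_def)
  have x3: "x = ?y + ?y + ?y" by (simp add: scaleR_left_distrib[symmetric])
  have sm: "smooth_on C f" "open C"
    using C f by (auto simp: completely_monotone_on_def open_convex_cone_def)
  note alt = completely_monotone_alternating[OF C f]
  let ?B = "{bs :: bool list. length bs = r}"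
  have finB: "finite ?B" by (rule finite_lists_length)
  have near: "\<forall>\<^sub>F h in at_right 0. \<forall>p\<in>A \<times> ?B. ?y + h *\<^sub>R partial_sum (vs (fst p)) (snd p) \<in> C"
  proof (intro eventually_ball_finite ballI)
    fix p assume "p \<in> A \<times> ?B"
    have "((\<lambda>h. ?y + h *\<^sub>R partial_sum (vs (fst p)) (snd p)) \<longlongrightarrow> ?y + 0 *\<^sub>R partial_sum (vs (fst p)) (snd p)) (at_right 0)"
      by (intro tendsto_intros)
    then show "\<forall>\<^sub>F h in at_right 0. ?y + h *\<^sub>R partial_sum (vs (fst p)) (snd p) \<in> C"
      using topological_tendstoD sm(2) y by fastforce
  qed (use A finB in auto)
  have pos: "\<forall>\<^sub>F h in at_right 0. 0 \<le> (\<Sum>i\<in>A. \<Sum>j\<in>A. c i * c j *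
      (fdiff (map (scaleR h) (vs i @ vs j)) f x / h ^ length (vs i @ vs j)))"
    using near eventually_at_right_less[of 0]
  proof eventually_elim
    case (elim h)
    let ?u = "\<lambda>p. ?y + h *\<^sub>R partial_sum (vs (fst p)) (snd p)"
    let ?c = "\<lambda>p. c (fst p) * bsign (snd p)"
    have "0 \<le> (\<Sum>p\<in>A \<times> ?B. \<Sum>q\<in>A \<times> ?B. ?c p * ?c q * f (?y + ?u p + ?u q))"
      by (rule alternating_positive_definite[OF C _ alt _ y]) (use elim(1) A(1) finB in auto)
    also have "\<dots> = (\<Sum>i\<in>A. \<Sum>bs\<in>?B. \<Sum>j\<in>A. \<Sum>bs'\<in>?B. c i * bsign bs * (c j * bsign bs') *
        f (x + h *\<^sub>R partial_sum (vs i) bs + h *\<^sub>R partial_sum (vs j) bs'))"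
      by (simp add: sum.cartesian_product' algebra_simps, simp add: scaleR_left_distrib[symmetric] add.assoc[symmetric], simp add: add_ac)
    also have "\<dots> = (\<Sum>i\<in>A. \<Sum>j\<in>A. \<Sum>bs\<in>?B. \<Sum>bs'\<in>?B. c i * bsign bs * (c j * bsign bs') *
        f (x + h *\<^sub>R partial_sum (vs i) bs + h *\<^sub>R partial_sum (vs j) bs'))"
      by (intro sum.cong refl sum.swap)
    also have "\<dots> = (\<Sum>i\<in>A. \<Sum>j\<in>A. c i * c j * fdiff (map (scaleR h) (vs i @ vs j)) f x)"
    proof (intro sum.cong refl)
      fix i j assume "i \<in> A" "j \<in> A"
      then have "fdiff (map (scaleR h) (vs i @ vs j)) f x = (\<Sum>bs\<in>?B. bsign bs * (\<Sum>bs'\<in>?B. bsign bs' *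
        f (x + h *\<^sub>R partial_sum (vs i) bs + h *\<^sub>R partial_sum (vs j) bs')))"
        by (subst map_append, subst fdiff_append) (simp add: fdiff_expand partial_sum_scaleR A(2))
      then show "(\<Sum>bs\<in>?B. \<Sum>bs'\<in>?B. c i * bsign bs * (c j * bsign bs') *
        f (x + h *\<^sub>R partial_sum (vs i) bs + h *\<^sub>R partial_sum (vs j) bs'))
        = c i * c j * fdiff (map (scaleR h) (vs i @ vs j)) f x"
        by (simp add: sum_distrib_left mult_ac)
    qed
    \<comment> \<open>All lists have length r, so every pair has the same scale
      \<open>h ^ (r + r)\<close> and one division turns all differences into difference
      quotients.\<close>
    finally have "0 \<le> (\<Sum>i\<in>A. \<Sum>j\<in>A. c i * c j * fdiff (map (scaleR h) (vs i @ vs j)) f x) / h ^ (r + r)"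
      using elim by simp
    also have "\<dots> = (\<Sum>i\<in>A. \<Sum>j\<in>A. c i * c j *
      (fdiff (map (scaleR h) (vs i @ vs j)) f x / h ^ length (vs i @ vs j)))"
      by (simp add: sum_divide_distrib A(2))
    finally show ?case .
  qed
  have "((\<lambda>h. \<Sum>i\<in>A. \<Sum>j\<in>A. c i * c j *
      (fdiff (map (scaleR h) (vs i @ vs j)) f x / h ^ length (vs i @ vs j)))
     \<longlongrightarrow> (\<Sum>i\<in>A. \<Sum>j\<in>A. c i * c j * foldr dir_deriv (rev (vs i @ vs j)) f x)) (at_right 0)"
    by (intro tendsto_sum tendsto_mult tendsto_const fdiff_quotient_tendsto[OF sm(2,1) x])
  then show ?thesis
    by (rule tendsto_lowerbound[OF _ pos]) simp
qed

section \<open>The Cayley identity\<close>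

text \<open>A relation instead of a function: two computations of the same derivative are compared
  through \<open>has_partial_unique\<close>, which is how most derivative identities below
  arise.\<close>

definition has_partial :: "'e::finite \<Rightarrow> (real ^ 'e \<Rightarrow> complex) \<Rightarrow> complex \<Rightarrow> real ^ 'e \<Rightarrow> bool" where
  "has_partial e g g' x \<longleftrightarrow> ((\<lambda>\<tau>. g (x + \<tau> *\<^sub>R axis e 1)) has_vector_derivative g') (at 0)"

lemma has_partial_const: "has_partial e (\<lambda>x. c) 0 x"
  by (simp add: has_partial_def)

lemma has_partial_mult:
  "has_partial e f f' x \<Longrightarrow> has_partial e g g' x \<Longrightarrow> has_partial e (\<lambda>x. f x * g x) (f x * g' + f' * g x) x"
  unfolding has_partial_def by (drule (1) has_vector_derivative_mult) simp

lemma has_partial_cmult: "has_partial e f f' x \<Longrightarrow> has_partial e (\<lambda>x. c * f x) (c * f') x"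
  using has_partial_mult[OF has_partial_const] by fastforce

lemma has_partial_sum:
  "(\<And>i. i \<in> I \<Longrightarrow> has_partial e (f i) (f' i) x) \<Longrightarrow> has_partial e (\<lambda>x. \<Sum>i\<in>I. f i x) (\<Sum>i\<in>I. f' i) x"
  unfolding has_partial_def by (rule has_vector_derivative_sum)

lemma has_partial_prod:
  assumes "finite I" "\<And>i. i \<in> I \<Longrightarrow> has_partial e (f i) (f' i) x"
  shows "has_partial e (\<lambda>x. \<Prod>i\<in>I. f i x) (\<Sum>i\<in>I. f' i * (\<Prod>j\<in>I - {i}. f j x)) x"
  using assms
proof (induction I)
  case empty
  then show ?case using has_partial_const[of e 1 x] by simp
next
  case (insert a I)
  have "(\<Sum>i\<in>insert a I. f' i * (\<Prod>j\<in>insert a I - {i}. f j x))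
    = f' a * (\<Prod>j\<in>I. f j x) + (\<Sum>i\<in>I. f' i * (\<Prod>j\<in>insert a I - {i}. f j x))"
    using insert.hyps by simp
  also have "(\<Sum>i\<in>I. f' i * (\<Prod>j\<in>insert a I - {i}. f j x)) = f a x * (\<Sum>i\<in>I. f' i * (\<Prod>j\<in>I - {i}. f j x))"
    unfolding sum_distrib_left
  proof (intro sum.cong refl)
    fix i assume "i \<in> I"
    then have "insert a I - {i} = insert a (I - {i})" using insert.hyps by auto
    then show "f' i * (\<Prod>j\<in>insert a I - {i}. f j x) = f a x * (f' i * (\<Prod>j\<in>I - {i}. f j x))"
      using insert.hyps by simp
  qed
  finally show ?case
    using has_partial_mult[OF insert.prems[of a] insert.IH] insert.hyps insert.prems by (simp add: add.commute)
qed

lemma has_partial_unique: "has_partial e f a x \<Longrightarrow> has_partial e f b x \<Longrightarrow> a = b"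
  unfolding has_partial_def by (rule vector_derivative_unique_at)

lemma has_partial_cong_open:
  assumes "open U" "x \<in> U" "\<And>y. y \<in> U \<Longrightarrow> f y = g y" "has_partial e f a x"
  shows "has_partial e g a x"
proof -
  let ?S = "(\<lambda>\<tau>. x + \<tau> *\<^sub>R axis e 1) -` U"
  have "open ?S" by (intro open_vimage assms(1) continuous_intros)
  moreover have "0 \<in> ?S" using assms(2) by simp
  ultimately show ?thesis
    using assms(3,4) unfolding has_partial_def
    by (elim has_vector_derivative_transform_within_open[where S = ?S]) auto
qed

text \<open>The head of the list is the derivative applied last and is matched with row
  \<open>length es\<close>, so lengthening the list by one means applying the next row of the
  operator determinant.\<close>

fun row_coef :: "(nat \<Rightarrow> nat \<Rightarrow> 'e \<Rightarrow> complex) \<Rightarrow> (nat \<Rightarrow> nat) \<Rightarrow> 'e list \<Rightarrow> complex" where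
  "row_coef w \<sigma> [] = 1"
| "row_coef w \<sigma> (e # es) = w (length es) (\<sigma> (length es)) e * row_coef w \<sigma> es"

text \<open>The coefficients of the differential operator \<open>det (\<partial>\<^sub>i\<^sub>j)\<close>, where \<open>\<partial>\<^sub>i\<^sub>j\<close> is the derivative in the
  (complex) direction \<open>w i j\<close>.\<close>
definition det_coef :: "nat \<Rightarrow> (nat \<Rightarrow> nat \<Rightarrow> 'e \<Rightarrow> complex) \<Rightarrow> 'e list \<Rightarrow> complex" where
  "det_coef r w es = (\<Sum>\<sigma> | \<sigma> permutes {..<r}. of_int (sign \<sigma>) * row_coef w \<sigma> es)"

text \<open>The rows of \<open>det (\<partial>\<^sub>i\<^sub>j)\<close> are applied one at a time. For the induction the signed sum over
  permutations \<open>\<sigma>\<close> carries a weight \<open>h\<close> depending only on the values of \<open>\<sigma>\<close> at the rows not yet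
  used; differentiating \<open>H i (\<sigma> i)\<close> in row \<open>t\<close> produces \<open>H t (\<sigma> i) * H i (\<sigma> t)\<close>, which is the
  transposition of \<open>i\<close> and \<open>t\<close> and so contributes \<open>\<kappa>\<close> once for every \<open>i < t\<close>.\<close>
lemma cayley_identity:
  fixes F :: "'e::finite list \<Rightarrow> real ^ 'e \<Rightarrow> complex"
  assumes U: "open U"
    and F: "\<And>es e x. x \<in> U \<Longrightarrow> has_partial e (F es) (F (e # es) x) x"
    and H: "\<And>e k l x. x \<in> U \<Longrightarrow> k < r \<Longrightarrow> l < r \<Longrightarrow> has_partial e (H k l) (dH e k l x) x"
    and lawF: "\<And>i j x. x \<in> U \<Longrightarrow> i < r \<Longrightarrow> j < r \<Longrightarrow> (\<Sum>e\<in>UNIV. w i j e * F [e] x) = s * F [] x * H i j x"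
    and lawH: "\<And>i j k l x. x \<in> U \<Longrightarrow> i < r \<Longrightarrow> j < r \<Longrightarrow> k < r \<Longrightarrow> l < r \<Longrightarrow>
      (\<Sum>e\<in>UNIV. w i j e * dH e k l x) = - (\<kappa> * (H i l x * H k j x) + \<kappa>' * (H k i x * H j l x))"
    and sym: "\<kappa>' = 0 \<or> (\<forall>x\<in>U. \<forall>k<r. \<forall>l<r. H k l x = H l k x)"
    and x: "x \<in> U"
  shows "(\<Sum>es | length es = r. det_coef r w es * F es x)
    = (\<Prod>i<r. s + \<kappa> * of_nat i) * F [] x * pdet r (\<lambda>i j. H i j x)"
proof -
  let ?P = "{\<sigma>. \<sigma> permutes {..<r}}"
  let ?c = "\<lambda>t. \<Prod>i<t. s + \<kappa> * of_nat i"
  \<comment> \<open>Dependence on the rows from t onwards only, phrased as invariance under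
    transpositions of the first t rows because this is the form in which it is used.\<close>
  define tail where "tail t h \<longleftrightarrow> (\<forall>\<sigma>\<in>?P. \<forall>i<t. \<forall>k<t. h (\<sigma> \<circ> Transposition.transpose i k) = h \<sigma>)"
    for t and h :: "(nat \<Rightarrow> nat) \<Rightarrow> complex"
  have main: "(\<Sum>\<sigma>\<in>?P. of_int (sign \<sigma>) * (h \<sigma> * (\<Sum>es | length es = t. row_coef w \<sigma> es * F es x)))
     = ?c t * F [] x * (\<Sum>\<sigma>\<in>?P. of_int (sign \<sigma>) * (h \<sigma> * (\<Prod>i<t. H i (\<sigma> i) x)))"
    if "t \<le> r" "tail t h" "x \<in> U" for t h x
    using that
  proof (induction t arbitrary: h x)
    case 0
    have "{es :: 'e list. es = []} = {[]}" by auto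
    then show ?case by (simp add: sum_distrib_left mult_ac)
  next
    case (Suc t)
    have t: "t < r" using Suc.prems by simp
    have lt: "\<sigma> i < r" if "\<sigma> \<in> ?P" "i < r" for \<sigma> i
      using that permutes_in_image[of \<sigma> "{..<r}" i] by auto
    \<comment> \<open>Fixing the value j of \<sigma> at row t makes the coefficient
      \<open>w t j\<close> of that row independent of \<sigma>, so the induction hypothesis applies
      to the remaining t rows with this weight.\<close>
    let ?h = "\<lambda>j \<sigma>. h \<sigma> * of_bool (\<sigma> t = j)"
    let ?D = "\<lambda>e \<sigma>. F [e] x * (\<Prod>i<t. H i (\<sigma> i) x)
        + F [] x * (\<Sum>i<t. dH e i (\<sigma> i) x * (\<Prod>k\<in>{..<t}-{i}. H k (\<sigma> k) x))"
    \<comment> \<open>The induction hypothesis is an identity on the open set U, so both of its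
      sides may be differentiated along e.\<close>
    have step: "(\<Sum>\<sigma>\<in>?P. of_int (sign \<sigma>) * (?h j \<sigma> * (\<Sum>es | length es = t. row_coef w \<sigma> es * F (e # es) x)))
       = ?c t * (\<Sum>\<sigma>\<in>?P. of_int (sign \<sigma>) * (?h j \<sigma> * ?D e \<sigma>))" for j e
    proof -
      let ?L = "\<lambda>y. \<Sum>\<sigma>\<in>?P. of_int (sign \<sigma>) * (?h j \<sigma> * (\<Sum>es | length es = t. row_coef w \<sigma> es * F es y))"
      let ?R = "\<lambda>y. ?c t * (\<Sum>\<sigma>\<in>?P. of_int (sign \<sigma>) * (?h j \<sigma> * (F [] y * (\<Prod>i<t. H i (\<sigma> i) y))))"
      have tl: "tail t (?h j)"
        unfolding tail_def
      proof (intro ballI allI impI)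
        fix \<sigma> i k assume a: "\<sigma> \<in> ?P" "i < t" "k < t"
        then have "h (\<sigma> \<circ> Transposition.transpose i k) = h \<sigma>"
          using Suc.prems(2) unfolding tail_def by (metis less_Suc_eq)
        moreover have "Transposition.transpose i k t = t"
          using a by (auto simp: Transposition.transpose_def)
        ultimately show "?h j (\<sigma> \<circ> Transposition.transpose i k) = ?h j \<sigma>" by simp
      qed
      have "?L y = ?R y" if "y \<in> U" for y
        using Suc.IH[OF _ tl that] Suc.prems(1) by (simp add: sum_distrib_left mult_ac)
      moreover have "has_partial e ?L (\<Sum>\<sigma>\<in>?P. of_int (sign \<sigma>) * (?h j \<sigma> * (\<Sum>es | length es = t. row_coef w \<sigma> es * F (e # es) x))) x"
        by (intro has_partial_sum has_partial_cmult F Suc.prems)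
      moreover have "has_partial e ?R (?c t * (\<Sum>\<sigma>\<in>?P. of_int (sign \<sigma>) * (?h j \<sigma> * ?D e \<sigma>))) x"
      proof (intro has_partial_sum has_partial_cmult)
        fix \<sigma> assume s: "\<sigma> \<in> ?P"
        have "has_partial e (\<lambda>y. \<Prod>i<t. H i (\<sigma> i) y) (\<Sum>i<t. dH e i (\<sigma> i) x * (\<Prod>k\<in>{..<t}-{i}. H k (\<sigma> k) x)) x"
          using Suc.prems t lt[OF s] by (intro has_partial_prod H) auto
        from has_partial_mult[OF F[OF Suc.prems(3), of e "[]"] this]
        show "has_partial e (\<lambda>y. F [] y * (\<Prod>i<t. H i (\<sigma> i) y)) (?D e \<sigma>) x"
          by (simp add: add.commute)
      qed
      ultimately show ?thesis
        using has_partial_cong_open[OF U Suc.prems(3), of ?L ?R] has_partial_unique by blast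
    qed
    let ?Q = "\<lambda>i \<sigma>. \<Prod>k\<in>{..<t}-{i}. H k (\<sigma> k) x"
    have law: "(\<Sum>e\<in>UNIV. w t (\<sigma> t) e * ?D e \<sigma>)
      = F [] x * (s * (\<Prod>i<Suc t. H i (\<sigma> i) x)
         - (\<Sum>i<t. \<kappa> * (H t (\<sigma> i) x * H i (\<sigma> t) x * ?Q i \<sigma>) + \<kappa>' * (H i t x * H (\<sigma> t) (\<sigma> i) x * ?Q i \<sigma>)))"
      if s: "\<sigma> \<in> ?P" for \<sigma>
    proof -
      have "(\<Sum>e\<in>UNIV. w t (\<sigma> t) e * ?D e \<sigma>)
        = (\<Sum>e\<in>UNIV. w t (\<sigma> t) e * F [e] x) * (\<Prod>i<t. H i (\<sigma> i) x)
        + F [] x * (\<Sum>i<t. (\<Sum>e\<in>UNIV. w t (\<sigma> t) e * dH e i (\<sigma> i) x) * ?Q i \<sigma>)"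
      proof -
        have "(\<Sum>e\<in>UNIV. w t (\<sigma> t) e * (F [] x * (\<Sum>i<t. dH e i (\<sigma> i) x * ?Q i \<sigma>)))
          = F [] x * (\<Sum>i<t. (\<Sum>e\<in>UNIV. w t (\<sigma> t) e * dH e i (\<sigma> i) x) * ?Q i \<sigma>)"
          unfolding sum_distrib_left sum_distrib_right by (subst sum.swap) (simp add: mult_ac)
        then show ?thesis
          by (simp add: distrib_left sum.distrib sum_distrib_right mult.assoc)
      qed
      also have "(\<Sum>e\<in>UNIV. w t (\<sigma> t) e * F [e] x) = s * F [] x * H t (\<sigma> t) x"
        using lawF Suc.prems t lt[OF s] by blast
      also have "(\<Sum>i<t. (\<Sum>e\<in>UNIV. w t (\<sigma> t) e * dH e i (\<sigma> i) x) * ?Q i \<sigma>)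
        = (\<Sum>i<t. - (\<kappa> * (H t (\<sigma> i) x * H i (\<sigma> t) x) + \<kappa>' * (H i t x * H (\<sigma> t) (\<sigma> i) x)) * ?Q i \<sigma>)"
      proof (intro sum.cong refl arg_cong2[of _ _ _ _ "(*)"])
        fix i assume "i \<in> {..<t}"
        then show "(\<Sum>e\<in>UNIV. w t (\<sigma> t) e * dH e i (\<sigma> i) x)
           = - (\<kappa> * (H t (\<sigma> i) x * H i (\<sigma> t) x) + \<kappa>' * (H i t x * H (\<sigma> t) (\<sigma> i) x))"
          using lawH[OF Suc.prems(3) t lt[OF s t] _ lt[OF s], of i i] t by simp
      qed
      finally show ?thesis
        by (simp add: algebra_simps sum_negf sum.distrib sum_subtractf)
    qed
    have swap: "(\<Sum>\<sigma>\<in>?P. of_int (sign \<sigma>) * (h \<sigma> * G \<sigma>))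
       = - (\<Sum>\<sigma>\<in>?P. of_int (sign \<sigma>) * (h \<sigma> * G (\<sigma> \<circ> Transposition.transpose i t)))" if "i < t" for i G
    proof -
      have "h (\<sigma> \<circ> Transposition.transpose i t) = h \<sigma>" if "\<sigma> \<in> ?P" for \<sigma>
        using Suc.prems(2) that \<open>i < t\<close> unfolding tail_def by (meson less_SucI lessI)
      then show ?thesis
        using sum_permutes_transpose[of i r t "\<lambda>\<sigma>. h \<sigma> * G \<sigma>"] that t by simp
    qed
    have Qswap: "?Q i (\<sigma> \<circ> Transposition.transpose i t) = ?Q i \<sigma>" for i \<sigma>
      by (intro prod.cong) (auto simp: Transposition.transpose_def)
    have k1: "(\<Sum>\<sigma>\<in>?P. of_int (sign \<sigma>) * (h \<sigma> * (H t (\<sigma> i) x * H i (\<sigma> t) x * ?Q i \<sigma>)))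
       = - (\<Sum>\<sigma>\<in>?P. of_int (sign \<sigma>) * (h \<sigma> * (\<Prod>i<Suc t. H i (\<sigma> i) x)))" if "i < t" for i
    proof -
      have pr: "(\<Prod>i<Suc t. H i (\<sigma> i) x) = H t (\<sigma> t) x * H i (\<sigma> i) x * ?Q i \<sigma>" for \<sigma>
        using prod.remove[of "{..<t}" i "\<lambda>i. H i (\<sigma> i) x"] that by (simp add: mult_ac)
      show ?thesis
        unfolding pr by (subst swap[OF that]) (simp add: Qswap)
    qed
    \<comment> \<open>Exchanging i and t swaps the two indices of
      \<open>H (\<sigma> t) (\<sigma> i)\<close>. By symmetry of H only the sign changes, so the sum
      is its own negative.\<close>
    have k2: "\<kappa>' * (\<Sum>\<sigma>\<in>?P. of_int (sign \<sigma>) * (h \<sigma> * (H i t x * H (\<sigma> t) (\<sigma> i) x * ?Q i \<sigma>))) = 0"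
      if "i < t" for i
    proof (cases "\<kappa>' = 0")
      case False
      let ?X = "\<Sum>\<sigma>\<in>?P. of_int (sign \<sigma>) * (h \<sigma> * (H i t x * H (\<sigma> t) (\<sigma> i) x * ?Q i \<sigma>))"
      have sy: "H k l x = H l k x" if "k < r" "l < r" for k l
        using sym False Suc.prems(3) that by blast
      have "?X = - (\<Sum>\<sigma>\<in>?P. of_int (sign \<sigma>) * (h \<sigma> * (H i t x * H (\<sigma> i) (\<sigma> t) x * ?Q i \<sigma>)))"
        by (subst swap[OF that]) (simp add: Qswap)
      also have "\<dots> = - ?X"
      proof (intro arg_cong[of _ _ uminus] sum.cong refl)
        fix \<sigma> assume "\<sigma> \<in> ?P"
        then have "\<sigma> i < r" "\<sigma> t < r" using lt that t by auto
        then have "H (\<sigma> i) (\<sigma> t) x = H (\<sigma> t) (\<sigma> i) x" by (rule sy)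
        then show "of_int (sign \<sigma>) * (h \<sigma> * (H i t x * H (\<sigma> i) (\<sigma> t) x * ?Q i \<sigma>))
          = of_int (sign \<sigma>) * (h \<sigma> * (H i t x * H (\<sigma> t) (\<sigma> i) x * ?Q i \<sigma>))" by simp
      qed
      finally show ?thesis by simp
    qed simp
    have "(\<Sum>\<sigma>\<in>?P. of_int (sign \<sigma>) * (h \<sigma> * (\<Sum>es | length es = Suc t. row_coef w \<sigma> es * F es x)))
      = (\<Sum>\<sigma>\<in>?P. \<Sum>j<r. \<Sum>e\<in>UNIV. w t j e * (of_int (sign \<sigma>) * (?h j \<sigma> * (\<Sum>es | length es = t. row_coef w \<sigma> es * F (e # es) x))))"
    proof (intro sum.cong refl)
      fix \<sigma> assume s: "\<sigma> \<in> ?P"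
      let ?g = "\<lambda>j. \<Sum>e\<in>UNIV. w t j e * (of_int (sign \<sigma>) * (h \<sigma> * (\<Sum>es | length es = t. row_coef w \<sigma> es * F (e # es) x)))"
      have "(\<Sum>j<r. \<Sum>e\<in>UNIV. w t j e * (of_int (sign \<sigma>) * (?h j \<sigma> * (\<Sum>es | length es = t. row_coef w \<sigma> es * F (e # es) x))))
        = (\<Sum>j<r. if \<sigma> t = j then ?g j else 0)"
        by (intro sum.cong refl) simp
      also have "\<dots> = ?g (\<sigma> t)" using lt[OF s t] by simp
      also have "\<dots> = of_int (sign \<sigma>) * (h \<sigma> * (\<Sum>es | length es = Suc t. row_coef w \<sigma> es * F es x))"
        by (simp add: sum_lists_Suc sum_distrib_left mult_ac)
      finally show "of_int (sign \<sigma>) * (h \<sigma> * (\<Sum>es | length es = Suc t. row_coef w \<sigma> es * F es x))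
        = (\<Sum>j<r. \<Sum>e\<in>UNIV. w t j e * (of_int (sign \<sigma>) * (?h j \<sigma> * (\<Sum>es | length es = t. row_coef w \<sigma> es * F (e # es) x))))"
        by simp
    qed
    also have "\<dots> = (\<Sum>j<r. \<Sum>e\<in>UNIV. w t j e * (\<Sum>\<sigma>\<in>?P. of_int (sign \<sigma>) * (?h j \<sigma> * (\<Sum>es | length es = t. row_coef w \<sigma> es * F (e # es) x))))"
      unfolding sum_distrib_left by (subst sum.swap, intro sum.cong refl, subst sum.swap, rule refl)
    also have "\<dots> = (\<Sum>j<r. \<Sum>e\<in>UNIV. w t j e * (?c t * (\<Sum>\<sigma>\<in>?P. of_int (sign \<sigma>) * (?h j \<sigma> * ?D e \<sigma>))))"
      unfolding step ..
    also have "\<dots> = (\<Sum>\<sigma>\<in>?P. \<Sum>j<r. \<Sum>e\<in>UNIV. w t j e * (?c t * (of_int (sign \<sigma>) * (?h j \<sigma> * ?D e \<sigma>))))"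
      unfolding sum_distrib_left by (subst (2) sum.swap, subst sum.swap, rule refl)
    also have "\<dots> = (\<Sum>\<sigma>\<in>?P. ?c t * (of_int (sign \<sigma>) * (h \<sigma> * (\<Sum>e\<in>UNIV. w t (\<sigma> t) e * ?D e \<sigma>))))"
    proof (intro sum.cong refl)
      fix \<sigma> assume s: "\<sigma> \<in> ?P"
      let ?g = "\<lambda>j. \<Sum>e\<in>UNIV. w t j e * (?c t * (of_int (sign \<sigma>) * (h \<sigma> * ?D e \<sigma>)))"
      have "(\<Sum>j<r. \<Sum>e\<in>UNIV. w t j e * (?c t * (of_int (sign \<sigma>) * (?h j \<sigma> * ?D e \<sigma>))))
        = (\<Sum>j<r. if \<sigma> t = j then ?g j else 0)"
        by (intro sum.cong refl) simp
      also have "\<dots> = ?g (\<sigma> t)" using lt[OF s t] by simp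
      also have "\<dots> = ?c t * (of_int (sign \<sigma>) * (h \<sigma> * (\<Sum>e\<in>UNIV. w t (\<sigma> t) e * ?D e \<sigma>)))"
        unfolding sum_distrib_left by (intro sum.cong refl) (simp only: mult_ac)
      finally show "(\<Sum>j<r. \<Sum>e\<in>UNIV. w t j e * (?c t * (of_int (sign \<sigma>) * (?h j \<sigma> * ?D e \<sigma>))))
        = ?c t * (of_int (sign \<sigma>) * (h \<sigma> * (\<Sum>e\<in>UNIV. w t (\<sigma> t) e * ?D e \<sigma>)))" .
    qed
    also have "\<dots> = (\<Sum>\<sigma>\<in>?P. ?c t * F [] x * (s * (of_int (sign \<sigma>) * (h \<sigma> * (\<Prod>i<Suc t. H i (\<sigma> i) x)))
        - (\<Sum>i<t. \<kappa> * (of_int (sign \<sigma>) * (h \<sigma> * (H t (\<sigma> i) x * H i (\<sigma> t) x * ?Q i \<sigma>)))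
          + \<kappa>' * (of_int (sign \<sigma>) * (h \<sigma> * (H i t x * H (\<sigma> t) (\<sigma> i) x * ?Q i \<sigma>))))))"
    proof (intro sum.cong refl)
      fix \<sigma> assume "\<sigma> \<in> ?P"
      from law[OF this] show "?c t * (of_int (sign \<sigma>) * (h \<sigma> * (\<Sum>e\<in>UNIV. w t (\<sigma> t) e * ?D e \<sigma>)))
        = ?c t * F [] x * (s * (of_int (sign \<sigma>) * (h \<sigma> * (\<Prod>i<Suc t. H i (\<sigma> i) x)))
        - (\<Sum>i<t. \<kappa> * (of_int (sign \<sigma>) * (h \<sigma> * (H t (\<sigma> i) x * H i (\<sigma> t) x * ?Q i \<sigma>)))
          + \<kappa>' * (of_int (sign \<sigma>) * (h \<sigma> * (H i t x * H (\<sigma> t) (\<sigma> i) x * ?Q i \<sigma>)))))"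
        by (simp add: right_diff_distrib sum_distrib_left distrib_left sum.distrib del: prod.lessThan_Suc)
           (simp only: mult_ac)
    qed
    also have "\<dots> = ?c t * F [] x * (s * (\<Sum>\<sigma>\<in>?P. of_int (sign \<sigma>) * (h \<sigma> * (\<Prod>i<Suc t. H i (\<sigma> i) x)))
        - (\<Sum>i<t. \<kappa> * (\<Sum>\<sigma>\<in>?P. of_int (sign \<sigma>) * (h \<sigma> * (H t (\<sigma> i) x * H i (\<sigma> t) x * ?Q i \<sigma>)))
          + \<kappa>' * (\<Sum>\<sigma>\<in>?P. of_int (sign \<sigma>) * (h \<sigma> * (H i t x * H (\<sigma> t) (\<sigma> i) x * ?Q i \<sigma>)))))"
    proof -
      have "(\<Sum>\<sigma>\<in>?P. c * (s * a \<sigma> - (\<Sum>i<t. \<kappa> * b i \<sigma> + \<kappa>' * d i \<sigma>)))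
        = c * (s * (\<Sum>\<sigma>\<in>?P. a \<sigma>) - (\<Sum>i<t. \<kappa> * (\<Sum>\<sigma>\<in>?P. b i \<sigma>) + \<kappa>' * (\<Sum>\<sigma>\<in>?P. d i \<sigma>)))"
        for c :: complex and a b d
      proof -
        have "(\<Sum>i<t. \<kappa> * (\<Sum>\<sigma>\<in>?P. b i \<sigma>) + \<kappa>' * (\<Sum>\<sigma>\<in>?P. d i \<sigma>))
          = (\<Sum>\<sigma>\<in>?P. \<Sum>i<t. \<kappa> * b i \<sigma> + \<kappa>' * d i \<sigma>)"
          by (subst sum.swap) (simp only: sum_distrib_left sum.distrib)
        then show ?thesis by (simp only: sum_distrib_left[symmetric] sum_subtractf)
      qed
      then show ?thesis .
    qed
    also have "\<dots> = ?c t * F [] x * (s * (\<Sum>\<sigma>\<in>?P. of_int (sign \<sigma>) * (h \<sigma> * (\<Prod>i<Suc t. H i (\<sigma> i) x)))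
        - (\<Sum>i<t. - \<kappa> * (\<Sum>\<sigma>\<in>?P. of_int (sign \<sigma>) * (h \<sigma> * (\<Prod>i<Suc t. H i (\<sigma> i) x)))))"
      using k1 k2 by (intro arg_cong2[of _ _ _ _ "(*)"] arg_cong2[of _ _ _ _ "(-)"] sum.cong refl) (simp del: prod.lessThan_Suc)
    also have "\<dots> = ?c (Suc t) * F [] x * (\<Sum>\<sigma>\<in>?P. of_int (sign \<sigma>) * (h \<sigma> * (\<Prod>i<Suc t. H i (\<sigma> i) x)))"
      by (simp only: sum_constant prod.lessThan_Suc card_lessThan) (simp add: algebra_simps)
    finally show ?case .
  qed
  have "(\<Sum>es | length es = r. det_coef r w es * F es x)
    = (\<Sum>\<sigma>\<in>?P. of_int (sign \<sigma>) * (1 * (\<Sum>es | length es = r. row_coef w \<sigma> es * F es x)))"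
    unfolding det_coef_def sum_distrib_right sum_distrib_left by (subst sum.swap) (simp add: mult_ac)
  also have "\<dots> = ?c r * F [] x * pdet r (\<lambda>i j. H i j x)"
    using main[of r "\<lambda>_. 1" x] x by (simp add: tail_def pdet_def)
  finally show ?thesis .
qed

lemma has_partial_pdet:
  assumes "\<And>i j. i < n \<Longrightarrow> j < n \<Longrightarrow> has_partial e (A i j) (dA i j) x"
  shows "has_partial e (\<lambda>x. pdet n (\<lambda>i j. A i j x))
    (\<Sum>k<n. pdet n (\<lambda>i. if i = k then dA k else (\<lambda>j. A i j x))) x"
proof -
  have "has_partial e (\<lambda>x. pdet n (\<lambda>i j. A i j x))
    (\<Sum>\<sigma> | \<sigma> permutes {..<n}. of_int (sign \<sigma>) * (\<Sum>k<n. dA k (\<sigma> k) * (\<Prod>i\<in>{..<n}-{k}. A i (\<sigma> i) x))) x"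
    unfolding pdet_def
  proof (intro has_partial_sum has_partial_cmult has_partial_prod)
    fix \<sigma> i assume "\<sigma> \<in> {\<sigma>. \<sigma> permutes {..<n}}" "i \<in> {..<n}"
    then show "has_partial e (A i (\<sigma> i)) (dA i (\<sigma> i)) x"
      using permutes_in_image[of \<sigma> "{..<n}" i] by (intro assms) auto
  qed simp
  also have "(\<Sum>\<sigma> | \<sigma> permutes {..<n}. of_int (sign \<sigma>) * (\<Sum>k<n. dA k (\<sigma> k) * (\<Prod>i\<in>{..<n}-{k}. A i (\<sigma> i) x)))
    = (\<Sum>k<n. pdet n (\<lambda>i. if i = k then dA k else (\<lambda>j. A i j x)))"
    unfolding sum_distrib_left by (subst sum.swap) (simp add: pdet_row)
  finally show ?thesis .
qed

lemma pdet_row_comb2: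
  assumes "i < n"
  shows "pdet n (\<lambda>k. if k = i then (\<lambda>j. a * f j + b * g j) else A k)
    = a * pdet n (\<lambda>k. if k = i then f else A k) + b * pdet n (\<lambda>k. if k = i then g else A k)"
  unfolding pdet_row[OF assms] by (simp add: sum_distrib_left distrib_left distrib_right sum.distrib mult_ac)

text \<open>By this law, \<open>f det H\<close> satisfies the hypothesis of \<open>cayley_identity\<close> with \<open>s - 1\<close> whenever \<open>f\<close>
  satisfies it with \<open>s\<close>.\<close>
lemma pdet_derivative_law:
  fixes H :: "nat \<Rightarrow> nat \<Rightarrow> real ^ 'e::finite \<Rightarrow> complex"
  assumes law: "\<And>k l. k < r \<Longrightarrow> l < r \<Longrightarrow>
      (\<Sum>e\<in>UNIV. w e * dH e k l) = - (\<kappa> * (H i l x * H k j x) + \<kappa>' * (H k i x * H j l x))"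
    and ij: "i < r" "j < r"
    and sym: "\<kappa>' = 0 \<or> (\<forall>k<r. \<forall>l<r. H k l x = H l k x)"
  shows "(\<Sum>e\<in>UNIV. w e * (\<Sum>k<r. pdet r (\<lambda>i. if i = k then dH e k else (\<lambda>j. H i j x))))
    = - (\<kappa> + \<kappa>') * H i j x * pdet r (\<lambda>i j. H i j x)"
proof -
  let ?A = "\<lambda>i j. H i j x"
  have "(\<Sum>e\<in>UNIV. w e * (\<Sum>k<r. pdet r (\<lambda>i. if i = k then dH e k else ?A i)))
    = (\<Sum>k<r. \<Sum>e\<in>UNIV. w e * pdet r (\<lambda>i. if i = k then dH e k else ?A i))"
    unfolding sum_distrib_left by (rule sum.swap)
  also have "\<dots> = (\<Sum>k<r. pdet r (\<lambda>i. if i = k then (\<lambda>l. \<Sum>e\<in>UNIV. w e * dH e k l) else ?A i))"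
    by (intro sum.cong refl) (simp add: pdet_row_sum)
  also have "\<dots> = (\<Sum>k<r. pdet r (\<lambda>m. if m = k then (\<lambda>l. (- \<kappa> * H k j x) * ?A i l + (- \<kappa>' * H k i x) * ?A j l) else ?A m))"
    by (intro sum.cong refl pdet_cong) (simp add: law)
  also have "\<dots> = (\<Sum>k<r. (- \<kappa> * H k j x) * (if i = k then pdet r ?A else 0)
      + (- \<kappa>' * H k i x) * (if j = k then pdet r ?A else 0))"
  proof (intro sum.cong refl)
    fix k assume "k \<in> {..<r}"
    then show "pdet r (\<lambda>m. if m = k then (\<lambda>l. (- \<kappa> * H k j x) * ?A i l + (- \<kappa>' * H k i x) * ?A j l) else ?A m)
      = (- \<kappa> * H k j x) * (if i = k then pdet r ?A else 0) + (- \<kappa>' * H k i x) * (if j = k then pdet r ?A else 0)"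
      using pdet_row_comb2[of k r "- \<kappa> * H k j x" "?A i" "- \<kappa>' * H k i x" "?A j" ?A]
        pdet_row_other[of k r i ?A] pdet_row_other[of k r j ?A] ij by simp
  qed
  also have "\<dots> = - (\<kappa> * H i j x + \<kappa>' * H j i x) * pdet r ?A"
    using ij by (simp add: sum.distrib if_distrib[of "\<lambda>y. _ * y"] algebra_simps cong: if_cong)
  also have "\<kappa>' * H j i x = \<kappa>' * H i j x" using sym ij by auto
  finally show ?thesis by (simp add: algebra_simps)
qed

lemma has_partial_cnj: "has_partial e f a x \<Longrightarrow> has_partial e (\<lambda>x. cnj (f x)) (cnj a) x"
  unfolding has_partial_def by (rule has_vector_derivative_cnj)

lemma has_partial_inverse:
  assumes "has_partial e f a x" "f x \<noteq> 0"
  shows "has_partial e (\<lambda>x. inverse (f x)) (- (a / (f x)\<^sup>2)) x"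
proof -
  have "(inverse has_field_derivative (- inverse ((f x)\<^sup>2))) (at (f (x + 0 *\<^sub>R axis e 1)))"
    using DERIV_inverse[of "f x" UNIV] assms(2) by (simp add: numeral_2_eq_2)
  from field_vector_diff_chain_at[OF assms(1)[unfolded has_partial_def] this]
  show ?thesis by (simp add: has_partial_def o_def field_simps)
qed

section \<open>Powers of determinants of sums of rank-one matrices\<close>

text \<open>The hypothesis says that no nonzero vector is orthogonal to every \<open>v e\<close>;
  with positive weights the Hermitian matrix \<open>X x\<close> is then positive definite.\<close>

locale rank_one_sum =
  fixes n :: nat and v :: "'e::finite \<Rightarrow> nat \<Rightarrow> complex"
  assumes spanning: "(\<And>e. (\<Sum>k<n. cnj (v e k) * u k) = 0) \<Longrightarrow> k < n \<Longrightarrow> u k = 0"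
begin

definition X :: "real ^ 'e \<Rightarrow> nat \<Rightarrow> nat \<Rightarrow> complex" where
  "X x k l = (\<Sum>e\<in>UNIV. of_real (x $ e) * (v e k * cnj (v e l)))"

text \<open>The inverse of \<open>X x\<close> by Cramer's rule, meaningful where the determinant is
  nonzero.\<close>

definition G :: "real ^ 'e \<Rightarrow> nat \<Rightarrow> nat \<Rightarrow> complex" where
  "G x j i = padj n (X x) j i / pdet n (X x)"

text \<open>Entry (k, l) of the matrix product -G V G, where V is the rank-one matrix of e, the
  derivative of X along e.\<close>

definition dG :: "'e \<Rightarrow> nat \<Rightarrow> nat \<Rightarrow> real ^ 'e \<Rightarrow> complex" where
  "dG e k l x = - (\<Sum>a<n. \<Sum>b<n. G x k a * (v e a * cnj (v e b)) * G x b l)"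

lemma X_hermitian: "cnj (X x k l) = X x l k"
  by (simp add: X_def cnj_sum mult_ac)

lemma has_partial_X: "has_partial e (\<lambda>x. X x k l) (v e k * cnj (v e l)) x"
proof -
  have "X (x + \<tau> *\<^sub>R axis e 1) k l = X x k l + of_real \<tau> * (v e k * cnj (v e l))" for \<tau>
  proof -
    have "X (x + \<tau> *\<^sub>R axis e 1) k l
      = X x k l + (\<Sum>e'\<in>UNIV. if e' = e then of_real \<tau> * (v e' k * cnj (v e' l)) else 0)"
      unfolding X_def sum.distrib[symmetric] by (intro sum.cong refl) (auto simp: axis_def algebra_simps)
    then show ?thesis by simp
  qed
  then show ?thesis
    unfolding has_partial_def by (auto intro!: derivative_eq_intros)
qed

context
  fixes x :: "real ^ 'e"
  assumes det: "pdet n (X x) \<noteq> 0"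
begin

lemma X_G: "i < n \<Longrightarrow> l < n \<Longrightarrow> (\<Sum>j<n. X x l j * G x j i) = of_bool (l = i)"
  using mult_padj[of i n l "X x"] det by (simp add: G_def sum_divide_distrib[symmetric])

text \<open>Y = Y (X G) = (Y X) G = G. Applied to the conjugate transpose and to the transpose of G,
  it gives the symmetry properties of G.\<close>

lemma left_inverse_unique:
  assumes "\<And>a l. a < n \<Longrightarrow> l < n \<Longrightarrow> (\<Sum>j<n. Y a j * X x j l) = of_bool (a = l)" and ai: "a < n" "i < n"
  shows "Y a i = G x a i"
proof -
  have "Y a i = (\<Sum>l<n. Y a l * (\<Sum>j<n. X x l j * G x j i))"
    using ai X_G[OF ai(2)] by (simp add: if_distrib[of "\<lambda>y. _ * y"] of_bool_def cong: if_cong)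
  also have "\<dots> = (\<Sum>j<n. (\<Sum>l<n. Y a l * X x l j) * G x j i)"
    unfolding sum_distrib_left sum_distrib_right by (subst sum.swap) (simp add: mult_ac)
  also have "\<dots> = G x a i"
    using ai assms(1)[OF ai(1)] by (simp add: if_distrib[of "\<lambda>y. y * _"] of_bool_def cong: if_cong)
  finally show ?thesis .
qed

lemma G_hermitian: "a < n \<Longrightarrow> i < n \<Longrightarrow> cnj (G x i a) = G x a i"
proof (rule left_inverse_unique[of "\<lambda>a i. cnj (G x i a)"])
  fix a l assume "a < n" "l < n"
  then have "cnj (\<Sum>j<n. X x l j * G x j a) = of_bool (a = l)"
    using X_G by simp
  then show "(\<Sum>j<n. cnj (G x j a) * X x j l) = of_bool (a = l)"
    by (simp add: X_hermitian mult_ac)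
qed

lemma G_X: "a < n \<Longrightarrow> l < n \<Longrightarrow> (\<Sum>j<n. G x a j * X x j l) = of_bool (a = l)"
proof -
  assume al: "a < n" "l < n"
  then have "(\<Sum>j<n. G x a j * X x j l) = cnj (\<Sum>j<n. X x l j * G x j a)"
    by (simp add: X_hermitian) (intro sum.cong refl, simp add: G_hermitian mult_ac)
  then show ?thesis using X_G[OF al] by simp
qed

lemma G_symmetric:
  assumes "\<And>e k. k < n \<Longrightarrow> cnj (v e k) = v e k" and "a < n" "i < n"
  shows "G x i a = G x a i"
proof (rule left_inverse_unique[of "\<lambda>a i. G x i a"])
  have s: "X x j l = X x l j" if "j < n" "l < n" for j l
    using assms(1) that by (simp add: X_def mult_ac)
  fix a l assume al: "a < n" "l < n"
  then have "(\<Sum>j<n. G x j a * X x j l) = (\<Sum>j<n. X x l j * G x j a)"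
    by (intro sum.cong refl) (simp add: s)
  then show "(\<Sum>j<n. G x j a * X x j l) = of_bool (a = l)" using X_G[OF al] by simp
qed (use assms in auto)

text \<open>Jacobi's formula: differentiating one row at a time and expanding along that row
  produces the adjugate, hence the determinant times a trace.\<close>

lemma has_partial_det:
  "has_partial e (\<lambda>x. pdet n (X x)) (pdet n (X x) * (\<Sum>k<n. \<Sum>j<n. v e k * cnj (v e j) * G x j k)) x"
proof -
  have "has_partial e (\<lambda>x. pdet n (\<lambda>i j. X x i j))
    (\<Sum>k<n. pdet n (\<lambda>i. if i = k then (\<lambda>j. v e k * cnj (v e j)) else X x i)) x"
    by (intro has_partial_pdet has_partial_X)
  also have "(\<Sum>k<n. pdet n (\<lambda>i. if i = k then (\<lambda>j. v e k * cnj (v e j)) else X x i))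
    = (\<Sum>k<n. \<Sum>j<n. v e k * cnj (v e j) * padj n (X x) j k)"
    by (intro sum.cong refl pdet_row_padj) simp
  also have "\<dots> = pdet n (X x) * (\<Sum>k<n. \<Sum>j<n. v e k * cnj (v e j) * G x j k)"
    using det by (simp add: G_def sum_distrib_left)
  finally show ?thesis .
qed

lemma G_differentiable: "\<exists>g. has_partial e (\<lambda>x. G x j i) g x"
proof -
  have "\<exists>a. has_partial e (\<lambda>x. padj n (X x) j i) a x"
  proof -
    let ?A = "\<lambda>k l x. if k = i then of_bool (l = j) else X x k l"
    let ?dA = "\<lambda>k l. if k = i then 0 else v e k * cnj (v e l)"
    have "has_partial e (?A k l) (?dA k l) x" for k l
      using has_partial_X has_partial_const by (cases "k = i") auto
    from has_partial_pdet[of n e ?A ?dA x, OF this]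
    have "\<exists>a. has_partial e (\<lambda>x. pdet n (\<lambda>k l. ?A k l x)) a x" by blast
    moreover have "padj n (X x) j i = pdet n (\<lambda>k l. ?A k l x)" for x
      unfolding padj_def by (intro pdet_cong) auto
    ultimately show ?thesis by simp
  qed
  then obtain a where "has_partial e (\<lambda>x. padj n (X x) j i) a x" by blast
  from has_partial_mult[OF this has_partial_inverse[OF has_partial_det det]]
  show ?thesis unfolding G_def divide_inverse by blast
qed

text \<open>Differentiating X G = 1 and multiplying by G from the left determines the derivative of
  G. That a derivative exists comes from \<open>G_differentiable\<close>, where G is a quotient of
  polynomials.\<close>

lemma has_partial_G:
  assumes U: "open U" "x \<in> U" "\<And>y. y \<in> U \<Longrightarrow> pdet n (X y) \<noteq> 0" and kl: "k < n" "l < n"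
  shows "has_partial e (\<lambda>x. G x k l) (dG e k l x) x"
proof -
  have "\<forall>j. \<exists>g. has_partial e (\<lambda>x. G x j l) g x" using G_differentiable by blast
  from choice[OF this] obtain g where g: "\<And>j. has_partial e (\<lambda>x. G x j l) (g j) x" by blast
  let ?V = "\<lambda>a b. v e a * cnj (v e b)"
  have eq: "(\<Sum>b<n. ?V a b * G x b l) + (\<Sum>b<n. X x a b * g b) = 0" if "a < n" for a
  proof -
    have "has_partial e (\<lambda>x. \<Sum>b<n. X x a b * G x b l) (\<Sum>b<n. X x a b * g b + ?V a b * G x b l) x"
      by (intro has_partial_sum has_partial_mult has_partial_X g)
    moreover have "(\<Sum>b<n. X y a b * G y b l) = of_bool (a = l)" if "y \<in> U" for y
      using mult_padj[of l n a "X y"] U(3)[OF that] kl \<open>a < n\<close>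
      by (simp add: G_def sum_divide_distrib[symmetric])
    then have "has_partial e (\<lambda>x. \<Sum>b<n. X x a b * G x b l) 0 x"
      by (intro has_partial_cong_open[OF U(1,2) _ has_partial_const]) (rule sym)
    ultimately have "(\<Sum>b<n. X x a b * g b + ?V a b * G x b l) = 0"
      by (rule has_partial_unique)
    then show ?thesis by (simp add: sum.distrib add.commute)
  qed
  have "g k = (\<Sum>b<n. (\<Sum>a<n. G x k a * X x a b) * g b)"
    using kl G_X[OF kl(1)] by (simp add: if_distrib[of "\<lambda>y. y * _"] of_bool_def cong: if_cong)
  also have "\<dots> = (\<Sum>a<n. G x k a * (\<Sum>b<n. X x a b * g b))"
    unfolding sum_distrib_left sum_distrib_right by (subst sum.swap) (simp add: mult_ac)
  also have "\<dots> = (\<Sum>a<n. G x k a * - (\<Sum>b<n. ?V a b * G x b l))"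
    by (intro sum.cong refl arg_cong2[of _ _ _ _ "(*)"]) (use eq in \<open>auto simp: eq_neg_iff_add_eq_0 add.commute\<close>)
  also have "\<dots> = dG e k l x"
    by (simp add: dG_def sum_distrib_left sum_negf mult_ac)
  finally show ?thesis using g by metis
qed

lemma quadratic_form:
  "(\<Sum>k<n. cnj (y k) * (\<Sum>l<n. X x k l * y l))
    = (\<Sum>e\<in>UNIV. of_real (x $ e) * of_real ((cmod (\<Sum>l<n. cnj (v e l) * y l))\<^sup>2))"
proof -
  have "(\<Sum>k<n. cnj (y k) * (\<Sum>l<n. X x k l * y l))
    = (\<Sum>k<n. \<Sum>l<n. \<Sum>e\<in>UNIV. of_real (x $ e) * ((cnj (y k) * v e k) * (cnj (v e l) * y l)))"
    by (simp add: X_def sum_distrib_left sum_distrib_right mult_ac)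
  also have "\<dots> = (\<Sum>k<n. \<Sum>e\<in>UNIV. \<Sum>l<n. of_real (x $ e) * ((cnj (y k) * v e k) * (cnj (v e l) * y l)))"
    by (intro sum.cong refl sum.swap)
  also have "\<dots> = (\<Sum>e\<in>UNIV. \<Sum>k<n. \<Sum>l<n. of_real (x $ e) * ((cnj (y k) * v e k) * (cnj (v e l) * y l)))"
    by (rule sum.swap)
  also have "\<dots> = (\<Sum>e\<in>UNIV. of_real (x $ e) * ((\<Sum>k<n. cnj (y k) * v e k) * (\<Sum>l<n. cnj (v e l) * y l)))"
    by (simp only: sum_product, simp only: sum_distrib_left)
  also have "\<dots> = (\<Sum>e\<in>UNIV. of_real (x $ e) * of_real ((cmod (\<Sum>l<n. cnj (v e l) * y l))\<^sup>2))"
  proof (intro sum.cong refl arg_cong2[of _ _ _ _ "(*)"])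
    fix e
    have "(\<Sum>k<n. cnj (y k) * v e k) = cnj (\<Sum>l<n. cnj (v e l) * y l)"
      by (simp add: mult.commute)
    then show "(\<Sum>k<n. cnj (y k) * v e k) * (\<Sum>l<n. cnj (v e l) * y l)
      = of_real ((cmod (\<Sum>l<n. cnj (v e l) * y l))\<^sup>2)"
      by (simp only: complex_norm_square mult.commute)
  qed
  finally show ?thesis .
qed

text \<open>A null vector of the leading block of \<open>G = X\<^sup>-\<^sup>1\<close>, padded by zeros to \<open>z\<close>, gives \<open>y = G z\<close> with
  \<open>y\<^sup>* X y = y\<^sup>* z = 0\<close>, contradicting positive definiteness of \<open>X\<close>.\<close>
lemma leading_minor_inverse_nonzero:
  assumes "x \<in> positive_orthant" "r \<le> n"
  shows "pdet r (G x) \<noteq> 0"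
proof
  assume "pdet r (G x) = 0"
  then obtain u k0 where u: "k0 < r" "u k0 \<noteq> 0" "\<And>i. i < r \<Longrightarrow> (\<Sum>j<r. G x i j * u j) = 0"
    unfolding pdet_eq_0_iff by blast
  define z where "z k = (if k < r then u k else 0)" for k
  define y where "y k = (\<Sum>l<n. G x k l * z l)" for k
  have yr: "y k = 0" if "k < r" for k
  proof -
    have "y k = (\<Sum>l<r. G x k l * z l)"
      unfolding y_def using assms(2) by (intro sum.mono_neutral_right) (auto simp: z_def)
    then show ?thesis using u(3)[OF that] by (simp add: z_def)
  qed
  have Xy: "(\<Sum>l<n. X x k l * y l) = z k" if "k < n" for k
  proof -
    have "(\<Sum>l<n. X x k l * y l) = (\<Sum>m<n. (\<Sum>l<n. X x k l * G x l m) * z m)"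
      unfolding y_def sum_distrib_left sum_distrib_right by (subst sum.swap) (simp add: mult_ac)
    also have "\<dots> = z k"
      using that X_G by (simp add: if_distrib[of "\<lambda>y. y * _"] of_bool_def cong: if_cong)
    finally show ?thesis .
  qed
  have "(\<Sum>k<n. cnj (y k) * (\<Sum>l<n. X x k l * y l)) = 0"
    by (intro sum.neutral ballI) (use Xy yr z_def in auto)
  then have "complex_of_real (\<Sum>e\<in>UNIV. x $ e * (cmod (\<Sum>l<n. cnj (v e l) * y l))\<^sup>2) = 0"
    unfolding quadratic_form by simp
  then have "(\<Sum>e\<in>UNIV. x $ e * (cmod (\<Sum>l<n. cnj (v e l) * y l))\<^sup>2) = 0"
    by (simp only: of_real_eq_0_iff)
  moreover have pos: "0 < x $ e" for e using assms(1) by (simp add: positive_orthant_def)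
  ultimately have e0: "x $ e * (cmod (\<Sum>l<n. cnj (v e l) * y l))\<^sup>2 = 0" for e
    by (subst (asm) sum_nonneg_eq_0_iff) (auto intro!: mult_nonneg_nonneg less_imp_le[OF pos])
  then have "(\<Sum>l<n. cnj (v e l) * y l) = 0" for e
    using pos[of e] e0[of e] by simp
  then have "y l = 0" if "l < n" for l
    using spanning[of y l] that by simp
  then have "z k0 = 0" using Xy[of k0] u(1) assms(2) by simp
  then show False using u by (simp add: z_def)
qed

end

end

section \<open>The contradiction from applying the minor operator twice\<close>

lemma cnj_row_coef: "cnj (row_coef w \<sigma> es) = row_coef (\<lambda>i j e. cnj (w i j e)) \<sigma> es"
  by (induction es) auto

lemma cnj_det_coef: "cnj (det_coef r w es) = det_coef r (\<lambda>i j e. cnj (w i j e)) es"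
  by (simp add: det_coef_def cnj_row_coef)

lemma cnj_pdet: "cnj (pdet n A) = pdet n (\<lambda>i j. cnj (A i j))"
  by (simp add: pdet_def)

context rank_one_sum
begin

text \<open>The coefficients \<open>w i j\<close> combine the axis derivatives into a matrix
  derivative: they send X to the matrix unit at (j, i) if \<kappa> = 1, and in general to its
  mixture with the unit at (i, j). The second application uses the conjugate coefficients, so that
  the total operator is q times its conjugate. The constant c allows the determinant to be a
  multiple of B.\<close>

theorem not_completely_monotone:
  fixes B :: "real ^ 'e \<Rightarrow> real" and w :: "nat \<Rightarrow> nat \<Rightarrow> 'e \<Rightarrow> complex" and \<kappa> \<beta> c :: real
  assumes r: "r \<le> n" and c: "c > 0"
    and B: "\<And>x. x \<in> positive_orthant \<Longrightarrow> B x > 0"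
      "\<And>x. x \<in> positive_orthant \<Longrightarrow> pdet n (X x) = of_real (c * B x)"
    and w: "\<And>i j k l. i < r \<Longrightarrow> j < r \<Longrightarrow> k < n \<Longrightarrow> l < n \<Longrightarrow>
      (\<Sum>e\<in>UNIV. w i j e * (v e k * cnj (v e l)))
        = of_real \<kappa> * of_bool (k = j \<and> l = i) + of_real (1 - \<kappa>) * of_bool (k = i \<and> l = j)"
    and real: "\<kappa> = 1 \<or> (\<forall>e. \<forall>k<n. cnj (v e k) = v e k)"
    and neg: "(\<Prod>i<r. (\<beta> - \<kappa> * real i) * (\<beta> + 1 - \<kappa> * real i)) < 0"
    and C: "open_convex_cone C" "C \<noteq> {}" "C \<subseteq> positive_orthant"
  shows "\<not> completely_monotone_on C (\<lambda>x. B x powr (- \<beta>))"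
proof
  let ?f = "\<lambda>x. B x powr (- \<beta>)"
  assume cm: "completely_monotone_on C ?f"
  have opC: "open C" and sm: "smooth_on C ?f"
    using C cm by (auto simp: open_convex_cone_def completely_monotone_on_def)
  have BC: "B x > 0" "pdet n (X x) = of_real (c * B x)" "pdet n (X x) \<noteq> 0" if "x \<in> C" for x
    using B[of x] that C(3) c by auto
  define F where "F es x = complex_of_real (foldr dir_deriv (map (\<lambda>e. axis e 1) es) ?f x)" for es x
  define H where "H i j x = G x i j" for i j x
  let ?cn = "\<lambda>i j e. cnj (w i j e)"
  let ?detH = "\<lambda>x. pdet r (\<lambda>i j. H i j x)"
  have hF: "has_partial e (F es) (F (e # es) x) x" if "x \<in> C" for e es x
  proof -
    let ?D = "foldr dir_deriv (map (\<lambda>e. axis e 1) es) ?f"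
    have "((\<lambda>\<tau>. ?D (x + \<tau> *\<^sub>R axis e 1)) has_real_derivative dir_deriv (axis e 1) ?D (x + 0 *\<^sub>R axis e 1)) (at 0)"
      using dir_deriv_has_derivative[OF smooth_on_iterated_dir_deriv[OF opC sm], of x 0] that by simp
    then show ?thesis
      unfolding has_partial_def F_def
      by (intro has_vector_derivative_of_real) (simp add: has_real_derivative_iff_has_vector_derivative)
  qed
  have lessn: "i < r \<Longrightarrow> i < n" for i using r by simp
  have hH: "has_partial e (H k l) (dG e k l x) x" if "x \<in> C" "k < r" "l < r" for e k l x
    unfolding H_def using has_partial_G[OF BC(3)[OF that(1)] opC that(1) BC(3)] lessn that by blast
  have Hsym: "of_real (1 - \<kappa>) = (0::complex) \<or> (\<forall>x\<in>C. \<forall>k<r. \<forall>l<r. H k l x = H l k x)"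
    using real G_symmetric[OF BC(3)] lessn unfolding H_def by auto
  have Hherm: "cnj (H k l x) = H l k x" if "x \<in> C" "k < r" "l < r" for k l x
    unfolding H_def using G_hermitian[OF BC(3)[OF that(1)]] lessn that by blast
  have lawH: "(\<Sum>e\<in>UNIV. w i j e * dG e k l x)
      = - (of_real \<kappa> * (H i l x * H k j x) + of_real (1 - \<kappa>) * (H k i x * H j l x))"
    if "x \<in> C" "i < r" "j < r" "k < r" "l < r" for i j k l x
  proof -
    have "(\<Sum>e\<in>UNIV. w i j e * dG e k l x)
      = - (\<Sum>a<n. \<Sum>b<n. G x k a * (\<Sum>e\<in>UNIV. w i j e * (v e a * cnj (v e b))) * G x b l)"
    proof -
      have "(\<Sum>e\<in>UNIV. w i j e * dG e k l x)
        = - (\<Sum>e\<in>UNIV. \<Sum>a<n. \<Sum>b<n. G x k a * (w i j e * (v e a * cnj (v e b))) * G x b l)"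
        unfolding dG_def by (simp add: sum_distrib_left sum_negf mult_ac)
      also have "(\<Sum>e\<in>UNIV. \<Sum>a<n. \<Sum>b<n. G x k a * (w i j e * (v e a * cnj (v e b))) * G x b l)
        = (\<Sum>a<n. \<Sum>e\<in>UNIV. \<Sum>b<n. G x k a * (w i j e * (v e a * cnj (v e b))) * G x b l)"
        by (rule sum.swap)
      also have "\<dots> = (\<Sum>a<n. \<Sum>b<n. \<Sum>e\<in>UNIV. G x k a * (w i j e * (v e a * cnj (v e b))) * G x b l)"
        by (intro sum.cong refl sum.swap)
      finally show ?thesis by (simp only: sum_distrib_left sum_distrib_right)
    qed
    also have "\<dots> = - (\<Sum>a<n. \<Sum>b<n. (if b = i then if a = j then of_real \<kappa> * (G x k j * G x i l) else 0 else 0)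
        + (if b = j then if a = i then of_real (1 - \<kappa>) * (G x k i * G x j l) else 0 else 0))"
      using that by (intro arg_cong[of _ _ uminus] sum.cong refl) (simp add: w, simp add: algebra_simps)
    also have "\<dots> = - (of_real \<kappa> * (H i l x * H k j x) + of_real (1 - \<kappa>) * (H k i x * H j l x))"
      using lessn that by (simp add: sum.distrib H_def)
    finally show ?thesis .
  qed
  \<comment> \<open>The logarithmic derivative of the determinant is the trace of G times the
    derivative of X; for the direction \<open>w i j\<close> this trace reduces to a single entry of
    G.\<close>
  have lawF: "(\<Sum>e\<in>UNIV. w i j e * F [e] x) = of_real (- \<beta>) * F [] x * H i j x"
    if x: "x \<in> C" and ij: "i < r" "j < r" for i j x
  proof -
    let ?d = "\<lambda>e. (\<Sum>k<n. \<Sum>l<n. v e k * cnj (v e l) * G x l k)"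
    have Fe: "F [e] x = of_real (- \<beta>) * F [] x * ?d e" for e
    proof -
      have hd: "has_partial e (\<lambda>x. pdet n (X x)) (pdet n (X x) * ?d e) x"
        by (rule has_partial_det[OF BC(3)[OF x]])
      let ?b = "Re (pdet n (X x) * ?d e) / c"
      \<comment> \<open>The determinant is complex-valued and B is real, so the derivative of B is
        obtained from the real part divided by c and afterwards compared with the complex
        one.\<close>
      have "((\<lambda>\<tau>. Re (pdet n (X (x + \<tau> *\<^sub>R axis e 1)))) has_vector_derivative Re (pdet n (X x) * ?d e)) (at 0)"
        using hd unfolding has_partial_def by (rule bounded_linear.has_vector_derivative[OF bounded_linear_Re])
      then have "((\<lambda>\<tau>. Re (pdet n (X (x + \<tau> *\<^sub>R axis e 1))) / c) has_real_derivative ?b) (at 0)"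
        unfolding has_real_derivative_iff_has_vector_derivative[symmetric] by (rule DERIV_cdivide)
      then have "((\<lambda>\<tau>. complex_of_real (Re (pdet n (X (x + \<tau> *\<^sub>R axis e 1))) / c)) has_vector_derivative of_real ?b) (at 0)"
        by (intro has_vector_derivative_of_real) (simp add: has_real_derivative_iff_has_vector_derivative)
      then have "has_partial e (\<lambda>y. complex_of_real (Re (pdet n (X y)) / c)) (of_real ?b) x"
        by (simp add: has_partial_def)
      then have hB: "has_partial e (\<lambda>y. complex_of_real (B y)) (of_real ?b) x"
        by (rule has_partial_cong_open[OF opC x, rotated]) (use BC c in simp)
      then have "has_partial e (\<lambda>y. complex_of_real c * complex_of_real (B y)) (of_real c * of_real ?b) x"
        by (rule has_partial_cmult)
      then have "has_partial e (\<lambda>y. pdet n (X y)) (of_real c * of_real ?b) x"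
        by (rule has_partial_cong_open[OF opC x, rotated]) (use BC in simp)
      with hd have "pdet n (X x) * ?d e = of_real c * of_real ?b"
        by (rule has_partial_unique)
      then have bd: "complex_of_real ?b = of_real (B x) * ?d e"
        using BC[OF x] c by simp
      have "((\<lambda>\<tau>. Re (complex_of_real (B (x + \<tau> *\<^sub>R axis e 1)))) has_vector_derivative Re (of_real ?b)) (at 0)"
        using hB unfolding has_partial_def by (rule bounded_linear.has_vector_derivative[OF bounded_linear_Re])
      then have "((\<lambda>\<tau>. B (x + \<tau> *\<^sub>R axis e 1)) has_real_derivative ?b) (at 0)"
        by (simp add: has_real_derivative_iff_has_vector_derivative)
      moreover have "((\<lambda>y. y powr (- \<beta>)) has_real_derivative (- \<beta>) * (B x) powr (- \<beta> - 1)) (at (B (x + 0 *\<^sub>R axis e 1)))"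
        using has_real_derivative_powr[OF BC(1)[OF x], of "- \<beta>"] by simp
      ultimately have "((\<lambda>\<tau>. ?f (x + \<tau> *\<^sub>R axis e 1)) has_real_derivative (- \<beta>) * (B x) powr (- \<beta> - 1) * ?b) (at 0)"
        by (rule DERIV_chain2[rotated])
      then have "((\<lambda>\<tau>. complex_of_real (?f (x + \<tau> *\<^sub>R axis e 1))) has_vector_derivative
          of_real ((- \<beta>) * (B x) powr (- \<beta> - 1) * ?b)) (at 0)"
        by (intro has_vector_derivative_of_real) (simp add: has_real_derivative_iff_has_vector_derivative)
      then have "has_partial e (F []) (of_real ((- \<beta>) * (B x) powr (- \<beta> - 1) * ?b)) x"
        by (simp add: has_partial_def F_def)
      then have "F [e] x = of_real ((- \<beta>) * (B x) powr (- \<beta> - 1) * ?b)"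
        using hF[OF x] has_partial_unique by blast
      also have "\<dots> = of_real (- \<beta>) * of_real ((B x) powr (- \<beta> - 1) * B x) * ?d e"
        unfolding of_real_mult bd by simp
      also have "(B x) powr (- \<beta> - 1) * B x = B x powr (- \<beta>)"
        using BC(1)[OF x] by (simp add: powr_diff)
      finally show ?thesis by (simp add: F_def)
    qed
    have "(\<Sum>e\<in>UNIV. w i j e * ?d e) = (\<Sum>k<n. \<Sum>l<n. (\<Sum>e\<in>UNIV. w i j e * (v e k * cnj (v e l))) * G x l k)"
    proof -
      have "(\<Sum>e\<in>UNIV. w i j e * ?d e) = (\<Sum>e\<in>UNIV. \<Sum>k<n. \<Sum>l<n. w i j e * (v e k * cnj (v e l)) * G x l k)"
        by (simp add: sum_distrib_left mult_ac)
      also have "\<dots> = (\<Sum>k<n. \<Sum>e\<in>UNIV. \<Sum>l<n. w i j e * (v e k * cnj (v e l)) * G x l k)"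
        by (rule sum.swap)
      also have "\<dots> = (\<Sum>k<n. \<Sum>l<n. \<Sum>e\<in>UNIV. w i j e * (v e k * cnj (v e l)) * G x l k)"
        by (intro sum.cong refl sum.swap)
      finally show ?thesis by (simp only: sum_distrib_right)
    qed
    also have "\<dots> = (\<Sum>k<n. \<Sum>l<n. (if l = i then if k = j then of_real \<kappa> * G x i j else 0 else 0)
        + (if l = j then if k = i then of_real (1 - \<kappa>) * G x j i else 0 else 0))"
      using ij by (intro sum.cong refl) (simp add: w, simp add: algebra_simps)
    also have "\<dots> = of_real \<kappa> * H i j x + of_real (1 - \<kappa>) * H j i x"
      using lessn ij by (simp add: sum.distrib H_def)
    also have "\<dots> = H i j x"
      using Hsym x ij by (auto simp: algebra_simps)
    finally have "(\<Sum>e\<in>UNIV. w i j e * ?d e) = H i j x" .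
    then have "of_real (- \<beta>) * F [] x * (\<Sum>e\<in>UNIV. w i j e * ?d e) = of_real (- \<beta>) * F [] x * H i j x" by simp
    then show ?thesis unfolding Fe by (simp add: sum_distrib_left mult_ac)
  qed
  define Q where "Q es = det_coef r w es" for es
  let ?p = "\<lambda>s. \<Prod>i<r. of_real s + complex_of_real \<kappa> * of_nat i"
  have first: "(\<Sum>es | length es = r. Q es * F es x) = ?p (- \<beta>) * F [] x * ?detH x" if "x \<in> C" for x
    unfolding Q_def
    by (rule cayley_identity[OF opC hF hH lawF lawH Hsym that])
  \<comment> \<open>\<open>K es' x\<close> is the \<open>es'\<close>-derivative of the first
    application. Since heads are differentiated last, \<open>es'\<close> stands in front, and K
    meets the same recursion as F in \<open>cayley_identity\<close>.\<close>
  define K where "K es' x = (\<Sum>es | length es = r. Q es * F (es' @ es) x)" for es' x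
  have hK: "has_partial e (K es) (K (e # es) x) x" if "x \<in> C" for e es x
    unfolding K_def append_Cons by (intro has_partial_sum has_partial_cmult hF that)
  have K0: "K [] x = ?p (- \<beta>) * (F [] x * ?detH x)" if "x \<in> C" for x
    using first[OF that] by (simp add: K_def mult.assoc)
  let ?ddet = "\<lambda>e x. \<Sum>k<r. pdet r (\<lambda>i. if i = k then (\<lambda>l. dG e k l x) else (\<lambda>j. H i j x))"
  have Ke: "K [e] x = ?p (- \<beta>) * (F [] x * ?ddet e x + F [e] x * ?detH x)" if "x \<in> C" for e x
  proof -
    have "has_partial e ?detH (?ddet e x) x"
      by (intro has_partial_pdet hH that)
    then have "has_partial e (\<lambda>x. ?p (- \<beta>) * (F [] x * ?detH x)) (?p (- \<beta>) * (F [] x * ?ddet e x + F [e] x * ?detH x)) x"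
      by (intro has_partial_cmult has_partial_mult hF that)
    then have "has_partial e (K []) (?p (- \<beta>) * (F [] x * ?ddet e x + F [e] x * ?detH x)) x"
      by (rule has_partial_cong_open[OF opC that, rotated]) (simp add: K0)
    then show ?thesis using hK[OF that] has_partial_unique by blast
  qed
  have cnj_dG: "cnj (dG e k l x) = dG e l k x" if x: "x \<in> C" and "k < r" "l < r" for e k l x
  proof -
    have "has_partial e (\<lambda>x. cnj (H k l x)) (cnj (dG e k l x)) x"
      by (intro has_partial_cnj hH that)
    then have "has_partial e (H l k) (cnj (dG e k l x)) x"
      by (rule has_partial_cong_open[OF opC x, rotated]) (use Hherm that in auto)
    then show ?thesis using hH that has_partial_unique by blast
  qed
  have lawH': "(\<Sum>e\<in>UNIV. ?cn i j e * dG e k l x)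
      = - (of_real \<kappa> * (H j l x * H k i x) + of_real (1 - \<kappa>) * (H k j x * H i l x))"
    if "x \<in> C" "i < r" "j < r" "k < r" "l < r" for i j k l x
  proof -
    have "(\<Sum>e\<in>UNIV. ?cn i j e * dG e k l x) = cnj (\<Sum>e\<in>UNIV. w i j e * dG e l k x)"
      using that by (simp add: cnj_dG)
    also have "\<dots> = cnj (- (of_real \<kappa> * (H i k x * H l j x) + of_real (1 - \<kappa>) * (H l i x * H j k x)))"
      using lawH that by simp
    finally show ?thesis using that Hherm by (simp add: mult_ac)
  qed
  have lawF': "(\<Sum>e\<in>UNIV. ?cn i j e * F [e] x) = of_real (- \<beta>) * F [] x * H j i x"
    if "x \<in> C" "i < r" "j < r" for i j x
  proof -
    have "(\<Sum>e\<in>UNIV. ?cn i j e * F [e] x) = cnj (\<Sum>e\<in>UNIV. w i j e * F [e] x)"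
      by (simp add: F_def)
    also have "\<dots> = cnj (of_real (- \<beta>) * F [] x * H i j x)" using lawF that by simp
    finally show ?thesis using that Hherm by (simp add: F_def)
  qed
  have lawK: "(\<Sum>e\<in>UNIV. ?cn i j e * K [e] x) = of_real (- \<beta> - 1) * K [] x * H j i x"
    if x: "x \<in> C" and ij: "i < r" "j < r" for i j x
  proof -
    have "(\<Sum>e\<in>UNIV. ?cn i j e * ?ddet e x) = - (of_real \<kappa> + of_real (1 - \<kappa>)) * H j i x * ?detH x"
      by (rule pdet_derivative_law[where H = H and i = j and j = i])
         (use lawH' x ij Hsym in auto)
    then have dd: "(\<Sum>e\<in>UNIV. ?cn i j e * ?ddet e x) = - (H j i x * ?detH x)" by simp
    have "(\<Sum>e\<in>UNIV. ?cn i j e * K [e] x)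
      = ?p (- \<beta>) * (F [] x * (\<Sum>e\<in>UNIV. ?cn i j e * ?ddet e x) + (\<Sum>e\<in>UNIV. ?cn i j e * F [e] x) * ?detH x)"
    proof -
      have alg: "(\<Sum>e\<in>UNIV. a e * (p * (q * d e + g e * h))) = p * (q * (\<Sum>e\<in>UNIV. a e * d e) + (\<Sum>e\<in>UNIV. a e * g e) * h)"
        for p q h :: complex and a d g :: "'e \<Rightarrow> complex"
        by (simp add: sum_distrib_left sum_distrib_right sum.distrib[symmetric] algebra_simps)
      show ?thesis unfolding Ke[OF x] by (rule alg)
    qed
    also have "\<dots> = of_real (- \<beta> - 1) * (?p (- \<beta>) * (F [] x * ?detH x)) * H j i x"
      unfolding dd lawF'[OF x ij] by (simp add: algebra_simps)
    finally show ?thesis using K0[OF x] by simp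
  qed
  obtain x where x: "x \<in> C" using C(2) by blast
  \<comment> \<open>Conjugating the coefficients replaces the Hermitian H by its transpose; the
    transposed minor has the same value, so a square appears.\<close>
  have second: "(\<Sum>es | length es = r. det_coef r ?cn es * K es x)
    = ?p (- \<beta> - 1) * K [] x * pdet r (\<lambda>i j. H j i x)"
  proof (rule cayley_identity[OF opC hK, where H = "\<lambda>i j. H j i" and dH = "\<lambda>e i j. dG e j i"
        and \<kappa> = "of_real \<kappa>" and \<kappa>' = "of_real (1 - \<kappa>)"])
    show "of_real (1 - \<kappa>) = (0::complex) \<or> (\<forall>x\<in>C. \<forall>k<r. \<forall>l<r. H l k x = H k l x)"
      using Hsym by auto
    show "(\<Sum>e\<in>UNIV. ?cn i j e * dG e l k x)
        = - (of_real \<kappa> * (H l i x * H j k x) + of_real (1 - \<kappa>) * (H i k x * H l j x))"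
      if "x \<in> C" "i < r" "j < r" "k < r" "l < r" for i j k l x
      using lawH'[OF that(1-3) that(5,4)] by (simp add: mult_ac)
  qed (use x hH lawK in auto)
  have "cnj (?detH x) = pdet r (\<lambda>i j. H j i x)"
    unfolding cnj_pdet by (intro pdet_cong) (use Hherm x in auto)
  then have dT: "pdet r (\<lambda>i j. H j i x) = ?detH x" and dreal: "cnj (?detH x) = ?detH x"
    using pdet_transpose[of r "\<lambda>i j. H i j x"] by auto
  define h where "h = Re (?detH x)"
  have h: "?detH x = of_real h"
    using dreal by (simp add: h_def complex_eq_iff)
  have "x \<in> positive_orthant" using x C by blast
  then have "h \<noteq> 0"
    using leading_minor_inverse_nonzero[OF BC(3)[OF x] _ r] h unfolding H_def by (metis of_real_0)
  have prods: "?p (- \<beta> - 1) * ?p (- \<beta>) = of_real (\<Prod>i<r. (\<beta> - \<kappa> * real i) * (\<beta> + 1 - \<kappa> * real i))"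
    unfolding prod.distrib[symmetric] of_real_prod by (intro prod.cong refl) (simp add: algebra_simps)
  have total: "(\<Sum>es | length es = r. cnj (Q es) * K es x)
    = of_real ((\<Prod>i<r. (\<beta> - \<kappa> * real i) * (\<beta> + 1 - \<kappa> * real i)) * (?f x * h\<^sup>2))"
  proof -
    have "(\<Sum>es | length es = r. cnj (Q es) * K es x) = ?p (- \<beta> - 1) * K [] x * ?detH x"
      using second by (simp add: Q_def cnj_det_coef dT)
    also have "\<dots> = (?p (- \<beta> - 1) * ?p (- \<beta>)) * (F [] x * ?detH x * ?detH x)"
      using K0[OF x] by (simp add: mult_ac)
    finally show ?thesis unfolding prods h F_def by (simp add: power2_eq_square mult_ac)
  qed
  let ?L = "{es :: 'e list. length es = r}"
  have form: "0 \<le> (\<Sum>es\<in>?L. \<Sum>es'\<in>?L. q es * q es' * foldr dir_deriv (map (\<lambda>e. axis e 1) (es' @ es)) ?f x)"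
    for q :: "'e list \<Rightarrow> real"
    using completely_monotone_derivative_form[OF C(1) cm finite_lists_length[of r], of
      "\<lambda>es. rev (map (\<lambda>e. axis e 1) es)" r x q] x by simp
  \<comment> \<open>The values of F are real, and the real part of Q times a conjugate of Q is the
    sum of the products of real parts and of imaginary parts: the complex form is a sum of two real
    ones.\<close>
  have "0 \<le> Re (\<Sum>es\<in>?L. \<Sum>es'\<in>?L. Q es * cnj (Q es') * F (es' @ es) x)"
    using add_nonneg_nonneg[OF form[of "\<lambda>es. Re (Q es)"] form[of "\<lambda>es. Im (Q es)"]]
    by (simp add: F_def sum.distrib[symmetric] algebra_simps)
  also have "(\<Sum>es\<in>?L. \<Sum>es'\<in>?L. Q es * cnj (Q es') * F (es' @ es) x) = (\<Sum>es\<in>?L. cnj (Q es) * K es x)"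
    unfolding K_def sum_distrib_left by (subst sum.swap) (simp add: mult_ac)
  also have "Re \<dots> = (\<Prod>i<r. (\<beta> - \<kappa> * real i) * (\<beta> + 1 - \<kappa> * real i)) * (?f x * h\<^sup>2)"
    unfolding total by (rule Re_complex_of_real)
  also have "\<dots> < 0"
    using neg BC(1)[OF x] \<open>h \<noteq> 0\<close> by (intro mult_neg_pos mult_pos_pos) auto
  finally show False by simp
qed

text \<open>The determinant is homogeneous of degree n, so passing from x to x + x multiplies B by
  2^n. For negative \<beta> this makes the first difference of f in the cone direction x
  positive.\<close>

theorem not_completely_monotone_negative:
  fixes B :: "real ^ 'e \<Rightarrow> real" and \<beta> c :: real
  assumes n: "0 < n" and c: "c > 0"
    and B: "\<And>x. x \<in> positive_orthant \<Longrightarrow> B x > 0"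
      "\<And>x. x \<in> positive_orthant \<Longrightarrow> pdet n (X x) = of_real (c * B x)"
    and \<beta>: "\<beta> < 0"
    and C: "open_convex_cone C" "C \<noteq> {}" "C \<subseteq> positive_orthant"
  shows "\<not> completely_monotone_on C (\<lambda>x. B x powr (- \<beta>))"
proof
  let ?f = "\<lambda>x. B x powr (- \<beta>)"
  assume cm: "completely_monotone_on C ?f"
  obtain x where x: "x \<in> C" using C(2) by blast
  then have x2: "x + x \<in> C" using cone_add[OF C(1)] by blast
  have "X (x + x) = (\<lambda>k l. 2 * X x k l)"
    by (intro ext) (simp add: X_def sum_distrib_left algebra_simps)
  then have "pdet n (X (x + x)) = 2 ^ n * pdet n (X x)"
    using pdet_scale[of n 2 "X x"] by simp
  moreover have "x \<in> positive_orthant" "x + x \<in> positive_orthant" using x x2 C(3) by auto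
  ultimately have "of_real (c * B (x + x)) = complex_of_real (2 ^ n * (c * B x))"
    by (simp only: B(2)) simp
  then have "c * B (x + x) = 2 ^ n * (c * B x)"
    by (simp only: of_real_eq_iff)
  then have "B (x + x) = 2 ^ n * B x" using c by simp
  moreover have "(1::real) < 2 ^ n" using n by (simp add: one_less_power)
  ultimately have "B x < B (x + x)" using B(1)[of x] x C(3) by auto
  then have "?f x < ?f (x + x)"
    using \<beta> B(1)[of x] x C(3) by (intro powr_less_mono2) auto
  moreover have "0 \<le> (-1) ^ length [x] * fdiff [x] ?f x"
    using completely_monotone_alternating[OF C(1) cm] x
    unfolding alternating_on_def by (metis empty_subsetI insert_subset list.set(1) list.set(2))
  ultimately show False by simp
qed

end

text \<open>Multilinearity in all rows at once. The choice functions \<open>g\<close> become the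
  parent functions of the matrix-tree theorem.\<close>

lemma pdet_rows_sum:
  assumes "\<And>k. k < n \<Longrightarrow> finite (S k)"
  shows "pdet n (\<lambda>k l. \<Sum>u\<in>S k. a k u * m k u l)
    = (\<Sum>g\<in>PiE {..<n} S. (\<Prod>k<n. a k (g k)) * pdet n (\<lambda>k l. m k (g k) l))"
proof -
  have "pdet n (\<lambda>k l. \<Sum>u\<in>S k. a k u * m k u l)
    = (\<Sum>\<sigma> | \<sigma> permutes {..<n}. of_int (sign \<sigma>) * (\<Sum>g\<in>PiE {..<n} S. \<Prod>k<n. a k (g k) * m k (g k) (\<sigma> k)))"
    unfolding pdet_def by (subst prod_sum_PiE) (use assms in auto)
  also have "\<dots> = (\<Sum>g\<in>PiE {..<n} S. (\<Prod>k<n. a k (g k)) * pdet n (\<lambda>k l. m k (g k) l))"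
    unfolding pdet_def sum_distrib_left prod.distrib by (subst sum.swap) (simp add: mult_ac)
  finally show ?thesis .
qed

section \<open>The matrix-tree theorem for complete graphs\<close>

text \<open>Each exchange keeps the cardinality and makes S - T smaller.\<close>

lemma matroid_bases_card_eq:
  assumes "matroid M" "S \<in> bases M" "T \<in> bases M"
  shows "card S = card T"
  using assms(2)
proof (induction "card (S - T)" arbitrary: S rule: less_induct)
  case less
  interpret matroid M by fact
  have fin: "finite S" "finite T" using bases_subset finite_ground less.prems assms(3) finite_subset by blast+
  show ?case
  proof (cases "S - T = {}")
    case True
    have "T - S = {}"
      using basis_exchange[OF assms(3) less.prems] True by blast
    then show ?thesis using True by (metis Diff_eq_empty_iff subset_antisym)
  next
    case False
    then obtain a where a: "a \<in> S - T" by blast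
    then obtain b where b: "b \<in> T - S" "insert b (S - {a}) \<in> bases M"
      using basis_exchange[OF less.prems assms(3)] by blast
    let ?S = "insert b (S - {a})"
    have "?S - T = (S - T) - {a}" using a b by auto
    then have "card (?S - T) < card (S - T)"
      using a fin by (metis card_Diff1_less finite_Diff)
    then have "card ?S = card T" using less.hyps b(2) by blast
    moreover have "card ?S = card S"
      using a b fin card.remove[of S a] by simp
    ultimately show ?thesis by simp
  qed
qed

text \<open>Spanning trees of the complete graph on \<open>{..n}\<close> are encoded by their parent functions towards the
  root \<open>n\<close>; the potential \<open>d\<close> witnesses that iterating \<open>g\<close> leads to the root.\<close>
definition acyclic_parent :: "nat \<Rightarrow> (nat \<Rightarrow> nat) \<Rightarrow> bool" where
  "acyclic_parent n g \<longleftrightarrow> (\<exists>d :: nat \<Rightarrow> nat. \<forall>k<n. d (g k) < d k)"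

definition parent_functions :: "nat \<Rightarrow> (nat \<Rightarrow> nat) set" where
  "parent_functions n = PiE {..<n} (\<lambda>k. {..n} - {k})"

definition parent_edges :: "nat \<Rightarrow> (nat \<Rightarrow> nat) \<Rightarrow> nat set set" where
  "parent_edges n g = (\<lambda>k. {k, g k}) ` {..<n}"

text \<open>A contributing permutation sends each k to itself or to its parent, hence never raises
  the potential d. A permutation preserves the sum of d, so only the identity contributes.\<close>

lemma pdet_acyclic_parent:
  assumes "acyclic_parent n g"
  shows "pdet n (\<lambda>k l. of_bool (l = k) - of_bool (l = g k)) = (1::'a::comm_ring_1)"
proof -
  obtain d :: "nat \<Rightarrow> nat" where d: "\<And>k. k < n \<Longrightarrow> d (g k) < d k"
    using assms unfolding acyclic_parent_def by blast
  let ?t = "\<lambda>\<sigma>. of_int (sign \<sigma>) * (\<Prod>k<n. of_bool (\<sigma> k = k) - of_bool (\<sigma> k = g k) :: 'a)"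
  have zero: "?t \<sigma> = 0" if \<sigma>: "\<sigma> permutes {..<n}" and ne: "\<sigma> \<noteq> id" for \<sigma>
  proof (cases "\<forall>k<n. \<sigma> k = k \<or> \<sigma> k = g k")
    case True
    obtain k where k: "\<sigma> k \<noteq> k" using ne by (auto simp: fun_eq_iff)
    then have kn: "k < n" using \<sigma> permutes_not_in by force
    have "(\<Sum>k<n. d (\<sigma> k)) < (\<Sum>k<n. d k)"
    proof (rule sum_strict_mono_ex1)
      show "\<forall>k\<in>{..<n}. d (\<sigma> k) \<le> d k" using True d by (metis lessThan_iff less_imp_le order_refl)
      show "\<exists>k\<in>{..<n}. d (\<sigma> k) < d k" using True d k kn by (metis lessThan_iff)
    qed simp
    moreover have "(\<Sum>k<n. d (\<sigma> k)) = (\<Sum>k<n. d k)"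
      using sum.permute[OF \<sigma>, of d] by (simp add: o_def)
    ultimately show ?thesis by simp
  next
    case False
    then have "\<exists>k\<in>{..<n}. (of_bool (\<sigma> k = k) - of_bool (\<sigma> k = g k) :: 'a) = 0" by auto
    then have "(\<Prod>k<n. of_bool (\<sigma> k = k) - of_bool (\<sigma> k = g k) :: 'a) = 0"
      by (intro prod_zero) auto
    then show ?thesis by simp
  qed
  have "pdet n (\<lambda>k l. of_bool (l = k) - of_bool (l = g k)) = (\<Sum>\<sigma> | \<sigma> permutes {..<n}. if \<sigma> = id then ?t id else 0)"
    unfolding pdet_def by (intro sum.cong refl) (use zero in auto)
  also have "\<dots> = ?t id" using permutes_id[of "{..<n}"] by (simp add: finite_permutations)
  also have "\<dots> = 1"
  proof -
    have "k \<noteq> g k" if "k < n" for k using d[OF that] by (metis less_irrefl)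
    then show ?thesis by (simp add: sign_id)
  qed
  finally show ?thesis .
qed

text \<open>The vertices that never reach the root form a nonempty set S such that k lies in S
  exactly when \<open>g k\<close> does; its indicator is a null vector of the matrix.\<close>

lemma pdet_not_acyclic_parent:
  assumes g: "g \<in> parent_functions n" and "\<not> acyclic_parent n g"
  shows "pdet n (\<lambda>k l. of_bool (l = k) - of_bool (l = g k)) = (0::'a::idom)"
proof -
  \<comment> \<open>Sending n to itself makes the root absorbing, so iterates are defined beyond the
    arrival there.\<close>
  define f where "f k = (if k < n then g k else n)" for k
  define S where "S = {k. k < n \<and> (\<forall>j. (f ^^ j) k \<noteq> n)}"
  have gn: "g k \<le> n" if "k < n" for k using g that by (auto simp: parent_functions_def PiE_def Pi_def)
  have "S \<noteq> {}"
  proof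
    assume "S = {}"
    then have ex: "\<exists>j. (f ^^ j) k = n" if "k < n" for k using that by (auto simp: S_def)
    define d where "d k = (LEAST j. (f ^^ j) k = n)" for k
    have "d (g k) < d k" if k: "k < n" for k
    proof -
      have dk: "(f ^^ d k) k = n" unfolding d_def using ex[OF k] by (rule LeastI_ex)
      then have "d k \<noteq> 0" using k by (intro notI) simp
      then obtain j where j: "d k = Suc j" using not0_implies_Suc by blast
      then have "(f ^^ j) (g k) = n" using dk k by (simp add: funpow_swap1 f_def)
      then have "d (g k) \<le> j" unfolding d_def by (rule Least_le)
      then show ?thesis using j by simp
    qed
    then show False using assms(2) unfolding acyclic_parent_def by blast
  qed
  then obtain k0 where k0: "k0 \<in> S" by blast
  have inv: "g k \<in> S \<longleftrightarrow> k \<in> S" if k: "k < n" for k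
  proof -
    have fk: "f k = g k" using k by (simp add: f_def)
    have fs: "(f ^^ Suc j) k = (f ^^ j) (g k)" for j
      unfolding funpow_Suc_right o_def fk ..
    have "(\<forall>j. (f ^^ j) k \<noteq> n) \<longleftrightarrow> (\<forall>j. (f ^^ j) (g k) \<noteq> n)"
    proof
      assume "\<forall>j. (f ^^ j) k \<noteq> n"
      then show "\<forall>j. (f ^^ j) (g k) \<noteq> n" unfolding fs[symmetric] by blast
    next
      assume *: "\<forall>j. (f ^^ j) (g k) \<noteq> n"
      show "\<forall>j. (f ^^ j) k \<noteq> n"
      proof
        fix j show "(f ^^ j) k \<noteq> n"
        proof (cases j)
          case 0
          then show ?thesis using k by simp
        next
          case (Suc i)
          then show ?thesis using * fs[of i] by simp
        qed
      qed
    qed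
    moreover have "g k < n" if "\<forall>j. (f ^^ j) (g k) \<noteq> n"
      using that[rule_format, of 0] gn[OF k] by simp
    ultimately show ?thesis using k by (auto simp: S_def)
  qed
  let ?u = "\<lambda>k. of_bool (k \<in> S) :: 'a"
  have "(\<Sum>l<n. (of_bool (l = k) - of_bool (l = g k)) * ?u l) = 0" if k: "k < n" for k
  proof -
    have "(\<Sum>l<n. (of_bool (l = k) - of_bool (l = g k)) * ?u l)
      = (\<Sum>l<n. if l = k then ?u k else 0) - (\<Sum>l<n. if l = g k then ?u (g k) else 0)"
      unfolding sum_subtractf[symmetric] by (intro sum.cong) auto
    also have "\<dots> = ?u k - (if g k < n then ?u (g k) else 0)" using k by simp
    also have "(if g k < n then ?u (g k) else 0) = ?u (g k)" by (auto simp: S_def)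
    finally show ?thesis using inv[OF k] by simp
  qed
  moreover have "\<exists>k<n. ?u k \<noteq> 0" using k0 by (auto simp: S_def)
  ultimately show ?thesis unfolding pdet_eq_0_iff by (intro exI[of _ ?u] conjI allI impI)
qed

text \<open>At a vertex of maximal potential on the cycle both neighbours would have to be its
  parent, but in a cycle with at least three vertices the two neighbours differ.\<close>

lemma parent_edges_no_cycle:
  assumes "acyclic_parent n g"
  shows "\<not> has_cycle (parent_edges n g)"
proof
  obtain d :: "nat \<Rightarrow> nat" where d: "\<And>k. k < n \<Longrightarrow> d (g k) < d k"
    using assms unfolding acyclic_parent_def by blast
  assume "has_cycle (parent_edges n g)"
  then obtain vs where vs: "3 \<le> length vs" "distinct vs"
    "\<And>i. i < length vs \<Longrightarrow> {vs ! i, vs ! (Suc i mod length vs)} \<in> parent_edges n g"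
    unfolding has_cycle_def by blast
  let ?m = "length vs"
  let ?D = "(\<lambda>i. d (vs ! i)) ` {..<?m}"
  have "0 < ?m" using vs(1) by linarith
  then have "0 \<in> {..<?m}" by (simp only: lessThan_iff)
  then have D: "finite ?D" "?D \<noteq> {}" by blast+
  have "Max ?D \<in> ?D" by (rule Max_in[OF D])
  then obtain i where i: "i < ?m" "Max ?D = d (vs ! i)" by auto
  have max: "d (vs ! j) \<le> d (vs ! i)" if "j < ?m" for j
    using Max_ge[OF D(1), of "d (vs ! j)"] i that by auto
  have parent: "vs ! j = g (vs ! i)" if j: "j < ?m" and e: "{vs ! i, vs ! j} \<in> parent_edges n g" for j
  proof -
    obtain k where k: "k < n" "{vs ! i, vs ! j} = {k, g k}" using e by (auto simp: parent_edges_def)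
    then consider "vs ! i = k" "vs ! j = g k" | "vs ! j = k" "vs ! i = g k" by (auto simp: doubleton_eq_iff)
    then show ?thesis
    proof cases
      case 2
      then show ?thesis using d[OF k(1)] max[OF j] by simp
    qed simp
  qed
  let ?a = "Suc i mod ?m"
  define b where "b = (if i = 0 then ?m - 1 else i - 1)"
  have b: "b < ?m" "Suc b mod ?m = i" using vs(1) i(1) by (auto simp: b_def)
  have a: "?a < ?m" using vs(1) by (intro mod_less_divisor) linarith
  have "?a \<noteq> b"
  proof (cases "Suc i = ?m")
    case True
    then show ?thesis using vs(1) by (auto simp: b_def)
  next
    case False
    then show ?thesis using vs(1) i(1) by (auto simp: b_def)
  qed
  moreover have "vs ! ?a = g (vs ! i)" using parent[OF a] vs(3)[OF i(1)] by blast
  moreover have "vs ! b = g (vs ! i)" using parent[OF b(1)] vs(3)[OF b(1)] b(2) by (simp add: insert_commute)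
  ultimately show False using vs(2) a b(1) nth_eq_iff_index_eq by metis
qed

lemma acyclic_parent_unique:
  assumes "acyclic_parent n g" "k < n" "l < n" "g k = l" "g l = k"
  shows False
  using assms unfolding acyclic_parent_def by (metis less_asym)

lemma inj_on_parent_edge:
  assumes "acyclic_parent n g"
  shows "inj_on (\<lambda>k. {k, g k}) {..<n}"
proof (rule inj_onI)
  fix k l assume "k \<in> {..<n}" "l \<in> {..<n}" "{k, g k} = {l, g l}"
  then show "k = l" using acyclic_parent_unique[OF assms, of k l] by (auto simp: doubleton_eq_iff)
qed

text \<open>Induction on the potential of g. The edge from k to \<open>g k\<close> belongs in the
  other tree either to k, which gives equality, or to the lower vertex \<open>g k\<close>; there
  both functions agree already, so g would have a cycle of length two.\<close>

lemma inj_on_parent_edges: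
  "inj_on (parent_edges n) {g \<in> parent_functions n. acyclic_parent n g}"
proof (rule inj_onI)
  fix g g' assume g: "g \<in> {g \<in> parent_functions n. acyclic_parent n g}"
    and g': "g' \<in> {g \<in> parent_functions n. acyclic_parent n g}"
    and eq: "parent_edges n g = parent_edges n g'"
  obtain d :: "nat \<Rightarrow> nat" where d: "\<And>k. k < n \<Longrightarrow> d (g k) < d k"
    using g unfolding acyclic_parent_def by blast
  have "g k = g' k" if "k < n" for k
    using that
  proof (induction "d k" arbitrary: k rule: less_induct)
    case less
    have "{k, g k} \<in> parent_edges n g'" using less.prems eq unfolding parent_edges_def by blast
    then obtain l where l: "l < n" "{k, g k} = {l, g' l}" by (auto simp: parent_edges_def)
    show ?case
    proof (cases "l = k")
      case False
      then have l2: "l = g k" "g' l = k" using l(2) by (auto simp: doubleton_eq_iff)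
      have "d l < d k" using d[OF less.prems] l2(1) by simp
      then have "g l = k" using less.hyps[of l] l(1) l2(2) by simp
      moreover have "acyclic_parent n g" using g by simp
      ultimately have False
        by (intro acyclic_parent_unique[of n g k l] less.prems l(1) l2(1)[symmetric])
      then show ?thesis ..
    next
      case True
      then show ?thesis using l(2) by (metis doubleton_eq_iff)
    qed
  qed
  then show "g = g'"
    using g g' by (intro PiE_ext[of g "{..<n}" "\<lambda>k. {..n} - {k}" g']) (auto simp: parent_functions_def)
qed

lemma parent_edges_subset:
  assumes "g \<in> parent_functions n"
  shows "parent_edges n g \<subseteq> complete_graph_edges (Suc n)"
proof -
  have "g k \<le> n" "g k \<noteq> k" if "k < n" for k
    using assms that by (auto simp: parent_functions_def PiE_def Pi_def)
  then show ?thesis by (fastforce simp: parent_edges_def complete_graph_edges_def card_insert_if)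
qed

lemma finite_complete_graph_edges: "finite (complete_graph_edges p)"
  unfolding complete_graph_edges_def by (rule finite_subset[of _ "Pow {..<p}"]) auto

lemma complete_graph_edgesE:
  assumes "e \<in> complete_graph_edges p"
  obtains a b where "e = {a, b}" "a < b" "b < p"
proof -
  obtain a b where ab: "e = {a, b}" "a \<noteq> b"
    using assms by (auto simp: complete_graph_edges_def card_2_iff)
  have "a < p" "b < p" using assms ab by (auto simp: complete_graph_edges_def)
  then show ?thesis using ab that by (metis insert_commute nat_neq_iff)
qed

text \<open>\<open>card_eq\<close> is later supplied by the matroid isomorphic to this structure,
  and it takes the place of a graph-theoretic count of the edges of a maximal forest.\<close>

context
  fixes n :: nat and T :: "nat set set set"
  assumes T_def: "T = bases (graphic_matroid (complete_graph_edges (Suc n)))"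
    and card_eq: "\<And>F F'. F \<in> T \<Longrightarrow> F' \<in> T \<Longrightarrow> card F = card F'"
begin

abbreviation "KE \<equiv> complete_graph_edges (Suc n)"

lemma T_iff: "F \<in> T \<longleftrightarrow> F \<subseteq> KE \<and> \<not> has_cycle F \<and> (\<forall>F'. F \<subset> F' \<and> F' \<subseteq> KE \<longrightarrow> has_cycle F')"
  by (simp add: T_def graphic_matroid_def)

text \<open>The star at the root fixes the common cardinality n of all bases. It is maximal because
  any further edge {a, b} closes the triangle a, b, n.\<close>

lemma star_basis: "parent_edges n (\<lambda>k\<in>{..<n}. n) \<in> T" "(\<lambda>k\<in>{..<n}. n) \<in> parent_functions n"
  "acyclic_parent n (\<lambda>k\<in>{..<n}. n)"
proof -
  let ?g = "\<lambda>k\<in>{..<n}. n"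
  show pf: "?g \<in> parent_functions n" by (auto simp: parent_functions_def)
  show ac: "acyclic_parent n ?g"
    unfolding acyclic_parent_def by (intro exI[of _ "\<lambda>k. if k = n then 0 else 1"]) auto
  have edge: "{a, n} \<in> parent_edges n ?g" if "a < n" for a
    using that by (auto simp: parent_edges_def)
  have "has_cycle F'" if F': "parent_edges n ?g \<subset> F'" "F' \<subseteq> KE" for F'
  proof -
    obtain e where e: "e \<in> F'" "e \<notin> parent_edges n ?g" using F'(1) by blast
    then obtain a b where ab: "e = {a, b}" "a < b" "b < Suc n"
      using complete_graph_edgesE F'(2) by (metis subsetD)
    then have bn: "b < n" using e edge[of a] by (cases "b = n") auto
    show ?thesis
      unfolding has_cycle_def
    proof (intro exI[of _ "[a, b, n]"] conjI allI impI)
      fix i assume "i < length [a, b, n]"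
      then have "i = 0 \<or> i = 1 \<or> i = 2" by auto
      then show "{[a, b, n] ! i, [a, b, n] ! (Suc i mod length [a, b, n])} \<in> F'"
        using e ab bn edge[of a] edge[of b] F'(1) by (auto simp: insert_commute)
    qed (use ab bn in auto)
  qed
  then show "parent_edges n ?g \<in> T"
    unfolding T_iff using parent_edges_subset[OF pf] parent_edges_no_cycle[OF ac] by simp
qed

lemma card_parent_edges: "acyclic_parent n g \<Longrightarrow> card (parent_edges n g) = n"
  unfolding parent_edges_def using card_image[OF inj_on_parent_edge] by fastforce

text \<open>Extend the forest to a maximal one: this has n edges by comparison with the star, as
  many as the parent edges themselves.\<close>

lemma parent_edges_basis:
  assumes "g \<in> parent_functions n" "acyclic_parent n g"
  shows "parent_edges n g \<in> T"
proof -
  let ?A = "{F. F \<subseteq> KE \<and> \<not> has_cycle F}"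
  have fin: "finite ?A" using finite_complete_graph_edges by (intro finite_subset[of ?A "Pow KE"]) auto
  have "parent_edges n g \<in> ?A"
    using parent_edges_subset[OF assms(1)] parent_edges_no_cycle[OF assms(2)] by simp
  from finite_has_maximal2[OF fin this]
  obtain F where F: "F \<in> ?A" "parent_edges n g \<subseteq> F" "\<forall>F'\<in>?A. F \<subseteq> F' \<longrightarrow> F = F'"
    by (elim bexE conjE) (rule that)
  have FT: "F \<in> T"
    unfolding T_iff
  proof (intro conjI allI impI)
    fix F' assume "F \<subset> F' \<and> F' \<subseteq> KE"
    then show "has_cycle F'" using F(3) by auto
  qed (use F(1) in auto)
  have "card F = n" using card_eq[OF FT star_basis(1)] card_parent_edges[OF star_basis(3)] by simp
  moreover have "finite F" using F(1) finite_complete_graph_edges finite_subset by blast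
  ultimately have "parent_edges n g = F"
    using card_subset_eq F(2) card_parent_edges[OF assms(2)] by metis
  then show ?thesis using FT by simp
qed

text \<open>Otherwise the edge {v, n} is absent, and by maximality adding it closes a cycle; the
  remainder of that cycle is a path in F from v to n.\<close>

lemma basis_connected:
  assumes F: "F \<in> T" and v: "v \<le> n"
  shows "(v, n) \<in> {(a, b). {a, b} \<in> F}\<^sup>*"
proof (rule ccontr)
  let ?R = "{(a, b). {a, b} \<in> F}"
  assume nr: "(v, n) \<notin> ?R\<^sup>*"
  have "sym ?R" by (auto simp: sym_def insert_commute)
  then have symR: "sym (?R\<^sup>*)" by (rule sym_rtrancl)
  let ?e = "{v, n}"
  have "v \<noteq> n" using nr by auto
  then have eE: "?e \<in> KE" using v by (auto simp: complete_graph_edges_def)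
  have "?e \<notin> F" using nr by auto
  then have "has_cycle (insert ?e F)" using F eE unfolding T_iff by blast
  then obtain vs where vs: "3 \<le> length vs" "distinct vs"
    "\<And>i. i < length vs \<Longrightarrow> {vs ! i, vs ! (Suc i mod length vs)} \<in> insert ?e F"
    unfolding has_cycle_def by blast
  let ?m = "length vs"
  have nF: "\<not> has_cycle F" using F unfolding T_iff by blast
  then obtain i where i: "i < ?m" "{vs ! i, vs ! (Suc i mod ?m)} \<notin> F"
    using vs(1,2) unfolding has_cycle_def by blast
  then have ei: "{vs ! i, vs ! (Suc i mod ?m)} = ?e" using vs(3) by blast
  have m0: "0 < ?m" using vs(1) by linarith
  \<comment> \<open>A cycle of length at least three passes through the added edge only
    once.\<close>
  have other: "{vs ! j, vs ! (Suc j mod ?m)} \<in> F" if j: "j < ?m" "j \<noteq> i" for j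
  proof -
    have "{vs ! j, vs ! (Suc j mod ?m)} \<noteq> {vs ! i, vs ! (Suc i mod ?m)}"
    proof
      assume "{vs ! j, vs ! (Suc j mod ?m)} = {vs ! i, vs ! (Suc i mod ?m)}"
      then have "vs ! j = vs ! (Suc i mod ?m)" "vs ! (Suc j mod ?m) = vs ! i"
        using j i(1) vs(2) nth_eq_iff_index_eq by (auto simp: doubleton_eq_iff)
      then have "j = Suc i mod ?m" "Suc j mod ?m = i"
        using vs(2) j i(1) m0 by (simp_all add: nth_eq_iff_index_eq)
      then show False using vs(1) i(1) j(1)
        by (cases "Suc i = ?m"; cases "Suc j = ?m") auto
    qed
    then show ?thesis using vs(3)[OF j(1)] ei by auto
  qed
  \<comment> \<open>Walk around the cycle from the far end of the added edge back to its near end,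
    never using the edge at index i.\<close>
  have path: "(vs ! (Suc i mod ?m), vs ! ((Suc i + k) mod ?m)) \<in> ?R\<^sup>*" if "k < ?m" for k
    using that
  proof (induction k)
    case (Suc k)
    let ?j = "(Suc i + k) mod ?m"
    have "?j \<noteq> i"
    proof
      assume "?j = i"
      then have "(Suc i + k) mod ?m = i mod ?m" using i(1) by simp
      then have "?m dvd Suc i + k - i" by (metis add_leD1 le_add1 mod_eq_dvd_iff_nat Suc_leD add_Suc)
      then have "?m dvd Suc k" by simp
      then show False using Suc.prems by (auto dest: dvd_imp_le)
    qed
    then have "{vs ! ?j, vs ! (Suc ?j mod ?m)} \<in> F" using m0 by (intro other) auto
    moreover have "Suc ?j mod ?m = (Suc i + Suc k) mod ?m" by (simp add: mod_Suc_eq)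
    ultimately have "(vs ! ?j, vs ! ((Suc i + Suc k) mod ?m)) \<in> ?R" by simp
    then show ?case using Suc.IH Suc.prems by (meson Suc_lessD rtrancl.rtrancl_into_rtrancl)
  qed simp
  have "(Suc i + (?m - 1)) mod ?m = i" using i(1) m0 by simp
  then have "(vs ! (Suc i mod ?m), vs ! i) \<in> ?R\<^sup>*" using path[of "?m - 1"] m0 by simp
  then have "(v, n) \<in> ?R\<^sup>*" using ei symR by (auto simp: doubleton_eq_iff sym_def)
  then show False using nr by simp
qed

text \<open>Let each vertex choose a neighbour nearer to the root. The resulting parent edges lie in
  F and form a basis, so maximality makes them all of F.\<close>

lemma basis_parent_edges:
  assumes F: "F \<in> T"
  shows "\<exists>g\<in>parent_functions n. acyclic_parent n g \<and> parent_edges n g = F"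
proof -
  let ?R = "{(a, b). {a, b} \<in> F}"
  define d where "d v = (LEAST j. (v, n) \<in> ?R ^^ j)" for v
  have step: "\<exists>u. {k, u} \<in> F \<and> d u < d k" if k: "k < n" for k
  proof -
    have "\<exists>j. (k, n) \<in> ?R ^^ j" using basis_connected[OF F, of k] k rtrancl_power by fastforce
    then have dk: "(k, n) \<in> ?R ^^ d k" unfolding d_def by (rule LeastI_ex)
    then have "d k \<noteq> 0" using k by (intro notI) simp
    then obtain j where j: "d k = Suc j" using not0_implies_Suc by blast
    then obtain u where u: "(k, u) \<in> ?R" "(u, n) \<in> ?R ^^ j" using dk relpow_Suc_D2 by metis
    then have "d u \<le> j" unfolding d_def by (intro Least_le)
    then show ?thesis using u j by auto
  qed
  then obtain p where p: "\<And>k. k < n \<Longrightarrow> {k, p k} \<in> F \<and> d (p k) < d k" by metis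
  define g where "g = (\<lambda>k\<in>{..<n}. p k)"
  have FE: "F \<subseteq> KE" using F unfolding T_iff by blast
  have "p k \<in> {..n} - {k}" if "k < n" for k
  proof -
    have "{k, p k} \<in> KE" using p[OF that] FE by blast
    then show ?thesis by (auto simp: complete_graph_edges_def card_insert_if split: if_splits)
  qed
  then have gp: "g \<in> parent_functions n" by (auto simp: g_def parent_functions_def)
  have ga: "acyclic_parent n g" unfolding acyclic_parent_def using p by (intro exI[of _ d]) (auto simp: g_def)
  have "parent_edges n g \<subseteq> F" using p by (auto simp: parent_edges_def g_def)
  moreover have "parent_edges n g \<in> T" by (rule parent_edges_basis[OF gp ga])
  ultimately have "parent_edges n g = F" using F FE unfolding T_iff by blast
  then show ?thesis using gp ga by blast
qed

lemma parent_edges_bij: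
  "bij_betw (parent_edges n) {g \<in> parent_functions n. acyclic_parent n g} T"
  unfolding bij_betw_def
  using inj_on_parent_edges parent_edges_basis basis_parent_edges by (auto simp: image_iff) blast+

text \<open>Row k of the reduced Laplacian as a sum over the neighbours u of k, the shape required
  by \<open>pdet_rows_sum\<close>. For the root u = n the second indicator vanishes, since l <
  n.\<close>

lemma sum_edges_at_vertex:
  fixes y :: "nat set \<Rightarrow> 'a::comm_ring_1"
  assumes "k < n" "l < n"
  shows "(\<Sum>e\<in>KE. y e * (if k \<in> e \<and> l \<in> e then if k = l then 1 else -1 else 0))
    = (\<Sum>u\<in>{..n} - {k}. y {k, u} * (of_bool (l = k) - of_bool (l = u)))"
proof -
  have im: "{e \<in> KE. k \<in> e} = (\<lambda>u. {k, u}) ` ({..n} - {k})"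
  proof (intro subset_antisym subsetI)
    fix e assume "e \<in> {e \<in> KE. k \<in> e}"
    then obtain a b where ab: "e = {a, b}" "a < b" "b < Suc n" "k \<in> e"
      using complete_graph_edgesE by (metis mem_Collect_eq)
    then show "e \<in> (\<lambda>u. {k, u}) ` ({..n} - {k})"
      by (cases "k = a") (auto simp: image_iff insert_commute)
  next
    fix e assume "e \<in> (\<lambda>u. {k, u}) ` ({..n} - {k})"
    then show "e \<in> {e \<in> KE. k \<in> e}" using assms by (auto simp: complete_graph_edges_def)
  qed
  have "(\<Sum>e\<in>KE. y e * (if k \<in> e \<and> l \<in> e then if k = l then 1 else -1 else 0))
    = (\<Sum>e\<in>{e \<in> KE. k \<in> e}. y e * (if l \<in> e then if k = l then 1 else -1 else 0))"
    using finite_complete_graph_edges by (intro sum.mono_neutral_cong_right) auto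
  also have "\<dots> = (\<Sum>u\<in>{..n} - {k}. y {k, u} * (if l \<in> {k, u} then if k = l then 1 else -1 else 0))"
    unfolding im by (subst sum.reindex) (auto simp: inj_on_def doubleton_eq_iff)
  also have "\<dots> = (\<Sum>u\<in>{..n} - {k}. y {k, u} * (of_bool (l = k) - of_bool (l = u)))"
    by (intro sum.cong) auto
  finally show ?thesis .
qed

theorem matrix_tree:
  fixes y :: "nat set \<Rightarrow> 'a::idom"
  shows "pdet n (\<lambda>k l. \<Sum>e\<in>KE. y e * (if k \<in> e \<and> l \<in> e then if k = l then 1 else -1 else 0))
    = (\<Sum>F\<in>T. \<Prod>e\<in>F. y e)"
proof -
  let ?S = "\<lambda>k. {..n} - {k}" and ?m = "\<lambda>k u l. of_bool (l = k) - of_bool (l = u) :: 'a"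
  let ?P = "{g \<in> parent_functions n. acyclic_parent n g}"
  have fin: "finite (parent_functions n)" unfolding parent_functions_def by (intro finite_PiE) auto
  have "pdet n (\<lambda>k l. \<Sum>e\<in>KE. y e * (if k \<in> e \<and> l \<in> e then if k = l then 1 else -1 else 0))
    = pdet n (\<lambda>k l. \<Sum>u\<in>?S k. y {k, u} * ?m k u l)"
    by (intro pdet_cong sum_edges_at_vertex)
  also have "\<dots> = (\<Sum>g\<in>parent_functions n. (\<Prod>k<n. y {k, g k}) * pdet n (\<lambda>k l. ?m k (g k) l))"
    unfolding parent_functions_def by (rule pdet_rows_sum) simp
  also have "\<dots> = (\<Sum>g\<in>?P. \<Prod>k<n. y {k, g k})"
  proof (intro sum.mono_neutral_cong_right fin ballI)
    fix g assume "g \<in> parent_functions n - ?P"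
    then show "(\<Prod>k<n. y {k, g k}) * pdet n (\<lambda>k l. ?m k (g k) l) = 0"
      using pdet_not_acyclic_parent by force
  next
    fix g assume "g \<in> ?P"
    then have "acyclic_parent n g" by simp
    then show "(\<Prod>k<n. y {k, g k}) * pdet n (\<lambda>k l. ?m k (g k) l) = (\<Prod>k<n. y {k, g k})"
      by (simp only: pdet_acyclic_parent mult_1_right)
  qed auto
  also have "\<dots> = (\<Sum>g\<in>?P. \<Prod>e\<in>parent_edges n g. y e)"
    unfolding parent_edges_def by (intro sum.cong refl) (simp add: prod.reindex inj_on_parent_edge)
  also have "\<dots> = (\<Sum>F\<in>T. \<Prod>e\<in>F. y e)"
    by (rule sum.reindex_bij_betw[OF parent_edges_bij])
  finally show ?thesis .
qed

end

section \<open>Transfer along matroid isomorphisms\<close>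

lemma basis_gen_poly_iso:
  fixes M :: "'e::finite matroid_data" and N :: "'f matroid_data"
  assumes "matroid_iso M N" "ground M = UNIV"
  obtains h where "bij_betw h UNIV (ground N)"
    "\<And>x. basis_gen_poly M x = (\<Sum>S\<in>bases N. \<Prod>f\<in>S. x $ inv_into UNIV h f)"
    "bases N = (`) h ` bases M"
proof -
  obtain h where h: "bij_betw h UNIV (ground N)" "bases N = (`) h ` bases M"
    using assms unfolding matroid_iso_def by auto
  have inj: "inj h" using h(1) by (simp add: bij_betw_def)
  have "basis_gen_poly M x = (\<Sum>S\<in>bases N. \<Prod>f\<in>S. x $ inv_into UNIV h f)" for x :: "real ^ 'e"
  proof -
    have "(\<Prod>f\<in>h ` S. x $ inv_into UNIV h f) = (\<Prod>e\<in>S. x $ e)" for S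
      using inj by (subst prod.reindex) (auto simp: inj_on_def)
    moreover have "inj_on ((`) h) (bases M)"
      by (intro inj_on_image inj_on_subset[OF inj]) auto
    ultimately show ?thesis
      unfolding basis_gen_poly_def h(2) by (simp add: sum.reindex)
  qed
  then show ?thesis using that h by blast
qed

text \<open>Collects what each matroid has to supply, stated on the concrete ground set of N:
  vectors, a determinant formula, and matrix units for nonnegative \<beta>. Negative \<beta> is
  settled here once for all.\<close>

lemma iso_not_completely_monotone:
  fixes M :: "'e::finite matroid_data" and N :: "'f matroid_data"
    and v :: "'f \<Rightarrow> nat \<Rightarrow> complex" and c \<beta> :: real
  assumes M: "matroid M" "ground M = UNIV" "matroid_iso M N"
    and spanning: "\<And>u k. (\<And>f. f \<in> ground N \<Longrightarrow> (\<Sum>k<n. cnj (v f k) * u k) = 0) \<Longrightarrow> k < n \<Longrightarrow> u k = 0"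
    and n: "0 < n" and c: "0 < c"
    and det: "\<And>y :: 'f \<Rightarrow> real. pdet n (\<lambda>k l. \<Sum>f\<in>ground N. of_real (y f) * (v f k * cnj (v f l)))
        = of_real (c * (\<Sum>S\<in>bases N. \<Prod>f\<in>S. y f))"
    and \<beta>: "0 \<le> \<beta> \<Longrightarrow> \<exists>r \<kappa> w. r \<le> n \<and> (\<kappa> = 1 \<or> (\<forall>f\<in>ground N. \<forall>k<n. cnj (v f k) = v f k))
      \<and> (\<forall>i<r. \<forall>j<r. \<forall>k<n. \<forall>l<n. (\<Sum>f\<in>ground N. w i j f * (v f k * cnj (v f l)))
        = of_real \<kappa> * of_bool (k = j \<and> l = i) + of_real (1 - \<kappa>) * of_bool (k = i \<and> l = j))
      \<and> (\<Prod>i<r. (\<beta> - \<kappa> * real i) * (\<beta> + 1 - \<kappa> * real i)) < 0"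
    and C: "open_convex_cone C" "C \<noteq> {}" "C \<subseteq> positive_orthant"
  shows "\<not> completely_monotone_on C (\<lambda>x. basis_gen_poly M x powr (- \<beta>))"
proof -
  interpret matroid M by fact
  obtain h where h: "bij_betw h UNIV (ground N)"
    and poly: "\<And>x. basis_gen_poly M x = (\<Sum>S\<in>bases N. \<Prod>f\<in>S. x $ inv_into UNIV h f)"
    using basis_gen_poly_iso[OF M(3,2)] by metis
  have inv: "inv_into UNIV h (h e) = e" for e using h by (simp add: bij_betw_def)
  have hN: "h e \<in> ground N" for e using h by (auto simp: bij_betw_def)
  have reindex: "(\<Sum>e\<in>UNIV. \<phi> (h e)) = (\<Sum>f\<in>ground N. \<phi> f)" for \<phi> :: "'f \<Rightarrow> complex"
    by (rule sum.reindex_bij_betw[OF h])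
  interpret rank_one_sum n "\<lambda>e. v (h e)"
  proof
    fix u k assume *: "\<And>e. (\<Sum>k<n. cnj (v (h e) k) * u k) = 0" "k < n"
    show "u k = 0"
    proof (rule spanning[OF _ *(2)])
      fix f assume "f \<in> ground N"
      then obtain e where "f = h e" using h by (auto simp: bij_betw_def)
      then show "(\<Sum>k<n. cnj (v f k) * u k) = 0" using *(1) by simp
    qed
  qed
  have X: "X x = (\<lambda>k l. \<Sum>f\<in>ground N. of_real (x $ inv_into UNIV h f) * (v f k * cnj (v f l)))" for x
    unfolding X_def
    by (intro ext, subst reindex[symmetric]) (simp add: inv)
  have detX: "pdet n (X x) = of_real (c * basis_gen_poly M x)" for x
    unfolding X poly by (rule det)
  have pos: "0 < basis_gen_poly M x" if "x \<in> positive_orthant" for x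
    unfolding basis_gen_poly_def using bases_nonempty that
    by (intro sum_pos prod_pos) (auto simp: positive_orthant_def)
  show ?thesis
  proof (cases "0 \<le> \<beta>")
    case True
    then obtain r \<kappa> w where r: "r \<le> n"
      and real: "\<kappa> = 1 \<or> (\<forall>f\<in>ground N. \<forall>k<n. cnj (v f k) = v f k)"
      and w: "\<forall>i<r. \<forall>j<r. \<forall>k<n. \<forall>l<n. (\<Sum>f\<in>ground N. w i j f * (v f k * cnj (v f l)))
        = of_real \<kappa> * of_bool (k = j \<and> l = i) + of_real (1 - \<kappa>) * of_bool (k = i \<and> l = j)"
      and neg: "(\<Prod>i<r. (\<beta> - \<kappa> * real i) * (\<beta> + 1 - \<kappa> * real i)) < 0"
      using \<beta> by blast
    show ?thesis
    proof (rule not_completely_monotone[OF r c pos detX _ _ neg C])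
      show "(\<Sum>e\<in>UNIV. w i j (h e) * (v (h e) k * cnj (v (h e) l)))
        = of_real \<kappa> * of_bool (k = j \<and> l = i) + of_real (1 - \<kappa>) * of_bool (k = i \<and> l = j)"
        if "i < r" "j < r" "k < n" "l < n" for i j k l
        using w that reindex[of "\<lambda>f. w i j f * (v f k * cnj (v f l))"] by simp
      show "\<kappa> = 1 \<or> (\<forall>e. \<forall>k<n. cnj (v (h e) k) = v (h e) k)"
        using real hN by blast
    qed
  next
    case False
    then show ?thesis
      by (intro not_completely_monotone_negative[OF n c pos detX _ C]) auto
  qed
qed

section \<open>Complete graphs\<close>

text \<open>The signed incidence vector. Only coordinates below n are read later, which drops the
  root and yields the reduced Laplacian.\<close>

definition edge_vector :: "nat set \<Rightarrow> nat \<Rightarrow> complex" where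
  "edge_vector e k = (if k = Min e then 1 else if k = Max e then -1 else 0)"

lemma edge_vector_doubleton: "a < b \<Longrightarrow> edge_vector {a, b} k = (if k = a then 1 else if k = b then -1 else 0)"
  by (simp add: edge_vector_def)

lemma edge_vector_product:
  assumes "e \<in> complete_graph_edges p"
  shows "edge_vector e k * cnj (edge_vector e l) = (if k \<in> e \<and> l \<in> e then if k = l then 1 else -1 else 0)"
proof -
  obtain a b where "e = {a, b}" "a < b" using complete_graph_edgesE[OF assms] by metis
  then show ?thesis by (auto simp: edge_vector_doubleton)
qed

lemma iso_bases_card_eq:
  assumes "matroid M" "matroid_iso M N" "S \<in> bases N" "T \<in> bases N"
  shows "card S = card T"
proof -
  obtain h where h: "bij_betw h (ground M) (ground N)" "bases N = (`) h ` bases M"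
    using assms(2) unfolding matroid_iso_def by auto
  obtain S' T' where ST: "S' \<in> bases M" "T' \<in> bases M" "S = h ` S'" "T = h ` T'"
    using assms(3,4) h(2) by auto
  have "inj_on h S'" "inj_on h T'"
    using h(1) ST matroid.bases_subset[OF assms(1)] unfolding bij_betw_def by (meson inj_on_subset)+
  then have "card S = card S'" "card T = card T'" using ST by (simp_all add: card_image)
  then show ?thesis using matroid_bases_card_eq[OF assms(1) ST(1,2)] by simp
qed

text \<open>With k the integer part of 2\<beta> and r = k + 2, exactly one factor is negative,
  namely \<beta> - (k + 1)/2. The upper bound on \<beta> gives r \<le> n.\<close>

lemma real_wallach_negative:
  fixes \<beta> :: real
  assumes "0 \<le> \<beta>" "\<beta> \<notin> range (\<lambda>n::nat. real n / 2)" "\<beta> < (real n - 1) / 2"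
  shows "\<exists>r\<le>n. (\<Prod>i<r. (\<beta> - 1/2 * real i) * (\<beta> + 1 - 1/2 * real i)) < 0"
proof -
  define k where "k = nat \<lfloor>2 * \<beta>\<rfloor>"
  have k: "real k \<le> 2 * \<beta>" "2 * \<beta> < real k + 1" using assms(1) by (auto simp: k_def)
  have "\<beta> \<noteq> real k / 2" using assms(2) by blast
  then have k': "real k < 2 * \<beta>" using k by simp
  have "real k < real n - 1" using k' assms(3) by (simp add: field_simps)
  then have kn: "Suc (Suc k) \<le> n" by linarith
  have "(\<Prod>i<Suc k. (\<beta> - 1/2 * real i) * (\<beta> + 1 - 1/2 * real i)) > 0"
  proof (intro prod_pos ballI mult_pos_pos)
    fix i assume "i \<in> {..<Suc k}"
    then have "real i \<le> real k" by simp
    then show "0 < \<beta> - 1/2 * real i" "0 < \<beta> + 1 - 1/2 * real i" using k' by simp_all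
  qed
  moreover have "(\<beta> - 1/2 * real (Suc k)) * (\<beta> + 1 - 1/2 * real (Suc k)) < 0"
    using k k' by (intro mult_neg_pos) simp_all
  ultimately have "(\<Prod>i<Suc (Suc k). (\<beta> - 1/2 * real i) * (\<beta> + 1 - 1/2 * real i)) < 0"
    by (simp only: prod.lessThan_Suc[of _ "Suc k"] mult_pos_neg)
  then show ?thesis using kn by blast
qed

theorem complete_graph_not_completely_monotone:
  fixes M :: "'e::finite matroid_data"
  assumes M: "matroid M" "ground M = UNIV" "matroid_iso M (graphic_matroid (complete_graph_edges p))"
    and p: "2 \<le> p" and \<beta>: "\<beta> \<notin> range (\<lambda>n::nat. real n / 2) \<union> {(real p - 2) / 2..}"
    and C: "open_convex_cone C" "C \<noteq> {}" "C \<subseteq> positive_orthant"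
  shows "\<not> completely_monotone_on C (\<lambda>x. basis_gen_poly M x powr (- \<beta>))"
proof -
  obtain n where pn: "p = Suc n" and n: "0 < n" using p by (cases p) auto
  let ?E = "complete_graph_edges (Suc n)"
  let ?N = "graphic_matroid ?E"
  have iso: "matroid_iso M ?N" using M(3) pn by simp
  have gr: "ground ?N = ?E" by (simp add: graphic_matroid_def)
  have root: "{i, n} \<in> ?E" if "i < n" for i using that by (auto simp: complete_graph_edges_def)
  show ?thesis
  proof (rule iso_not_completely_monotone[OF M(1,2) iso _ n, where v = edge_vector and c = 1, unfolded gr])
    fix u :: "nat \<Rightarrow> complex" and k
    assume u: "\<And>f. f \<in> ?E \<Longrightarrow> (\<Sum>k<n. cnj (edge_vector f k) * u k) = 0" and k: "k < n"
    have "(\<Sum>m<n. cnj (edge_vector {k, n} m) * u m) = (\<Sum>m<n. if m = k then u k else 0)"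
      using k by (intro sum.cong refl) (simp add: edge_vector_doubleton)
    then show "u k = 0" using u[OF root[OF k]] k by simp
  next
    fix y :: "nat set \<Rightarrow> real"
    have "pdet n (\<lambda>k l. \<Sum>f\<in>?E. complex_of_real (y f) * (edge_vector f k * cnj (edge_vector f l)))
      = pdet n (\<lambda>k l. \<Sum>f\<in>?E. complex_of_real (y f) * (if k \<in> f \<and> l \<in> f then if k = l then 1 else -1 else 0))"
      by (intro pdet_cong sum.cong refl) (simp only: edge_vector_product)
    also have "\<dots> = (\<Sum>S\<in>bases ?N. \<Prod>f\<in>S. complex_of_real (y f))"
      by (rule matrix_tree[OF refl]) (rule iso_bases_card_eq[OF M(1) iso])
    finally show "pdet n (\<lambda>k l. \<Sum>f\<in>?E. complex_of_real (y f) * (edge_vector f k * cnj (edge_vector f l)))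
      = complex_of_real (1 * (\<Sum>S\<in>bases ?N. \<Prod>f\<in>S. y f))" by simp
  next
    assume "0 \<le> \<beta>"
    moreover have "\<beta> < (real n - 1) / 2" using \<beta> pn by auto
    ultimately obtain r where r: "r \<le> n" "(\<Prod>i<r. (\<beta> - 1/2 * real i) * (\<beta> + 1 - 1/2 * real i)) < 0"
      using real_wallach_negative[of \<beta> n] \<beta> by blast
    \<comment> \<open>Polarization: the symmetric unit at (i, j) is half of the squares of the unit
      vectors i and j minus half of the square of their difference. For i = j the set {i, j} is no
      edge, so the last term disappears as it should.\<close>
    let ?w = "\<lambda>i j f. 1/2 * of_bool (f = {i, n}) + 1/2 * of_bool (f = {j, n}) - 1/2 * of_bool (f = {i, j}) :: complex"
    have w: "(\<Sum>f\<in>?E. ?w i j f * (edge_vector f k * cnj (edge_vector f l)))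
      = of_real (1/2) * of_bool (k = j \<and> l = i) + of_real (1 - 1/2) * of_bool (k = i \<and> l = j)"
      if ij: "i < r" "j < r" and kl: "k < n" "l < n" for i j k l
    proof -
      have ij': "i < n" "j < n" using ij r by auto
      let ?P = "\<lambda>f. if k \<in> f \<and> l \<in> f then if k = l then 1 else -1 else (0::complex)"
      have split: "(1/2 * of_bool A + 1/2 * of_bool B - 1/2 * of_bool D) * x
        = (if A then 1/2 * x else 0) + (if B then 1/2 * x else 0) - (if D then 1/2 * x else 0)"
        for A B D and x :: complex
        by (cases A; cases B; cases D) (simp_all add: algebra_simps)
      note fin = finite_complete_graph_edges[of "Suc n"]
      have "(\<Sum>f\<in>?E. ?w i j f * (edge_vector f k * cnj (edge_vector f l)))
        = (\<Sum>f\<in>?E. (if f = {i, n} then 1/2 * ?P {i, n} else 0) + (if f = {j, n} then 1/2 * ?P {j, n} else 0)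
            - (if f = {i, j} then 1/2 * ?P {i, j} else 0))"
      proof (intro sum.cong refl)
        fix f assume "f \<in> ?E"
        then have "?w i j f * (edge_vector f k * cnj (edge_vector f l)) = ?w i j f * ?P f"
          by (simp only: edge_vector_product)
        also have "\<dots> = (if f = {i, n} then 1/2 * ?P f else 0) + (if f = {j, n} then 1/2 * ?P f else 0)
            - (if f = {i, j} then 1/2 * ?P f else 0)"
          by (rule split)
        also have "\<dots> = (if f = {i, n} then 1/2 * ?P {i, n} else 0) + (if f = {j, n} then 1/2 * ?P {j, n} else 0)
            - (if f = {i, j} then 1/2 * ?P {i, j} else 0)"
          by (intro arg_cong2[of _ _ _ _ "(-)"] arg_cong2[of _ _ _ _ "(+)"]) auto
        finally show "?w i j f * (edge_vector f k * cnj (edge_vector f l))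
          = (if f = {i, n} then 1/2 * ?P {i, n} else 0) + (if f = {j, n} then 1/2 * ?P {j, n} else 0)
            - (if f = {i, j} then 1/2 * ?P {i, j} else 0)" .
      qed
      also have "\<dots> = 1/2 * ?P {i, n} + 1/2 * ?P {j, n} - (if {i, j} \<in> ?E then 1/2 * ?P {i, j} else 0)"
        using root ij' fin unfolding sum_subtractf sum.distrib by simp
      also have "{i, j} \<in> ?E \<longleftrightarrow> i \<noteq> j"
        using ij' by (auto simp: complete_graph_edges_def card_insert_if)
      finally show ?thesis
        using kl ij' by (cases "k = i"; cases "l = i"; cases "k = j"; cases "l = j") simp_all
    qed
    have real: "cnj (edge_vector f k) = edge_vector f k" for f k by (simp add: edge_vector_def)
    show "\<exists>r \<kappa> w. r \<le> n \<and> (\<kappa> = 1 \<or> (\<forall>f\<in>?E. \<forall>k<n. cnj (edge_vector f k) = edge_vector f k))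
      \<and> (\<forall>i<r. \<forall>j<r. \<forall>k<n. \<forall>l<n. (\<Sum>f\<in>?E. w i j f * (edge_vector f k * cnj (edge_vector f l)))
        = of_real \<kappa> * of_bool (k = j \<and> l = i) + of_real (1 - \<kappa>) * of_bool (k = i \<and> l = j))
      \<and> (\<Prod>i<r. (\<beta> - \<kappa> * real i) * (\<beta> + 1 - \<kappa> * real i)) < 0"
    proof (intro exI[of _ r] exI[of _ "1/2"] exI[of _ ?w] conjI)
      show "(1/2 :: real) = 1 \<or> (\<forall>f\<in>?E. \<forall>k<n. cnj (edge_vector f k) = edge_vector f k)"
        using real by blast
      show "\<forall>i<r. \<forall>j<r. \<forall>k<n. \<forall>l<n. (\<Sum>f\<in>?E. ?w i j f * (edge_vector f k * cnj (edge_vector f l)))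
        = of_real (1/2) * of_bool (k = j \<and> l = i) + of_real (1 - 1/2) * of_bool (k = i \<and> l = j)"
        by (intro allI impI w)
    qed (rule r)+
  qed (use C in auto)
qed

section \<open>The uniform matroid of rank 2 on four elements\<close>

lemma pdet_2: "pdet 2 A = A 0 0 * A 1 1 - A 0 1 * A 1 0"
proof -
  have "{..<2::nat} = insert 0 {1}" by auto
  moreover have "finite {1::nat}" "0 \<notin> {1::nat}" by auto
  ultimately show ?thesis
    unfolding pdet_def
    by (simp add: sum_over_permutations_insert permutes_sing sign_swap_id sign_id Transposition.transpose_def)
qed

lemma pdet_3: "pdet 3 A = A 0 0 * A 1 1 * A 2 2 + A 0 1 * A 1 2 * A 2 0 + A 0 2 * A 1 0 * A 2 1
    - A 0 0 * A 1 2 * A 2 1 - A 0 1 * A 1 0 * A 2 2 - A 0 2 * A 1 1 * A 2 0"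
proof -
  have e: "{..<3::nat} = insert 0 (insert 1 {2})" by auto
  have f: "finite {2::nat}" "1 \<notin> {2::nat}" "finite {1, 2::nat}" "0 \<notin> {1, 2::nat}" by auto
  show ?thesis
    unfolding pdet_def e sum_over_permutations_insert[OF f(3,4)] sum_over_permutations_insert[OF f(1,2)] permutes_sing
    by (simp add: sign_swap_id permutation_swap_id sign_compose sign_id Transposition.transpose_def)
qed

definition omega :: complex where "omega = Complex (-1/2) (sqrt 3 / 2)"

text \<open>Rewriting with these brings every polynomial in \<open>omega\<close> into the form a + b
  \<open>omega\<close>; the second equation reaches products nested to the right.\<close>

lemma omega_square: "omega * omega = - 1 - omega" "omega * (omega * x) = (- 1 - omega) * x"
proof -
  show "omega * omega = - 1 - omega" by (simp add: omega_def complex_eq_iff field_simps)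
  then show "omega * (omega * x) = (- 1 - omega) * x" by (simp add: mult.assoc[symmetric])
qed

lemma cnj_omega: "cnj omega = - 1 - omega"
  by (simp add: omega_def complex_eq_iff)

lemma omega_neq: "1 + 2 * omega \<noteq> 0" "2 + omega \<noteq> 0"
  by (simp_all add: omega_def complex_eq_iff)

text \<open>The vectors (1, 0), (0, 1), (1, 1) and (1, -\<open>omega\<close>): all six minors of
  order 2 have modulus 1, so by Cauchy-Binet every pair contributes with coefficient 1.\<close>

definition U24_vector :: "nat \<Rightarrow> nat \<Rightarrow> complex" where
  "U24_vector f k = (if f = 0 then of_bool (k = 0) else if f = 1 then of_bool (k = 1)
     else if f = 2 then 1 else if k = 0 then 1 else - omega)"

lemma U24_ground: "ground (uniform_matroid 2 4) = {0, 1, 2, 3}"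
  by (auto simp: uniform_matroid_def)

lemma U24_bases: "bases (uniform_matroid 2 4) = {{0, 1}, {0, 2}, {0, 3}, {1, 2}, {1, 3}, {2, 3}}"
proof -
  have sub: "S \<in> {{0, 1}, {0, 2}, {0, 3}, {1, 2}, {1, 3}, {2, 3}}" if S: "S \<subseteq> {..<4::nat}" "card S = 2" for S
  proof -
    obtain a b where ab: "S = {a, b}" "a \<noteq> b" using S(2) by (auto simp: card_2_iff)
    then have "a = 0 \<or> a = 1 \<or> a = 2 \<or> a = 3" "b = 0 \<or> b = 1 \<or> b = 2 \<or> b = 3" using S(1) by auto
    then show ?thesis using ab by (elim disjE) (simp_all add: insert_commute)
  qed
  have sup: "S \<subseteq> {..<4::nat} \<and> card S = 2" if "S \<in> {{0, 1}, {0, 2}, {0, 3}, {1, 2}, {1, 3}, {2, 3}}" for S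
    using that by (elim insertE emptyE) simp_all
  have "{S. S \<subseteq> {..<4::nat} \<and> card S = 2} = {{0, 1}, {0, 2}, {0, 3}, {1, 2}, {1, 3}, {2, 3}}"
    by (rule subset_antisym; rule subsetI) (erule CollectE, erule conjE, erule (1) sub, rule CollectI, erule sup)
  then show ?thesis
    unfolding uniform_matroid_def by (simp only: matroid_data.simps)
qed

lemma sum_lessThan_2: "(\<Sum>k<2::nat. f k) = f 0 + (f 1 :: 'a::comm_monoid_add)" "(k::nat) < 2 \<longleftrightarrow> k = 0 \<or> k = 1"
  by (auto simp: numeral_2_eq_2)

lemma U24_det:
  fixes y :: "nat \<Rightarrow> real"
  shows "pdet 2 (\<lambda>k l. \<Sum>f\<in>{0, 1, 2, 3}. of_real (y f) * (U24_vector f k * cnj (U24_vector f l)))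
    = of_real (1 * (\<Sum>S\<in>bases (uniform_matroid 2 4). \<Prod>f\<in>S. y f))"
proof -
  have "(\<Sum>S\<in>bases (uniform_matroid 2 4). \<Prod>f\<in>S. y f)
    = y 0 * y 1 + y 0 * y 2 + y 0 * y 3 + y 1 * y 2 + y 1 * y 3 + y 2 * y 3"
    unfolding U24_bases by (simp add: doubleton_eq_iff)
  then show ?thesis
    by (simp add: pdet_2 U24_vector_def cnj_omega algebra_simps omega_square)
qed

lemma U24_spanning:
  assumes "\<And>f. f \<in> {0, 1, 2, 3} \<Longrightarrow> (\<Sum>k<2. cnj (U24_vector f k) * u k) = 0" "k < 2"
  shows "u k = 0"
  using assms(1)[of 0] assms(1)[of 1] assms(2) by (auto simp: U24_vector_def sum_lessThan_2)

text \<open>Coefficients expressing the matrix unit with entry 1 at position \<open>(j, i)\<close> through the four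
  rank-one matrices.\<close>
definition U24_coef :: "nat \<Rightarrow> nat \<Rightarrow> nat \<Rightarrow> complex" where
  "U24_coef i j f = (if i = j then of_bool (f = i)
     else (if i = 1 then if f < 2 then - 1 - omega else if f = 2 then omega else 1
           else if f < 2 then - omega else if f = 2 then 1 + omega else - 1) / (1 + 2 * omega))"

lemma U24_unit:
  assumes "i < 2" "j < 2" "k < 2" "l < 2"
  shows "(\<Sum>f\<in>{0, 1, 2, 3}. U24_coef i j f * (U24_vector f k * cnj (U24_vector f l))) = of_bool (k = j \<and> l = i)"
proof -
  have d: "1 + 2 * omega \<noteq> 0" by (rule omega_neq(1))
  consider "i = j" | "i = 1" "j = 0" | "i = 0" "j = 1" using assms by (auto simp: sum_lessThan_2)
  then show ?thesis
  proof cases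
    case 1
    then show ?thesis using assms by (auto simp: sum_lessThan_2 U24_coef_def U24_vector_def)
  next
    case 2
    \<comment> \<open>Multiplying by 1 + 2 \<open>omega\<close> clears the denominator and leaves an
      identity between Eisenstein integers.\<close>
    have c: "(1 + 2 * omega) * U24_coef i j f = (if f < 2 then - 1 - omega else if f = 2 then omega else 1)" for f
      using 2 d by (simp add: U24_coef_def)
    have "(\<Sum>f\<in>{0, 1, 2, 3}. (1 + 2 * omega) * U24_coef i j f * (U24_vector f k * cnj (U24_vector f l)))
      = (1 + 2 * omega) * of_bool (k = j \<and> l = i)"
      unfolding c using 2 assms by (auto simp: sum_lessThan_2 U24_vector_def cnj_omega algebra_simps omega_square)
    then show ?thesis
      by (simp only: mult.assoc sum_distrib_left[symmetric] mult_left_cancel[OF d])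
  next
    case 3
    have c: "(1 + 2 * omega) * U24_coef i j f = (if f < 2 then - omega else if f = 2 then 1 + omega else - 1)" for f
      using 3 d by (simp add: U24_coef_def)
    have "(\<Sum>f\<in>{0, 1, 2, 3}. (1 + 2 * omega) * U24_coef i j f * (U24_vector f k * cnj (U24_vector f l)))
      = (1 + 2 * omega) * of_bool (k = j \<and> l = i)"
      unfolding c using 3 assms by (auto simp: sum_lessThan_2 U24_vector_def cnj_omega algebra_simps omega_square)
    then show ?thesis
      by (simp only: mult.assoc sum_distrib_left[symmetric] mult_left_cancel[OF d])
  qed
qed

section \<open>The ternary affine plane\<close>

lemma arith_3: "(3::3) = 0" "(1::3) + 2 = 0" "(2::3) + 2 = 1" "(2::3) * 2 = 1" "- (1::3) = 2" "- (2::3) = 1"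
  "(2::3) \<noteq> 1" "(2::3) \<noteq> 0" "(0::3) \<noteq> 1" by simp_all

lemma UNIV_3': "(UNIV :: 3 set) = {0, 1, 2}" using UNIV_3 by auto

lemma all_3: "(\<forall>x::3. P x) \<longleftrightarrow> P 0 \<and> P 1 \<and> P 2"
proof -
  have "(\<forall>x::3. P x) \<longleftrightarrow> (\<forall>x\<in>UNIV. P x)" by simp
  then show ?thesis unfolding UNIV_3' by simp
qed

lemma sum_3': "sum f (UNIV::3 set) = f 0 + f 1 + (f 2 :: 'a::comm_monoid_add)"
  unfolding UNIV_3' by (simp add: add_ac)

text \<open>A line through the origin over the field with three elements has only two nonzero
  points, and they are negatives of each other.\<close>

lemma null_vectors_3:
  "\<forall>a b s t p q :: 3. (a, b) \<noteq> (0, 0) \<longrightarrow> a * s + b * t = 0 \<longrightarrow> a * p + b * q = 0 \<longrightarrow>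
    (s, t) \<noteq> (0, 0) \<longrightarrow> (p, q) \<noteq> (0, 0) \<longrightarrow> (s, t) \<noteq> (p, q) \<longrightarrow> (s + p, t + q) = (0, 0)"
  unfolding all_3 by simp

lemma third_point_3:
  "\<forall>a b c d :: 3. (d - b) * (- a - c) + (a - c) * (- b - d) = (d - b) * a + (a - c) * b"
  unfolding all_3 by simp

lemma triple_3: "x + x + x = (0 :: 3 \<times> 3)"
proof -
  have "\<forall>a::3. a + a + a = 0" unfolding all_3 by simp
  then show ?thesis by (cases x) (simp add: zero_prod_def)
qed

lemma third_point: "r = - p - q \<longleftrightarrow> p + q + r = (0 :: 'a::ab_group_add)"
proof -
  have "r = - (p + q) \<longleftrightarrow> r + (p + q) = 0" by (rule eq_neg_iff_add_eq_0)
  then show ?thesis by (simp add: add_ac)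
qed

text \<open>Distinct collinear points give two distinct nonzero multiples of one direction, q - p
  and r - p, hence opposite ones; since p + p = -p, their sum is p + q + r.\<close>

lemma collinear_iff:
  fixes p q r :: "3 \<times> 3"
  assumes "p \<noteq> q" "q \<noteq> r" "p \<noteq> r"
  shows "(\<exists>L. affine_line_3 L \<and> {p, q, r} \<subseteq> L) \<longleftrightarrow> p + q + r = 0"
proof -
  obtain p1 p2 q1 q2 r1 r2 where pqr: "p = (p1, p2)" "q = (q1, q2)" "r = (r1, r2)"
    by (cases p; cases q; cases r)
  have "p + p = - p" using triple_3[of p] by (simp add: eq_neg_iff_add_eq_0)
  moreover have "(q - p) + (r - p) = q + r - (p + p)" by (simp add: algebra_simps)
  ultimately have eq3: "p + q + r = (q - p) + (r - p)" by (simp add: add_ac)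
  show ?thesis
  proof
    assume "\<exists>L. affine_line_3 L \<and> {p, q, r} \<subseteq> L"
    then obtain a b c where ab: "(a, b) \<noteq> (0, 0)"
      and l: "a * p1 + b * p2 = c" "a * q1 + b * q2 = c" "a * r1 + b * r2 = c"
      unfolding affine_line_3_def pqr by auto
    have "a * (q1 - p1) + b * (q2 - p2) = 0" "a * (r1 - p1) + b * (r2 - p2) = 0"
      using l by (simp_all add: algebra_simps)
    moreover have "(q1 - p1, q2 - p2) \<noteq> (0, 0)" "(r1 - p1, r2 - p2) \<noteq> (0, 0)" "(q1 - p1, q2 - p2) \<noteq> (r1 - p1, r2 - p2)"
      using assms pqr by auto
    ultimately have "((q1 - p1) + (r1 - p1), (q2 - p2) + (r2 - p2)) = (0, 0)"
      using null_vectors_3 ab by blast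
    then show "p + q + r = 0" unfolding eq3 by (simp add: pqr zero_prod_def)
  next
    assume "p + q + r = 0"
    then have "r = - p - q" by (simp add: third_point)
    then have r: "r1 = - p1 - q1" "r2 = - p2 - q2" by (simp_all add: pqr)
    let ?a = "q2 - p2" and ?b = "p1 - q1"
    let ?L = "{(x, y). ?a * x + ?b * y = ?a * p1 + ?b * p2}"
    have "(?a, ?b) \<noteq> (0, 0)" using assms(1) pqr by auto
    then have "affine_line_3 ?L" unfolding affine_line_3_def by blast
    moreover have "{p, q, r} \<subseteq> ?L"
      using third_point_3 by (auto simp: pqr r algebra_simps)
    ultimately show "\<exists>L. affine_line_3 L \<and> {p, q, r} \<subseteq> L" by blast
  qed
qed

text \<open>Every three-element set has six orderings, and ordered triples can be summed one
  coordinate at a time.\<close>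

lemma sum_card_3:
  fixes F :: "'a::finite set \<Rightarrow> real"
  shows "6 * (\<Sum>S | card S = 3 \<and> P S. F S)
    = (\<Sum>p\<in>UNIV. \<Sum>q\<in>UNIV. \<Sum>r\<in>UNIV. of_bool (p \<noteq> q \<and> q \<noteq> r \<and> p \<noteq> r \<and> P {p, q, r}) * F {p, q, r})"
proof -
  let ?D = "{(p, q, r). p \<noteq> q \<and> q \<noteq> r \<and> p \<noteq> r \<and> P {p, q, r}}"
  let ?\<phi> = "\<lambda>(p, q, r). {p, q, r} :: 'a set"
  have im: "?\<phi> ` ?D \<subseteq> {S. card S = 3 \<and> P S}" by (auto simp: card_insert_if)
  have fibre: "(\<Sum>t\<in>{t \<in> ?D. ?\<phi> t = S}. F (?\<phi> t)) = 6 * F S" if S: "card S = 3" "P S" for S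
  proof -
    obtain a b c where abc: "S = {a, b, c}" "a \<noteq> b" "b \<noteq> c" "a \<noteq> c"
      using S(1) by (metis card_3_iff)
    have "{t \<in> ?D. ?\<phi> t = S} = {(a, b, c), (a, c, b), (b, a, c), (b, c, a), (c, a, b), (c, b, a)}" (is "_ = ?six")
    proof (intro subset_antisym subsetI)
      fix t assume "t \<in> {t \<in> ?D. ?\<phi> t = S}"
      then obtain p q r where t: "t = (p, q, r)" "p \<noteq> q" "q \<noteq> r" "p \<noteq> r" "{p, q, r} = {a, b, c}"
        unfolding abc(1) by auto
      then have "p \<in> {a, b, c}" "q \<in> {a, b, c}" "r \<in> {a, b, c}" by (metis insertCI)+
      then have "p = a \<or> p = b \<or> p = c" "q = a \<or> q = b \<or> q = c" "r = a \<or> r = b \<or> r = c" by simp_all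
      then show "t \<in> ?six"
        using t(1-4) by (elim disjE) simp_all
    next
      fix t assume "t \<in> ?six"
      then have "?\<phi> t = S" "t \<in> {(p, q, r). p \<noteq> q \<and> q \<noteq> r \<and> p \<noteq> r}"
        using abc(2-4) unfolding abc(1) by auto
      then show "t \<in> {t \<in> ?D. ?\<phi> t = S}" using S(2) by auto
    qed
    moreover have "F (?\<phi> t) = F S" if "t \<in> {t \<in> ?D. ?\<phi> t = S}" for t
      using that by simp
    moreover have "card ?six = 6" using abc(2-4) by simp
    ultimately show ?thesis by simp
  qed
  have "6 * (\<Sum>S | card S = 3 \<and> P S. F S)
    = (\<Sum>S | card S = 3 \<and> P S. \<Sum>t\<in>{t \<in> ?D. ?\<phi> t = S}. F (?\<phi> t))"
    unfolding sum_distrib_left by (intro sum.cong refl fibre[symmetric]) auto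
  also have "\<dots> = (\<Sum>t\<in>?D. F (?\<phi> t))"
    by (rule sum.group[OF _ _ im]) auto
  also have "\<dots> = (\<Sum>t\<in>UNIV \<times> UNIV \<times> UNIV. of_bool (t \<in> ?D) * F (?\<phi> t))"
    by (intro sum.mono_neutral_cong_left) simp_all
  also have "\<dots> = (\<Sum>p\<in>UNIV. \<Sum>q\<in>UNIV. \<Sum>r\<in>UNIV. of_bool (p \<noteq> q \<and> q \<noteq> r \<and> p \<noteq> r \<and> P {p, q, r}) * F {p, q, r})"
    by (simp only: sum.cartesian_product' mem_Collect_eq case_prod_conv)
  finally show ?thesis .
qed

text \<open>Newton's identity counts distinct triples with coefficient 2 at the cubes; subtracting
  all zero-sum triples removes the collinear ones but also the constant triples, since p + p + p =
  0, and restoring these raises the coefficient to 3.\<close>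

lemma AG23_basis_sum:
  fixes y :: "3 \<times> 3 \<Rightarrow> real"
  shows "6 * (\<Sum>S\<in>bases AG23. \<Prod>f\<in>S. y f)
    = (\<Sum>f\<in>UNIV. y f) ^ 3 - 3 * (\<Sum>f\<in>UNIV. y f) * (\<Sum>f\<in>UNIV. (y f)\<^sup>2) + 3 * (\<Sum>f\<in>UNIV. (y f) ^ 3)
      - (\<Sum>p\<in>UNIV. \<Sum>q\<in>UNIV. y p * y q * y (- p - q))"
proof -
  have "6 * (\<Sum>S\<in>bases AG23. \<Prod>f\<in>S. y f)
    = (\<Sum>p\<in>UNIV. \<Sum>q\<in>UNIV. \<Sum>r\<in>UNIV. of_bool (p \<noteq> q \<and> q \<noteq> r \<and> p \<noteq> r
        \<and> \<not> (\<exists>L. affine_line_3 L \<and> {p, q, r} \<subseteq> L)) * (\<Prod>f\<in>{p, q, r}. y f))"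
    unfolding AG23_def by (simp only: matroid_data.simps sum_card_3)
  also have "\<dots> = (\<Sum>p\<in>UNIV. \<Sum>q\<in>UNIV. \<Sum>r\<in>UNIV.
      y p * y q * y r - (if p = q then y q * y q * y r else 0) - (if r = q then y p * y q * y q else 0)
      - (if r = p then y p * y q * y p else 0)
      + 3 * (if r = q then if p = q then y q * y q * y q else 0 else 0) - (if r = - p - q then y p * y q * y (- p - q) else 0))"
  proof (intro sum.cong refl)
    fix p q r :: "3 \<times> 3"
    note z = third_point[of r p q]
    consider "p = q" "q = r" | "p = q" "q \<noteq> r" | "p \<noteq> q" "q = r" | "p \<noteq> q" "p = r" | "p \<noteq> q" "q \<noteq> r" "p \<noteq> r" by blast
    then show "of_bool (p \<noteq> q \<and> q \<noteq> r \<and> p \<noteq> r \<and> \<not> (\<exists>L. affine_line_3 L \<and> {p, q, r} \<subseteq> L)) * (\<Prod>f\<in>{p, q, r}. y f)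
      = y p * y q * y r - (if p = q then y q * y q * y r else 0) - (if r = q then y p * y q * y q else 0)
      - (if r = p then y p * y q * y p else 0)
      + 3 * (if r = q then if p = q then y q * y q * y q else 0 else 0) - (if r = - p - q then y p * y q * y (- p - q) else 0)"
    proof cases
      case 1
      then have "r = - p - q" using triple_3[of p] z by simp
      then show ?thesis using 1 by simp
    next
      case 2
      then have "r \<noteq> - p - q" using triple_3[of q] z by (metis add_left_cancel)
      then show ?thesis using 2 by simp
    next
      case 3
      then have "r \<noteq> - p - q" using triple_3[of q] z by (metis add_right_cancel)
      then show ?thesis using 3 by simp
    next
      case 4
      then have "r \<noteq> - p - q" using triple_3[of p] z by (metis add_right_cancel add_left_cancel)
      then show ?thesis using 4 by simp
    next
      case 5
      then show ?thesis using collinear_iff[OF 5] z by auto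
    qed
  qed
  also have "\<dots> = (\<Sum>f\<in>UNIV. y f) ^ 3 - 3 * (\<Sum>f\<in>UNIV. y f) * (\<Sum>f\<in>UNIV. (y f)\<^sup>2) + 3 * (\<Sum>f\<in>UNIV. (y f) ^ 3)
      - (\<Sum>p\<in>UNIV. \<Sum>q\<in>UNIV. y p * y q * y (- p - q))"
  proof -
    let ?S = "\<Sum>f\<in>UNIV. y f" and ?P = "\<Sum>f\<in>UNIV. y f * y f"
    have c1: "(\<Sum>p\<in>UNIV. \<Sum>q\<in>UNIV. \<Sum>r\<in>UNIV. y p * y q * y r) = ?S * ?S * ?S"
      by (simp only: sum_distrib_left[symmetric] sum_distrib_right[symmetric])
    have c2: "(\<Sum>p\<in>UNIV. \<Sum>q\<in>UNIV. \<Sum>r\<in>UNIV. if p = q then y q * y q * y r else 0) = ?P * ?S"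
    proof -
      have "(\<Sum>p\<in>UNIV. \<Sum>q\<in>UNIV. \<Sum>r\<in>UNIV. if p = q then y q * y q * y r else 0)
        = (\<Sum>p\<in>UNIV. \<Sum>q\<in>UNIV. if p = q then y q * y q * ?S else 0)"
        by (intro sum.cong refl) (auto simp: sum_distrib_left)
      then show ?thesis by (simp add: sum_distrib_right)
    qed
    have c3: "(\<Sum>p\<in>UNIV. \<Sum>q\<in>UNIV. \<Sum>r\<in>UNIV. if r = q then y p * y q * y q else 0) = ?S * ?P"
      by (simp add: sum_product mult.assoc)
    have c4: "(\<Sum>p\<in>UNIV. \<Sum>q\<in>UNIV. \<Sum>r\<in>UNIV. if r = p then y p * y q * y p else 0) = ?P * ?S"
      by (simp, simp only: sum_product, simp only: mult_ac)
    have c5: "(\<Sum>p\<in>UNIV. \<Sum>q\<in>UNIV. \<Sum>r\<in>UNIV. 3 * (if r = q then if p = q then y q * y q * y q else 0 else 0)) = 3 * (\<Sum>f\<in>UNIV. (y f) ^ 3)"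
      by (simp add: sum_distrib_left[symmetric] power3_eq_cube)
    have c6: "(\<Sum>p\<in>UNIV. \<Sum>q\<in>UNIV. \<Sum>r\<in>UNIV. if r = - p - q then y p * y q * y (- p - q) else 0)
      = (\<Sum>p\<in>UNIV. \<Sum>q\<in>UNIV. y p * y q * y (- p - q))" by simp
    show ?thesis
      unfolding sum.distrib sum_subtractf c1 c2 c3 c4 c5 c6
      by (simp add: power2_eq_square power3_eq_cube algebra_simps)
  qed
  finally show ?thesis .
qed

definition omega_power :: "3 \<Rightarrow> complex" where
  "omega_power b = (if b = 0 then 1 else if b = 1 then omega else - 1 - omega)"

text \<open>The first coordinate of a point selects one of three parallel lines; the three points of that line
  become vectors with a common vanishing coordinate.\<close>
definition AG23_vector :: "3 \<times> 3 \<Rightarrow> nat \<Rightarrow> complex" where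
  "AG23_vector f k =
    (if fst f = 0 then if k = 0 then 0 else if k = 1 then 1 else - omega_power (snd f)
     else if fst f = 1 then if k = 0 then - omega_power (snd f) else if k = 1 then 0 else 1
     else if k = 0 then 1 else if k = 1 then - omega_power (snd f) else 0)"

lemma sum_plane: "(\<Sum>f\<in>UNIV. F f) = F (0, 0) + F (0, 1) + F (0, 2) + (F (1, 0) + F (1, 1) + F (1, 2))
    + (F (2, 0) + F (2, 1) + F (2, 2))" for F :: "3 \<times> 3 \<Rightarrow> 'a::comm_monoid_add"
  unfolding UNIV_Times_UNIV[symmetric] sum.cartesian_product' sum_3' ..

text \<open>Organized by one class of three parallel lines: A, B, C are the sums over these lines,
  a, b, c the second elementary symmetric sums. The subtracted terms are the nine lines that meet
  each of the three once.\<close>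

lemma AG23_basis_polynomial:
  fixes y :: "3 \<times> 3 \<Rightarrow> real"
  defines "A \<equiv> y (0, 0) + y (0, 1) + y (0, 2)" and "B \<equiv> y (1, 0) + y (1, 1) + y (1, 2)"
    and "C \<equiv> y (2, 0) + y (2, 1) + y (2, 2)"
    and "a \<equiv> y (0, 0) * y (0, 1) + y (0, 0) * y (0, 2) + y (0, 1) * y (0, 2)"
    and "b \<equiv> y (1, 0) * y (1, 1) + y (1, 0) * y (1, 2) + y (1, 1) * y (1, 2)"
    and "c \<equiv> y (2, 0) * y (2, 1) + y (2, 0) * y (2, 2) + y (2, 1) * y (2, 2)"
  shows "(\<Sum>S\<in>bases AG23. \<Prod>f\<in>S. y f) = A * B * C + a * (B + C) + b * (A + C) + c * (A + B)
    - (y (0, 0) * y (1, 0) * y (2, 0) + y (0, 0) * y (1, 1) * y (2, 2) + y (0, 0) * y (1, 2) * y (2, 1)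
     + y (0, 1) * y (1, 0) * y (2, 2) + y (0, 1) * y (1, 1) * y (2, 1) + y (0, 1) * y (1, 2) * y (2, 0)
     + y (0, 2) * y (1, 0) * y (2, 1) + y (0, 2) * y (1, 1) * y (2, 0) + y (0, 2) * y (1, 2) * y (2, 2))"
proof -
  \<comment> \<open>Zero-sum triples are the constant ones, counted once, and the twelve lines,
    counted six times each.\<close>
  have lines: "(\<Sum>p\<in>UNIV. \<Sum>q\<in>UNIV. y p * y q * y (- p - q)) =
     (\<Sum>f\<in>UNIV. (y f) ^ 3) + 6 * (y (0, 0) * y (0, 1) * y (0, 2) + y (1, 0) * y (1, 1) * y (1, 2) + y (2, 0) * y (2, 1) * y (2, 2))
     + 6 * (y (0, 0) * y (1, 0) * y (2, 0) + y (0, 0) * y (1, 1) * y (2, 2) + y (0, 0) * y (1, 2) * y (2, 1)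
     + y (0, 1) * y (1, 0) * y (2, 2) + y (0, 1) * y (1, 1) * y (2, 1) + y (0, 1) * y (1, 2) * y (2, 0)
     + y (0, 2) * y (1, 0) * y (2, 1) + y (0, 2) * y (1, 1) * y (2, 0) + y (0, 2) * y (1, 2) * y (2, 2))"
    unfolding sum_plane by (simp add: arith_3 zero_prod_def algebra_simps power3_eq_cube)
  \<comment> \<open>Splits the third elementary symmetric sum of nine variables along the three
    lines; the free parameters stand for the power sums on each line.\<close>
  have newton: "(p + q + r) ^ 3 - 3 * (p + q + r) * (p2 + q2 + r2) + 2 * (p3 + q3 + r3)
    = 6 * p * q * r + 3 * ((p\<^sup>2 - p2) * (q + r) + (q\<^sup>2 - q2) * (p + r) + (r\<^sup>2 - r2) * (p + q))
      + (p ^ 3 - 3 * p * p2 + 2 * p3) + (q ^ 3 - 3 * q * q2 + 2 * q3) + (r ^ 3 - 3 * r * r2 + 2 * r3)"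
    for p q r p2 q2 r2 p3 q3 r3 :: real
    by (simp add: algebra_simps power2_eq_square power3_eq_cube)
  have e2: "(p + q + r)\<^sup>2 - (p\<^sup>2 + q\<^sup>2 + r\<^sup>2) = 2 * (p * q + p * r + q * r)" for p q r :: real
    by (simp add: algebra_simps power2_eq_square)
  have e3: "(p + q + r) ^ 3 - 3 * (p + q + r) * (p\<^sup>2 + q\<^sup>2 + r\<^sup>2) + 2 * (p ^ 3 + q ^ 3 + r ^ 3) = 6 * p * q * r" for p q r :: real
    by (simp add: algebra_simps power2_eq_square power3_eq_cube)
  have "6 * (\<Sum>S\<in>bases AG23. \<Prod>f\<in>S. y f)
    = ((\<Sum>f\<in>UNIV. y f) ^ 3 - 3 * (\<Sum>f\<in>UNIV. y f) * (\<Sum>f\<in>UNIV. (y f)\<^sup>2) + 2 * (\<Sum>f\<in>UNIV. (y f) ^ 3))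
      + (\<Sum>f\<in>UNIV. (y f) ^ 3) - (\<Sum>p\<in>UNIV. \<Sum>q\<in>UNIV. y p * y q * y (- p - q))"
    unfolding AG23_basis_sum by simp
  also have "(\<Sum>f\<in>UNIV. y f) ^ 3 - 3 * (\<Sum>f\<in>UNIV. y f) * (\<Sum>f\<in>UNIV. (y f)\<^sup>2) + 2 * (\<Sum>f\<in>UNIV. (y f) ^ 3)
    = 6 * A * B * C + 6 * (a * (B + C) + b * (A + C) + c * (A + B))
      + 6 * y (0, 0) * y (0, 1) * y (0, 2) + 6 * y (1, 0) * y (1, 1) * y (1, 2) + 6 * y (2, 0) * y (2, 1) * y (2, 2)"
    unfolding sum_plane
    by (subst newton, unfold e3 e2, fold A_def B_def C_def a_def b_def c_def) (simp add: algebra_simps)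
  finally show ?thesis unfolding lines by simp
qed

lemma sum_lessThan_3: "(\<Sum>k<3::nat. f k) = f 0 + f 1 + (f 2 :: 'a::comm_monoid_add)"
    "(k::nat) < 3 \<longleftrightarrow> k = 0 \<or> k = 1 \<or> k = 2"
  by (auto simp: numeral_3_eq_3 numeral_2_eq_2)

text \<open>The factor 3 is the squared modulus of the minor of a non-collinear triple; collinear
  triples have minor 0.\<close>

lemma AG23_det:
  fixes y :: "3 \<times> 3 \<Rightarrow> real"
  shows "pdet 3 (\<lambda>k l. \<Sum>f\<in>UNIV. of_real (y f) * (AG23_vector f k * cnj (AG23_vector f l)))
    = of_real (3 * (\<Sum>S\<in>bases AG23. \<Prod>f\<in>S. y f))"
proof -
  \<comment> \<open>Discrete Fourier coefficients of y on the three parallel lines; up to sign and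
    conjugation they are the off-diagonal entries of the matrix.\<close>
  define z :: "3 \<Rightarrow> complex" where "z i = y (i, 0) + omega * y (i, 1) + (- 1 - omega) * y (i, 2)" for i
  define t :: "3 \<Rightarrow> complex" where "t i = y (i, 0) + y (i, 1) + y (i, 2)" for i
  define d :: "3 \<Rightarrow> complex" where "d i = y (i, 0) * y (i, 1) + y (i, 0) * y (i, 2) + y (i, 1) * y (i, 2)" for i
  define L :: complex where
    "L = y (0, 0) * y (1, 0) * y (2, 0) + y (0, 0) * y (1, 1) * y (2, 2) + y (0, 0) * y (1, 2) * y (2, 1)
     + y (0, 1) * y (1, 0) * y (2, 2) + y (0, 1) * y (1, 1) * y (2, 1) + y (0, 1) * y (1, 2) * y (2, 0)
     + y (0, 2) * y (1, 0) * y (2, 1) + y (0, 2) * y (1, 1) * y (2, 0) + y (0, 2) * y (1, 2) * y (2, 2)"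
  let ?X = "\<lambda>k l. \<Sum>f\<in>UNIV. complex_of_real (y f) * (AG23_vector f k * cnj (AG23_vector f l))"
  have cz: "cnj (z i) = y (i, 0) + (- 1 - omega) * y (i, 1) + omega * y (i, 2)" for i
    by (simp add: z_def cnj_omega)
  have X: "?X 0 0 = t 1 + t 2" "?X 1 1 = t 0 + t 2" "?X 2 2 = t 0 + t 1"
    "?X 0 1 = - cnj (z 2)" "?X 1 0 = - z 2" "?X 1 2 = - cnj (z 0)" "?X 2 1 = - z 0" "?X 2 0 = - cnj (z 1)" "?X 0 2 = - z 1"
    unfolding cz unfolding sum_plane
    by (simp_all add: AG23_vector_def omega_power_def cnj_omega t_def z_def algebra_simps omega_square)
  have zz: "z i * cnj (z i) = t i * t i - 3 * d i" for i
    unfolding cz unfolding z_def t_def d_def by (simp add: algebra_simps omega_square)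
  \<comment> \<open>A choice of one point on each line contributes a power of \<open>omega\<close>
    plus its conjugate: 2 if the three points form a line, and -1 otherwise.\<close>
  have zzz: "z 0 * z 1 * z 2 + cnj (z 0) * cnj (z 1) * cnj (z 2) = 3 * L - t 0 * t 1 * t 2"
    unfolding cz unfolding z_def t_def L_def by (simp add: algebra_simps omega_square)
  have "pdet 3 ?X = (t 1 + t 2) * (t 0 + t 2) * (t 0 + t 1) - (z 0 * z 1 * z 2 + cnj (z 0) * cnj (z 1) * cnj (z 2))
    - (t 1 + t 2) * (z 0 * cnj (z 0)) - (t 0 + t 1) * (z 2 * cnj (z 2)) - (t 0 + t 2) * (z 1 * cnj (z 1))"
    unfolding pdet_3 X by (simp add: algebra_simps)
  also have "\<dots> = 3 * (t 0 * t 1 * t 2 + d 0 * (t 1 + t 2) + d 1 * (t 0 + t 2) + d 2 * (t 0 + t 1) - L)"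
    unfolding zz zzz by (simp add: algebra_simps)
  also have "\<dots> = of_real (3 * (\<Sum>S\<in>bases AG23. \<Prod>f\<in>S. y f))"
    unfolding AG23_basis_polynomial t_def d_def L_def by simp
  finally show ?thesis .
qed

lemma AG23_spanning:
  assumes u: "\<And>f. (\<Sum>k<3. cnj (AG23_vector f k) * u k) = 0" and k: "k < 3"
  shows "u k = 0"
proof -
  have 1: "u 1 = u 2" using u[of "(0, 0)"] by (simp add: sum_lessThan_3 AG23_vector_def omega_power_def)
  have "u 1 + (omega + 1) * u 2 = 0"
    using u[of "(0, 1)"] by (simp add: sum_lessThan_3 AG23_vector_def omega_power_def cnj_omega)
  then have "(2 + omega) * u 2 = 0" unfolding 1 by (simp add: algebra_simps)
  then have 2: "u 2 = 0" using omega_neq(2) by (simp only: mult_eq_0_iff) simp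
  have "u 0 = u 1" using u[of "(2, 0)"] by (simp add: sum_lessThan_3 AG23_vector_def omega_power_def)
  then show ?thesis using 1 2 k by (auto simp: sum_lessThan_3)
qed

text \<open>Coefficients expressing the matrix unit with entry 1 at position \<open>(j, i)\<close> through the nine
  rank-one matrices.\<close>
definition AG23_coef :: "nat \<Rightarrow> nat \<Rightarrow> 3 \<times> 3 \<Rightarrow> complex" where
  "AG23_coef i j f =
    (if i = j then (if fst f = of_nat i then - 1 / 6 else 1 / 6)
     else if fst f \<noteq> of_nat (3 - i - j) then 0
     else if (i, j) \<in> {(1, 0), (2, 1), (0, 2)} then - (1 / 3) * omega_power (snd f)
     else - (1 / 3) * cnj (omega_power (snd f)))"

text \<open>Orthogonality of the characters of the cyclic group of order 3: the trivial character
  isolates the diagonal of the rank-one matrices on a line, the two others one off-diagonal entry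
  each.\<close>

lemma AG23_parallel_sums:
  assumes "k < 3" "l < 3"
  shows "(\<Sum>b\<in>UNIV. AG23_vector (a, b) k * cnj (AG23_vector (a, b) l)) = 3 * of_bool (k = l \<and> of_nat k \<noteq> a)"
    and "(\<Sum>b\<in>UNIV. omega_power b * (AG23_vector (a, b) k * cnj (AG23_vector (a, b) l)))
      = - 3 * of_bool ((a, k, l) \<in> {(0, 1, 2), (1, 2, 0), (2, 0, 1)})"
    and "(\<Sum>b\<in>UNIV. cnj (omega_power b) * (AG23_vector (a, b) k * cnj (AG23_vector (a, b) l)))
      = - 3 * of_bool ((a, l, k) \<in> {(0, 1, 2), (1, 2, 0), (2, 0, 1)})"
proof -
  have "\<forall>a::3. a = 0 \<or> a = 1 \<or> a = 2" unfolding all_3 by simp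
  then have cases: "a = 0 \<or> a = 1 \<or> a = 2" "k = 0 \<or> k = 1 \<or> k = 2" "l = 0 \<or> l = 1 \<or> l = 2"
    using assms by (simp_all add: sum_lessThan_3)
  show "(\<Sum>b\<in>UNIV. AG23_vector (a, b) k * cnj (AG23_vector (a, b) l)) = 3 * of_bool (k = l \<and> of_nat k \<noteq> a)"
    using cases by (elim disjE) (simp_all add: sum_3' AG23_vector_def omega_power_def cnj_omega algebra_simps omega_square)
  show "(\<Sum>b\<in>UNIV. omega_power b * (AG23_vector (a, b) k * cnj (AG23_vector (a, b) l)))
      = - 3 * of_bool ((a, k, l) \<in> {(0, 1, 2), (1, 2, 0), (2, 0, 1)})"
    using cases by (elim disjE) (simp_all add: sum_3' AG23_vector_def omega_power_def cnj_omega algebra_simps omega_square)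
  show "(\<Sum>b\<in>UNIV. cnj (omega_power b) * (AG23_vector (a, b) k * cnj (AG23_vector (a, b) l)))
      = - 3 * of_bool ((a, l, k) \<in> {(0, 1, 2), (1, 2, 0), (2, 0, 1)})"
    using cases by (elim disjE) (simp_all add: sum_3' AG23_vector_def omega_power_def cnj_omega algebra_simps omega_square)
qed

lemma AG23_unit:
  assumes ij: "i < 3" "j < 3" and kl: "k < 3" "l < 3"
  shows "(\<Sum>f\<in>UNIV. AG23_coef i j f * (AG23_vector f k * cnj (AG23_vector f l))) = of_bool (k = j \<and> l = i)"
proof -
  let ?P = "\<lambda>a b. AG23_vector (a, b) k * cnj (AG23_vector (a, b) l)"
  have kl': "k = 0 \<or> k = 1 \<or> k = 2" "l = 0 \<or> l = 1 \<or> l = 2" using kl by (simp_all add: sum_lessThan_3)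
  have ij': "i = 0 \<or> i = 1 \<or> i = 2" "j = 0 \<or> j = 1 \<or> j = 2" using ij by (simp_all add: sum_lessThan_3)
  have "(\<Sum>f\<in>UNIV. AG23_coef i j f * (AG23_vector f k * cnj (AG23_vector f l)))
    = (\<Sum>a\<in>UNIV. \<Sum>b\<in>UNIV. AG23_coef i j (a, b) * ?P a b)"
    unfolding UNIV_Times_UNIV[symmetric] sum.cartesian_product' ..
  also have "\<dots> = of_bool (k = j \<and> l = i)"
  proof (cases "i = j")
    case True
    \<comment> \<open>Line a sums to three times the identity without its a-th diagonal unit. Adding
      the two lines other than i and subtracting line i leaves six times the unit at i.\<close>
    have "(\<Sum>a\<in>UNIV. \<Sum>b\<in>UNIV. AG23_coef i j (a, b) * ?P a b)
      = (\<Sum>a\<in>(UNIV :: 3 set). (if a = of_nat i then - 1 / 6 else 1 / 6) * (3 * of_bool (k = l \<and> of_nat k \<noteq> a)))"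
    proof (intro sum.cong refl)
      fix a :: 3
      let ?q = "if a = of_nat i then - 1 / 6 else 1 / 6 :: complex"
      have "(\<Sum>b\<in>UNIV. AG23_coef i j (a, b) * ?P a b) = ?q * (\<Sum>b\<in>UNIV. ?P a b)"
        unfolding sum_distrib_left by (intro sum.cong refl) (simp add: AG23_coef_def True)
      then show "(\<Sum>b\<in>UNIV. AG23_coef i j (a, b) * ?P a b) = ?q * (3 * of_bool (k = l \<and> of_nat k \<noteq> a))"
        unfolding AG23_parallel_sums(1)[OF kl] .
    qed
    also have "\<dots> = of_bool (k = j \<and> l = i)"
      using True ij' kl' by (elim disjE) (simp_all add: sum_3')
    finally show ?thesis .
  next
    case False
    \<comment> \<open>The index different from i and j: only vectors vanishing in that coordinate
      have both coordinates i and j nonzero.\<close>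
    let ?c = "of_nat (3 - i - j) :: 3"
    let ?cyc = "(i, j) \<in> {(1, 0), (2, 1), (0, 2)}"
    have "(\<Sum>a\<in>UNIV. \<Sum>b\<in>UNIV. AG23_coef i j (a, b) * ?P a b)
      = (\<Sum>a\<in>UNIV. if a = ?c then (\<Sum>b\<in>UNIV. AG23_coef i j (?c, b) * ?P ?c b) else 0)"
      by (intro sum.cong refl) (auto simp: AG23_coef_def False)
    also have "\<dots> = (\<Sum>b\<in>UNIV. AG23_coef i j (?c, b) * ?P ?c b)" by simp
    also have "\<dots> = - (1 / 3) * (if ?cyc then (\<Sum>b\<in>UNIV. omega_power b * ?P ?c b)
        else (\<Sum>b\<in>UNIV. cnj (omega_power b) * ?P ?c b))"
    proof (cases ?cyc)
      case True
      have "AG23_coef i j (?c, b) * ?P ?c b = - (1 / 3) * (omega_power b * ?P ?c b)" for b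
        unfolding AG23_coef_def fst_conv snd_conv if_P[OF True] if_not_P[OF False] by simp
      then show ?thesis unfolding if_P[OF True] sum_distrib_left by (intro sum.cong refl)
    next
      case n: False
      have "AG23_coef i j (?c, b) * ?P ?c b = - (1 / 3) * (cnj (omega_power b) * ?P ?c b)" for b
        unfolding AG23_coef_def fst_conv snd_conv if_not_P[OF n] if_not_P[OF False] by simp
      then show ?thesis unfolding if_not_P[OF n] sum_distrib_left by (intro sum.cong refl)
    qed
    also have "\<dots> = - (1 / 3) * (if ?cyc then - 3 * of_bool ((?c, k, l) \<in> {(0, 1, 2), (1, 2, 0), (2, 0, 1)})
        else - 3 * of_bool ((?c, l, k) \<in> {(0, 1, 2), (1, 2, 0), (2, 0, 1)}))"
      unfolding AG23_parallel_sums(2,3)[OF kl] ..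
    also have "\<dots> = of_bool (k = j \<and> l = i)"
      using False ij' kl' by (elim disjE) simp_all
    finally show ?thesis .
  qed
  finally show ?thesis .
qed

section \<open>Conclusions for the two Hermitian cases and the combined theorem\<close>

theorem U24_not_completely_monotone:
  fixes M :: "'e::finite matroid_data"
  assumes M: "matroid M" "ground M = UNIV" "matroid_iso M (uniform_matroid 2 4)"
    and \<beta>: "\<beta> \<notin> {0} \<union> {1..}"
    and C: "open_convex_cone C" "C \<noteq> {}" "C \<subseteq> positive_orthant"
  shows "\<not> completely_monotone_on C (\<lambda>x. basis_gen_poly M x powr (- \<beta>))"
proof (rule iso_not_completely_monotone[OF M, where v = U24_vector and c = 1 and n = 2, unfolded U24_ground])
  show "u k = 0" if "\<And>f. f \<in> {0, 1, 2, 3} \<Longrightarrow> (\<Sum>k<2. cnj (U24_vector f k) * u k) = 0" "k < 2" for u k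
    using that by (rule U24_spanning)
  assume "0 \<le> \<beta>"
  then have "0 < \<beta>" "\<beta> < 1" using \<beta> by auto
  then have "(\<Prod>i<2. (\<beta> - 1 * real i) * (\<beta> + 1 - 1 * real i)) < 0"
    by (simp add: numeral_2_eq_2 mult_pos_neg mult_neg_pos)
  then show "\<exists>r \<kappa> w. r \<le> 2 \<and> (\<kappa> = 1 \<or> (\<forall>f\<in>{0, 1, 2, 3}. \<forall>k<2. cnj (U24_vector f k) = U24_vector f k))
    \<and> (\<forall>i<r. \<forall>j<r. \<forall>k<2. \<forall>l<2. (\<Sum>f\<in>{0, 1, 2, 3}. w i j f * (U24_vector f k * cnj (U24_vector f l)))
      = of_real \<kappa> * of_bool (k = j \<and> l = i) + of_real (1 - \<kappa>) * of_bool (k = i \<and> l = j))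
    \<and> (\<Prod>i<r. (\<beta> - \<kappa> * real i) * (\<beta> + 1 - \<kappa> * real i)) < 0"
  proof (intro exI[of _ "2::nat"] exI[of _ "1::real"] exI[of _ U24_coef] conjI allI impI)
    fix i j k l :: nat assume "i < 2" "j < 2" "k < 2" "l < 2"
    from U24_unit[OF this]
    show "(\<Sum>f\<in>{0, 1, 2, 3}. U24_coef i j f * (U24_vector f k * cnj (U24_vector f l)))
      = of_real 1 * of_bool (k = j \<and> l = i) + of_real (1 - 1) * of_bool (k = i \<and> l = j)" by simp
  qed simp_all
qed (simp, simp, rule U24_det, rule C, rule C, rule C)

theorem AG23_not_completely_monotone:
  fixes M :: "'e::finite matroid_data"
  assumes M: "matroid M" "ground M = UNIV" "matroid_iso M AG23"
    and \<beta>: "\<beta> \<notin> {0, 1} \<union> {2..}"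
    and C: "open_convex_cone C" "C \<noteq> {}" "C \<subseteq> positive_orthant"
  shows "\<not> completely_monotone_on C (\<lambda>x. basis_gen_poly M x powr (- \<beta>))"
proof -
  have ground: "ground AG23 = UNIV" by (simp add: AG23_def)
  show ?thesis
  proof (rule iso_not_completely_monotone[OF M, where v = AG23_vector and c = 3 and n = 3, unfolded ground])
    show "u k = 0" if "\<And>f. f \<in> UNIV \<Longrightarrow> (\<Sum>k<3. cnj (AG23_vector f k) * u k) = 0" "k < 3" for u k
      by (rule AG23_spanning[OF that(1)[OF UNIV_I] that(2)])
    assume "0 \<le> \<beta>"
    then have b: "0 < \<beta>" "\<beta> < 2" "\<beta> \<noteq> 1" using \<beta> by auto
    have "(\<Prod>i<3. (\<beta> - 1 * real i) * (\<beta> + 1 - 1 * real i)) = (\<beta> + 1) * \<beta>\<^sup>2 * (\<beta> - 1)\<^sup>2 * (\<beta> - 2)"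
      by (simp add: numeral_3_eq_3 power2_eq_square algebra_simps)
    also have "\<dots> < 0" using b by (intro mult_pos_neg mult_pos_pos) auto
    finally show "\<exists>r \<kappa> w. r \<le> 3 \<and> (\<kappa> = 1 \<or> (\<forall>f\<in>UNIV. \<forall>k<3. cnj (AG23_vector f k) = AG23_vector f k))
      \<and> (\<forall>i<r. \<forall>j<r. \<forall>k<3. \<forall>l<3. (\<Sum>f\<in>UNIV. w i j f * (AG23_vector f k * cnj (AG23_vector f l)))
        = of_real \<kappa> * of_bool (k = j \<and> l = i) + of_real (1 - \<kappa>) * of_bool (k = i \<and> l = j))
      \<and> (\<Prod>i<r. (\<beta> - \<kappa> * real i) * (\<beta> + 1 - \<kappa> * real i)) < 0"
    proof (intro exI[of _ "3::nat"] exI[of _ "1::real"] exI[of _ AG23_coef] conjI allI impI)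
      fix i j k l :: nat assume "i < 3" "j < 3" "k < 3" "l < 3"
      from AG23_unit[OF this]
      show "(\<Sum>f\<in>UNIV. AG23_coef i j f * (AG23_vector f k * cnj (AG23_vector f l)))
        = of_real 1 * of_bool (k = j \<and> l = i) + of_real (1 - 1) * of_bool (k = i \<and> l = j)" by simp
    qed simp_all
  qed (simp, simp, rule AG23_det, rule C, rule C, rule C)
qed

theorem proposition7p9:
  fixes M :: "('e::finite) matroid_data"
    and \<beta> :: real
  assumes "matroid M"
    and "ground M = UNIV"
  shows "(\<forall>p::nat. 2 \<le> p \<and> matroid_iso M (graphic_matroid (complete_graph_edges p))
            \<and> \<beta> \<notin> range (\<lambda>n::nat. real n / 2) \<union> {(real p - 2) / 2..}
            \<longrightarrow> (\<forall>C. open_convex_cone C \<and> C \<noteq> {} \<and> C \<subseteq> positive_orthant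
                  \<longrightarrow> \<not> completely_monotone_on C (\<lambda>x. basis_gen_poly M x powr (- \<beta>))))
       \<and> (matroid_iso M (uniform_matroid 2 4)
            \<and> \<beta> \<notin> {0} \<union> {1..}
            \<longrightarrow> (\<forall>C. open_convex_cone C \<and> C \<noteq> {} \<and> C \<subseteq> positive_orthant
                  \<longrightarrow> \<not> completely_monotone_on C (\<lambda>x. basis_gen_poly M x powr (- \<beta>))))
       \<and> (matroid_iso M AG23
            \<and> \<beta> \<notin> {0, 1} \<union> {2..}
            \<longrightarrow> (\<forall>C. open_convex_cone C \<and> C \<noteq> {} \<and> C \<subseteq> positive_orthant
                  \<longrightarrow> \<not> completely_monotone_on C (\<lambda>x. basis_gen_poly M x powr (- \<beta>))))"
proof (intro conjI allI impI; elim conjE)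
  fix p and C :: "(real ^ 'e) set"
  assume "2 \<le> p" "matroid_iso M (graphic_matroid (complete_graph_edges p))"
    "\<beta> \<notin> range (\<lambda>n::nat. real n / 2) \<union> {(real p - 2) / 2..}"
    "open_convex_cone C" "C \<noteq> {}" "C \<subseteq> positive_orthant"
  then show "\<not> completely_monotone_on C (\<lambda>x. basis_gen_poly M x powr (- \<beta>))"
    using complete_graph_not_completely_monotone[OF assms] by blast
next
  fix C :: "(real ^ 'e) set"
  assume "matroid_iso M (uniform_matroid 2 4)" "\<beta> \<notin> {0} \<union> {1..}"
    "open_convex_cone C" "C \<noteq> {}" "C \<subseteq> positive_orthant"
  then show "\<not> completely_monotone_on C (\<lambda>x. basis_gen_poly M x powr (- \<beta>))"
    using U24_not_completely_monotone[OF assms] by blast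
next
  fix C :: "(real ^ 'e) set"
  assume "matroid_iso M AG23" "\<beta> \<notin> {0, 1} \<union> {2..}"
    "open_convex_cone C" "C \<noteq> {}" "C \<subseteq> positive_orthant"
  then show "\<not> completely_monotone_on C (\<lambda>x. basis_gen_poly M x powr (- \<beta>))"
    using AG23_not_completely_monotone[OF assms] by blast
qed

end
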